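(* Let $d,k\geq 2$ and let $G$ be one of the following subgroups of $\mathrm{AAut}(\mathcal{T}_{d,k})$: (i) the commutator subgroup $F_{d,k}'$ of $F_{d,k}$; (ii) $T_{d,k}$, where $\gcd(k,d-1)=1$; (iii) the commutator subgroup $V_{d,k}'$ of $V_{d,k}$; (iv) $\mathrm{AAut}(\mathcal{T}_{d,k})$. If $\Lambda\leq\mathrm{AAut}(\mathcal{T}_{d,k})$ is commensurated by $G$ and contains a translation, then $G\leq\Lambda$.
   Context: $\mathcal{T}_{d,k}$ is the rooted tree whose root $r$ has degree $k$ and all other vertices have degree $d+1$. Its boundary $\partial\mathcal{T}_{d,k}$ is the set of rays $(r=\xi_0,\xi_1,\dots)$ with $\xi_{n+1}$ a child of $\xi_n$; with $N(\xi,\xi')$ the largest $n$ such that $\xi_n=\xi'_n$, put $\mathrm{dist}(\xi,\xi')=d^{-N(\xi,\xi')}$. A homothety is a map multiplying all distances by a fixed positive constant. An almost automorphism is a homeomorphism $g$ of $\partial\mathcal{T}_{d,k}$ for which there is a partition of $\partial\mathcal{T}_{d,k}$ into finitely many proper balls $B_1,\dots,B_n$ (an admissible partition) with each $g|_{B_i}:B_i\to g(B_i)$ a homothety; $\mathrm{AAut}(\mathcal{T}_{d,k})$ is the group of almost automorphisms. Fix an embedding of $\mathcal{T}_{d,k}$ in the oriented plane with each level on a horizontal line; this induces a total order on $\partial\mathcal{T}_{d,k}$. $V_{d,k}$ (the Higman–Thompson group) is the subgroup of almost automorphisms having an admissible partition on each part of which $g$ is order preserving; $F_{d,k}$ and $T_{d,k}$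 (Brown's generalizations of Thompson's $F$ and $T$) are the subgroups of $V_{d,k}$ consisting of elements preserving the total order, respectively the induced cyclic order, of $\partial\mathcal{T}_{d,k}$. An element $h$ is a translation if there is a ball $B$ and $n\in\mathbb{Z}$ with $h^n|_B:B\to h^n(B)$ a homothety and $h^n(B)\subsetneq B$. A subgroup $\Lambda$ is commensurated by $G$ if $g\Lambda g^{-1}\cap\Lambda$ has finite index in $\Lambda$ for all $g\in G$. *)

theory Defs
  imports "HOL-Algebra.Algebra"
begin

text \<open>Boundary of T_{d,k}: a ray is encoded by its sequence of child choices:
  xi 0 < k (choice among the k children of the root), xi (Suc n) < d
  (choice among the d children of a non-root vertex).  The vertex xi_n of the
  paper is the prefix xi 0, ..., xi (n-1).\<close>

definition Bd :: "nat \<Rightarrow> nat \<Rightarrow> (nat \<Rightarrow> nat) set" where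
  "Bd d k = {xi. xi 0 < k \<and> (\<forall>n. xi (Suc n) < d)}"

text \<open>N(xi,eta) = number of common initial choices = largest n with xi_n = eta_n.\<close>
definition Nagree :: "(nat \<Rightarrow> nat) \<Rightarrow> (nat \<Rightarrow> nat) \<Rightarrow> nat" where
  "Nagree xi eta = (LEAST n. xi n \<noteq> eta n)"

definition bdist :: "nat \<Rightarrow> (nat \<Rightarrow> nat) \<Rightarrow> (nat \<Rightarrow> nat) \<Rightarrow> real" where
  "bdist d xi eta = (if xi = eta then 0 else 1 / (real d ^ Nagree xi eta))"

definition is_ball :: "nat \<Rightarrow> nat \<Rightarrow> (nat \<Rightarrow> nat) set \<Rightarrow> bool" where
  "is_ball d k B \<longleftrightarrow> (\<exists>xi \<in> Bd d k. \<exists>r>0. B = {eta \<in> Bd d k. bdist d xi eta \<le> r})"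

definition is_proper_ball :: "nat \<Rightarrow> nat \<Rightarrow> (nat \<Rightarrow> nat) set \<Rightarrow> bool" where
  "is_proper_ball d k B \<longleftrightarrow> is_ball d k B \<and> B \<noteq> Bd d k"

definition homothety_on :: "nat \<Rightarrow> (nat \<Rightarrow> nat) set \<Rightarrow> ((nat \<Rightarrow> nat) \<Rightarrow> (nat \<Rightarrow> nat)) \<Rightarrow> bool" where
  "homothety_on d B g \<longleftrightarrow> (\<exists>c>0. \<forall>x\<in>B. \<forall>y\<in>B. bdist d (g x) (g y) = c * bdist d x y)"

definition bcontinuous :: "nat \<Rightarrow> nat \<Rightarrow> ((nat \<Rightarrow> nat) \<Rightarrow> (nat \<Rightarrow> nat)) \<Rightarrow> bool" where
  "bcontinuous d k f \<longleftrightarrow> (\<forall>x\<in>Bd d k. \<forall>e>0. \<exists>\<delta>>0. \<forall>y\<in>Bd d k.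
      bdist d x y < \<delta> \<longrightarrow> bdist d (f x) (f y) < e)"

text \<open>Homeomorphisms of the boundary, normalised to be the identity outside the boundary
  (so that they form a group under composition).\<close>
definition bhomeo :: "nat \<Rightarrow> nat \<Rightarrow> ((nat \<Rightarrow> nat) \<Rightarrow> (nat \<Rightarrow> nat)) \<Rightarrow> bool" where
  "bhomeo d k g \<longleftrightarrow> bij_betw g (Bd d k) (Bd d k) \<and> (\<forall>x. x \<notin> Bd d k \<longrightarrow> g x = x)
      \<and> bcontinuous d k g \<and> bcontinuous d k (inv_into (Bd d k) g)"

definition admissible_partition :: "nat \<Rightarrow> nat \<Rightarrow> (nat \<Rightarrow> nat) set set \<Rightarrow> bool" where
  "admissible_partition d k P \<longleftrightarrow> finite P \<and> (\<forall>B\<in>P. is_proper_ball d k B) \<and> disjoint P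
      \<and> \<Union>P = Bd d k"

definition AAut :: "nat \<Rightarrow> nat \<Rightarrow> ((nat \<Rightarrow> nat) \<Rightarrow> (nat \<Rightarrow> nat)) set" where
  "AAut d k = {g. bhomeo d k g \<and> (\<exists>P. admissible_partition d k P \<and> (\<forall>B\<in>P. homothety_on d B g))}"

definition AAut_group :: "nat \<Rightarrow> nat \<Rightarrow> ((nat \<Rightarrow> nat) \<Rightarrow> (nat \<Rightarrow> nat)) monoid" where
  "AAut_group d k = \<lparr>carrier = AAut d k, monoid.mult = (\<circ>), one = id\<rparr>"

text \<open>Total order on the boundary induced by the planar embedding (lexicographic).\<close>
definition lex_less :: "(nat \<Rightarrow> nat) \<Rightarrow> (nat \<Rightarrow> nat) \<Rightarrow> bool" where
  "lex_less xi eta \<longleftrightarrow> (\<exists>n. (\<forall>i<n. xi i = eta i) \<and> xi n < eta n)"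

definition cyc_ordered :: "(nat \<Rightarrow> nat) \<Rightarrow> (nat \<Rightarrow> nat) \<Rightarrow> (nat \<Rightarrow> nat) \<Rightarrow> bool" where
  "cyc_ordered a b c \<longleftrightarrow> (lex_less a b \<and> lex_less b c) \<or> (lex_less b c \<and> lex_less c a)
      \<or> (lex_less c a \<and> lex_less a b)"

definition order_pres_on :: "(nat \<Rightarrow> nat) set \<Rightarrow> ((nat \<Rightarrow> nat) \<Rightarrow> (nat \<Rightarrow> nat)) \<Rightarrow> bool" where
  "order_pres_on B g \<longleftrightarrow> (\<forall>x\<in>B. \<forall>y\<in>B. lex_less x y \<longrightarrow> lex_less (g x) (g y))"

definition Vgrp :: "nat \<Rightarrow> nat \<Rightarrow> ((nat \<Rightarrow> nat) \<Rightarrow> (nat \<Rightarrow> nat)) set" where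
  "Vgrp d k = {g \<in> AAut d k. \<exists>P. admissible_partition d k P \<and>
      (\<forall>B\<in>P. homothety_on d B g \<and> order_pres_on B g)}"

definition Fgrp :: "nat \<Rightarrow> nat \<Rightarrow> ((nat \<Rightarrow> nat) \<Rightarrow> (nat \<Rightarrow> nat)) set" where
  "Fgrp d k = {g \<in> Vgrp d k. order_pres_on (Bd d k) g}"

definition Tgrp :: "nat \<Rightarrow> nat \<Rightarrow> ((nat \<Rightarrow> nat) \<Rightarrow> (nat \<Rightarrow> nat)) set" where
  "Tgrp d k = {g \<in> Vgrp d k. \<forall>a\<in>Bd d k. \<forall>b\<in>Bd d k. \<forall>c\<in>Bd d k.
      cyc_ordered a b c \<longrightarrow> cyc_ordered (g a) (g b) (g c)}"

definition is_translation :: "nat \<Rightarrow> nat \<Rightarrow> ((nat \<Rightarrow> nat) \<Rightarrow> (nat \<Rightarrow> nat)) \<Rightarrow> bool" where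
  "is_translation d k h \<longleftrightarrow> h \<in> AAut d k \<and> (\<exists>B (n::int). is_ball d k B \<and>
      homothety_on d B (h [^]\<^bsub>AAut_group d k\<^esub> n) \<and> (h [^]\<^bsub>AAut_group d k\<^esub> n) ` B \<subset> B)"

definition commensurated_by :: "('a, 'b) monoid_scheme \<Rightarrow> 'a set \<Rightarrow> 'a set \<Rightarrow> bool" where
  "commensurated_by Gr G \<Lambda> \<longleftrightarrow> (\<forall>g\<in>G.
     finite (rcosets\<^bsub>Gr\<lparr>carrier := \<Lambda>\<rparr>\<^esub> (((\<lambda>x. g \<otimes>\<^bsub>Gr\<^esub> x \<otimes>\<^bsub>Gr\<^esub> inv\<^bsub>Gr\<^esub> g) ` \<Lambda>) \<inter> \<Lambda>)))"

end

(*
Let t in Lambda contract a ball and let U be a ball which is disjoint from all t^i U, i > 0. If s1, s2 in G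
have support in gU with g in G, then for suitable p and q the elements s1 (tau^p s1^-1 tau^-p) and
s2 (tau^q s2^-1 tau^-q) lie in Lambda, where tau is the conjugate by g of a power of t. Their second factors
have supports disjoint from everything else, so that [s1, s2] lies in Lambda.

In all four cases G is the commutator subgroup H' of H = F, T, V or AAut. It remains to see that H' is
generated by commutators [s1, s2] of elements with small supports, which G can push into U. For F, an element
of F' has support away from the end points, and conjugation with an injection of the boundary onto an inner
interval moves all of F away from the end points. For the other groups, the elements fixing a ball pointwise
generate H, and they commute modulo the normal subgroup N generated by the small commutators: N contains F',
which moves any ball into any other one, so that two such elements may be assumed to fix the same ball.

T is generated by caret moves and by rotations of the leaves of finite subtrees. Modulo T' the caret moves
coincide and are (d-1)-torsion, which for gcd(k, d-1) = 1 forces the rotations and hence the caret moves into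
T'. AAut is generated by swaps of neighbouring balls and isometries of balls; the latter are commutators by an
infinite swindle, and the former are conjugate to isometries.
*)
theory Submission
  imports Defs "HOL-Library.Sublist"
begin

section \<open>Bijections as an additive group\<close>

text \<open>Conjugation into \<open>\<Lambda>\<close> is granted only for elements of H', while the
  generating commutators [s1, s2] have s1 and s2 in H. Each is therefore rewritten as [[s1, h1],
  [s2, h2]], with h1 and h2 in H moving the common support W to two further places, all three
  disjoint: the entries now lie in H', and the added factors do not change the outer commutator. So
  U must receive three copies of W at once, and this decides which supports count as small. F fixes
  the two end points of the boundary, so its sets W stay away from both; T, V and AAut have no
  global fixed point, and W may be the complement of any ball.

  The second constraint is arithmetical. Expanding a leaf adds d - 1 leaves, so finite codes have
  sizes k + j (d - 1), and two codes can be matched only after expanding them by suitable multiples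
  of d - 1. The expansion counts in the constructions come from this: the excess of each code over k
  is added to the other one.\<close>

typedef 'a bp = "{f :: 'a \<Rightarrow> 'a. bij f}"
  morphisms ap Abs_bp
  by (rule exI[of _ id]) simp

lemma bij_ap [simp]: "bij (ap p)"
  using ap[of p] by simp

lemma ap_Abs [simp]: "bij f \<Longrightarrow> ap (Abs_bp f) = f"
  by (simp add: Abs_bp_inverse)

lemma bp_eqI: "(\<And>x. ap p x = ap q x) \<Longrightarrow> p = q"
  using ap_inject by blast

text \<open>The class \<open>group_add\<close> does not make \<open>+\<close> commutative, so it can
  stand for composition (the right summand acts first). The gain is that identities between group
  words become a matter of rewriting.\<close>

instantiation bp :: (type) group_add
begin
definition "p + q = Abs_bp (ap p \<circ> ap q)"
definition "0 = Abs_bp id"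
definition "- p = Abs_bp (inv_into UNIV (ap p))"
definition "p - q = p + - (q :: 'a bp)"
lemma ap_plus [simp]: "ap (p + q) = ap p \<circ> ap q"
  by (simp add: plus_bp_def bij_comp)
lemma ap_0 [simp]: "ap 0 = id"
  by (simp add: zero_bp_def)
lemma ap_uminus: "ap (- p) = inv_into UNIV (ap p)"
  by (simp add: uminus_bp_def bij_imp_bij_inv)
instance
proof
  fix a b c :: "'a bp"
  show "a + b + c = a + (b + c)" by (rule bp_eqI) simp
  show "0 + a = a" by (rule bp_eqI) simp
  show "a + 0 = a" by (rule bp_eqI) simp
  show "- a + a = 0" by (rule bp_eqI) (simp add: ap_uminus bij_is_inj)
  show "a + - b = a - b" by (simp add: minus_bp_def)
qed
end

lemma ap_uminus_ap [simp]: "ap (- p) (ap p x) = x"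
  by (simp add: ap_uminus bij_is_inj)

lemma ap_ap_uminus [simp]: "ap p (ap (- p) x) = x"
  by (simp add: ap_uminus bij_is_surj surj_f_inv_f)

lemma ap_uminus_eq: "ap (- p) x = y \<longleftrightarrow> x = ap p y"
  by (metis ap_ap_uminus ap_uminus_ap)

lemma ap_eq [simp]: "ap p x = ap p y \<longleftrightarrow> x = y"
  by (metis ap_uminus_ap)

lemma ap_diff [simp]: "ap (p - q) = ap p \<circ> ap (- q)"
  by (simp add: minus_bp_def del: add_uminus_conv_diff)

text \<open>With these rules \<^term>\<open>simp\<close> decides the word problem of the free group.\<close>
lemmas grp = add.assoc minus_add diff_conv_add_uminus

section \<open>Subgroups, commutators and conjugates in additive notation\<close>

definition sgp :: "'a :: group_add set \<Rightarrow> bool" where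
  "sgp H \<longleftrightarrow> 0 \<in> H \<and> (\<forall>a\<in>H. \<forall>b\<in>H. a + b \<in> H) \<and> (\<forall>a\<in>H. - a \<in> H)"

lemma sgp_0: "sgp H \<Longrightarrow> 0 \<in> H"
  and sgp_add: "sgp H \<Longrightarrow> a \<in> H \<Longrightarrow> b \<in> H \<Longrightarrow> a + b \<in> H"
  and sgp_neg: "sgp H \<Longrightarrow> a \<in> H \<Longrightarrow> - a \<in> H"
  by (auto simp: sgp_def)

lemma sgp_diff: "sgp H \<Longrightarrow> a \<in> H \<Longrightarrow> b \<in> H \<Longrightarrow> a - b \<in> H"
  using sgp_add[of H a "-b"] sgp_neg[of H b] by simp

lemma sgp_add_left: "sgp H \<Longrightarrow> a \<in> H \<Longrightarrow> a + b \<in> H \<longleftrightarrow> b \<in> H"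
  by (metis minus_add_cancel sgp_add sgp_neg)

inductive_set gen :: "'a :: group_add set \<Rightarrow> 'a set" for S where
  zero: "0 \<in> gen S"
| incl: "a \<in> S \<Longrightarrow> a \<in> gen S"
| add: "a \<in> gen S \<Longrightarrow> b \<in> gen S \<Longrightarrow> a + b \<in> gen S"
| neg: "a \<in> gen S \<Longrightarrow> - a \<in> gen S"

lemma sgp_gen: "sgp (gen S)"
  by (auto simp: sgp_def intro: gen.intros)

lemma gen_le: "sgp H \<Longrightarrow> S \<subseteq> H \<Longrightarrow> gen S \<subseteq> H"
proof
  fix x assume "sgp H" "S \<subseteq> H" "x \<in> gen S"
  from this(3,1,2) show "x \<in> H" by induction (auto simp: sgp_def)
qed

definition comm :: "'a :: group_add \<Rightarrow> 'a \<Rightarrow> 'a" where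
  "comm a b = a + b - a - b"

definition der :: "'a :: group_add set \<Rightarrow> 'a set" where
  "der H = gen {comm a b | a b. a \<in> H \<and> b \<in> H}"

lemma sgp_der: "sgp (der H)"
  by (simp add: der_def sgp_gen)

lemma comm_in_der: "a \<in> H \<Longrightarrow> b \<in> H \<Longrightarrow> comm a b \<in> der H"
  unfolding der_def by (rule gen.incl) blast

lemma comm_in_sgp: "sgp H \<Longrightarrow> a \<in> H \<Longrightarrow> b \<in> H \<Longrightarrow> comm a b \<in> H"
  by (simp add: comm_def sgp_add sgp_diff)

lemma der_le: "sgp H \<Longrightarrow> der H \<subseteq> H"
  unfolding der_def by (rule gen_le) (auto simp: comm_in_sgp)

lemma der_mono: "H \<subseteq> K \<Longrightarrow> der H \<subseteq> der K"
  unfolding der_def by (rule gen_le[OF sgp_gen]) (auto intro!: gen.incl)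

definition cj :: "'a :: group_add \<Rightarrow> 'a \<Rightarrow> 'a" where
  "cj g a = g + a - g"

lemma cj_add: "cj g (a + b) = cj g a + cj g b"
  and cj_neg: "cj g (- a) = - cj g a"
  and cj_0 [simp]: "cj g 0 = 0"
  and cj_comm: "cj g (comm a b) = comm (cj g a) (cj g b)"
  and cj_cj: "cj g (cj h a) = cj (g + h) a"
  by (simp_all add: cj_def comm_def grp del: add_uminus_conv_diff)

lemma cj_in_sgp: "sgp H \<Longrightarrow> a \<in> H \<Longrightarrow> b \<in> H \<Longrightarrow> cj a b \<in> H"
  by (simp add: cj_def sgp_add sgp_diff)

lemma cj_gen:
  assumes "\<And>s. s \<in> S \<Longrightarrow> cj g s \<in> gen S'" "a \<in> gen S"
  shows "cj g a \<in> gen S'"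
  using assms(2) by induction (auto simp: cj_add cj_neg intro: gen.intros assms(1))

lemma cj_der: "sgp H \<Longrightarrow> g \<in> H \<Longrightarrow> a \<in> der H \<Longrightarrow> cj g a \<in> der H"
  unfolding der_def
  by (erule cj_gen[rotated]) (use cj_in_sgp in \<open>fastforce simp: cj_comm intro!: gen.incl\<close>)

text \<open>Commuting modulo \<open>N\<close> passes to products and inverses because
  \<open>N\<close> is normalised by \<open>gen S\<close>; so it has to be tested on generators
  only.\<close>

lemma der_gen_le:
  assumes N: "sgp N" "\<And>g n. g \<in> gen S \<Longrightarrow> n \<in> N \<Longrightarrow> cj g n \<in> N"
    and S: "\<And>s t. s \<in> S \<Longrightarrow> t \<in> S \<Longrightarrow> comm s t \<in> N"
  shows "der (gen S) \<subseteq> N"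
proof -
  have sym: "comm b a \<in> N" if "comm a b \<in> N" for a b
    using sgp_neg[OF N(1) that] by (simp add: comm_def grp del: add_uminus_conv_diff)
  \<comment> \<open>Used twice: first to enlarge the left entry with the right one in
    \<open>S\<close>, then, after exchanging the entries by \<open>sym\<close>, to enlarge the other
    one.\<close>
  have extend: "comm a t \<in> N" if a: "a \<in> gen S" and t: "t \<in> gen S"
    and base: "\<And>s. s \<in> S \<Longrightarrow> comm s t \<in> N" for a t
    using a
  proof induction
    case zero
    then show ?case using N(1) by (simp add: comm_def sgp_0)
  next
    case (incl a)
    then show ?case by (rule base)
  next
    case (add a b)
    have "comm (a + b) t = cj a (comm b t) + comm a t"
      by (simp add: comm_def cj_def grp del: add_uminus_conv_diff)
    with add show ?case by (simp add: N sgp_add)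
  next
    case (neg a)
    have "comm (- a) t = cj (- a) (- comm a t)"
      by (simp add: comm_def cj_def grp del: add_uminus_conv_diff)
    with neg show ?case by (simp add: N gen.neg sgp_neg)
  qed
  have "comm a s \<in> N" if "a \<in> gen S" "s \<in> S" for a s
    by (rule extend) (use that S in \<open>auto intro: gen.incl\<close>)
  note base = this
  have "comm a b \<in> N" if "a \<in> gen S" "b \<in> gen S" for a b
    by (rule extend) (use that in \<open>auto intro: sym base\<close>)
  thus ?thesis unfolding der_def by (intro gen_le N) auto
qed

primrec npow :: "nat \<Rightarrow> 'a :: group_add \<Rightarrow> 'a" where
  "npow 0 a = 0"
| "npow (Suc n) a = npow n a + a"

lemma npow_add: "npow (m + n) a = npow m a + npow n a"
  by (induction n) (simp_all add: add.assoc)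

lemma npow_mult: "npow (m * n) a = npow n (npow m a)"
  by (induction n) (simp_all add: npow_add add.commute[of m])

lemma cj_npow: "cj g (npow n a) = npow n (cj g a)"
  by (induction n) (simp_all add: cj_add)

lemma npow_in_sgp: "sgp H \<Longrightarrow> a \<in> H \<Longrightarrow> npow n a \<in> H"
  by (induction n) (auto simp: sgp_0 sgp_add)

text \<open>Euclid's algorithm on the exponents.\<close>

lemma npow_gcd:
  assumes "sgp K" "npow m a \<in> K" "npow n a \<in> K"
  shows "npow (gcd m n) a \<in> K"
  using assms(2,3)
proof (induction m n rule: gcd_nat_induct)
  case (step m n)
  have "npow (n * (m div n)) a \<in> K"
    using step assms(1) by (simp add: npow_mult npow_in_sgp)
  moreover have "npow m a = npow (n * (m div n)) a + npow (m mod n) a"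
    by (simp flip: npow_add)
  ultimately have "npow (m mod n) a \<in> K"
    using step.prems assms(1) by (simp add: sgp_add_left)
  with step show ?case
    by (simp add: gcd_red_nat[of m n])
qed simp

section \<open>Supports\<close>

definition fixes_on :: "'a set \<Rightarrow> 'a bp \<Rightarrow> bool" where
  "fixes_on B p \<longleftrightarrow> (\<forall>x\<in>B. ap p x = x)"

lemma fixes_on_mono: "fixes_on B p \<Longrightarrow> A \<subseteq> B \<Longrightarrow> fixes_on A p"
  by (auto simp: fixes_on_def)

lemma fixes_on_neg [simp]: "fixes_on B (- p) = fixes_on B p"
  by (auto simp: fixes_on_def ap_uminus_eq)

lemma fixes_on_add: "fixes_on B p \<Longrightarrow> fixes_on B q \<Longrightarrow> fixes_on B (p + q)"
  by (auto simp: fixes_on_def)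

lemma fixes_on_cj: "fixes_on B p \<Longrightarrow> fixes_on (ap g ` B) (cj g p)"
  by (auto simp: fixes_on_def cj_def)

lemma supp_image: "fixes_on (- W) p \<Longrightarrow> x \<in> W \<Longrightarrow> ap p x \<in> W"
  by (metis ComplI ap_eq fixes_on_def)

lemma fixes_on_cj_compl: "fixes_on (- W) p \<Longrightarrow> fixes_on (- (ap g ` W)) (cj g p)"
  unfolding fixes_on_def cj_def
  by (metis ComplD ComplI ap_ap_uminus ap_diff ap_plus comp_apply image_eqI)

lemma comm_disjoint_supp:
  assumes "fixes_on (- A) p" "fixes_on (- B) q" "A \<inter> B = {}"
  shows "p + q = q + p"
proof (rule bp_eqI)
  fix x
  have "ap p x = x" if "x \<notin> A" for x using assms(1) that by (simp add: fixes_on_def)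
  moreover have "ap q x = x" if "x \<notin> B" for x using assms(2) that by (simp add: fixes_on_def)
  moreover note supp_image[OF assms(1), of x] supp_image[OF assms(2), of x]
  ultimately show "ap (p + q) x = ap (q + p) x"
    using assms(3) by (cases "x \<in> A"; cases "x \<in> B") (auto simp: disjoint_iff)
qed

text \<open>Disjoint supports make every pair among \<open>p\<close>, \<open>q\<close>,
  \<open>p'\<close>, \<open>q'\<close> commute, except possibly \<open>p\<close> and
  \<open>q\<close>; hence \<open>p'\<close> and \<open>q'\<close> cancel from the
  commutator.\<close>

lemma comm_perturb:
  assumes "fixes_on (- A) p" "fixes_on (- A) q" "fixes_on (- B) p'" "fixes_on (- C) q'"
    and "A \<inter> B = {}" "A \<inter> C = {}" "B \<inter> C = {}"
  shows "comm (p + p') (q + q') = comm p q"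
proof -
  have c: "p + p' = p' + p" "q + q' = q' + q" "p + q' = q' + p" "q + p' = p' + q" "p' + q' = q' + p'"
    using assms by (auto intro: comm_disjoint_supp)
  have 1: "p' + q + q' - p' = q + q'"
  proof -
    have "p' + q + q' - p' = q + (p' + q') - p'"
      unfolding c(4)[symmetric] by (simp only: add.assoc)
    thus ?thesis
      unfolding c(5) by (simp add: grp del: add_uminus_conv_diff)
  qed
  have 2: "q' - p - q' = - p"
    using arg_cong[OF c(3), of "\<lambda>z. - p + z - p - q'"]
    by (simp add: grp del: add_uminus_conv_diff)
  have "comm (p + p') (q + q') = p + (p' + q + q' - p') - p - q' - q"
    by (simp add: comm_def grp del: add_uminus_conv_diff)
  also have "\<dots> = p + q + (q' - p - q') - q"
    unfolding 1 by (simp add: grp del: add_uminus_conv_diff)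
  also have "\<dots> = comm p q"
    unfolding 2 by (simp add: comm_def grp del: add_uminus_conv_diff)
  finally show ?thesis .
qed

section \<open>Commensurated subgroups\<close>

text \<open>A set disjoint from its forward images is wandering: apply \<open>npow i t\<close> to
  the disjointness for the exponent \<open>j - i\<close>.\<close>

lemma npow_image_disjoint:
  assumes "\<And>i. i > 0 \<Longrightarrow> ap (npow i t) ` U \<inter> U = {}" and "i < j"
  shows "ap (npow i t) ` U \<inter> ap (npow j t) ` U = {}"
proof -
  have "npow j t = npow i t + npow (j - i) t"
    using assms(2) by (simp flip: npow_add)
  hence "ap (npow j t) ` U = ap (npow i t) ` ap (npow (j - i) t) ` U"
    by (simp add: image_image)
  moreover have "ap (npow (j - i) t) ` U \<inter> U = {}"
    using assms by simp
  ultimately show ?thesis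
    by (metis Int_commute bij_ap bij_is_inj image_Int image_empty)
qed

text \<open>If \<open>\<tau>\<close> moves the common support of \<open>s\<^sub>1, s\<^sub>2\<close> off itself under all positive powers, then
  \<open>s\<^sub>i (\<tau>\<^sup>p s\<^sub>i\<^sup>-\<^sup>1 \<tau>\<^sup>-\<^sup>p)\<close> lies in \<open>\<Lambda>\<close> for suitable \<open>p\<close>, and with different \<open>p\<close> for \<open>i = 1, 2\<close>
  the second factors do not contribute to the commutator.\<close>
lemma comm_in_commensurated:
  fixes G L :: "'a bp set"
  assumes L: "sgp L"
    and wc: "\<And>g \<tau>. g \<in> G \<Longrightarrow> \<tau> \<in> L \<Longrightarrow> \<exists>n>0. cj g (npow n \<tau>) \<in> L"
    and t: "t \<in> L" "\<And>i. i > 0 \<Longrightarrow> ap (npow i t) ` U \<inter> U = {}"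
    and g: "g \<in> G" and s: "s1 \<in> G" "s2 \<in> G"
    and supp: "fixes_on (- (ap g ` U)) s1" "fixes_on (- (ap g ` U)) s2"
  shows "comm s1 s2 \<in> L"
proof -
  obtain m where m: "m > 0" "cj g (npow m t) \<in> L" using wc[OF g t(1)] by blast
  define \<tau> where "\<tau> = cj g (npow m t)"
  define W where "W = ap g ` U"
  have \<tau>L: "\<tau> \<in> L" using m(2) by (simp add: \<tau>_def)
  have \<tau>W: "ap (npow i \<tau>) ` W = ap g ` ap (npow (m * i) t) ` U" for i
    unfolding \<tau>_def W_def cj_npow[symmetric] npow_mult[symmetric]
    by (simp add: cj_def image_image)
  have disj: "ap (npow i \<tau>) ` W \<inter> W = {}" if "i > 0" for i
    unfolding \<tau>W unfolding W_def using t(2)[of "m * i"] m that by auto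
  obtain n1 where n1: "n1 > 0" "cj s1 (npow n1 \<tau>) \<in> L" using wc[OF s(1) \<tau>L] by blast
  obtain n2 where n2: "n2 > 0" "cj s2 (npow n2 \<tau>) \<in> L" using wc[OF s(2) \<tau>L] by blast
  \<comment> \<open>A multiple of \<open>n2\<close>, so that \<open>s2\<close> still conjugates this
    power of \<tau> into \<open>L\<close>, and larger than \<open>n1\<close>, so that the two
    translates of \<open>W\<close> are disjoint.\<close>
  define q where "q = n2 * Suc n1"
  have "n1 < q" unfolding q_def using n2(1) by (cases n2) auto
  have q: "cj s2 (npow q \<tau>) \<in> L"
    unfolding q_def npow_mult cj_npow[of _ "Suc n1"] by (rule npow_in_sgp[OF L n2(2)])
  \<comment> \<open>Rebracketing: s (\<tau>^p s^-1 \<tau>^-p) = (s \<tau>^p s^-1) \<tau>^-p is a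
    product of two elements of \<open>L\<close>.\<close>
  have in_L: "s + cj (npow p \<tau>) (- s) \<in> L" if "cj s (npow p \<tau>) \<in> L" for s p
  proof -
    have "s + cj (npow p \<tau>) (- s) = cj s (npow p \<tau>) - npow p \<tau>"
      by (simp add: cj_def grp del: add_uminus_conv_diff)
    thus ?thesis
      using that L \<tau>L by (simp add: sgp_diff npow_in_sgp)
  qed
  have "comm s1 s2 = comm (s1 + cj (npow n1 \<tau>) (- s1)) (s2 + cj (npow q \<tau>) (- s2))"
  proof (rule comm_perturb[symmetric])
    show "fixes_on (- W) s1" "fixes_on (- W) s2" using supp by (simp_all add: W_def)
    thus "fixes_on (- (ap (npow n1 \<tau>) ` W)) (cj (npow n1 \<tau>) (- s1))"
      "fixes_on (- (ap (npow q \<tau>) ` W)) (cj (npow q \<tau>) (- s2))"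
      by (simp_all add: fixes_on_cj_compl)
    show "W \<inter> ap (npow n1 \<tau>) ` W = {}" "W \<inter> ap (npow q \<tau>) ` W = {}"
      using disj[of n1] disj[of q] n1 \<open>n1 < q\<close> by auto
    show "ap (npow n1 \<tau>) ` W \<inter> ap (npow q \<tau>) ` W = {}"
      by (rule npow_image_disjoint[OF disj \<open>n1 < q\<close>])
  qed
  thus ?thesis
    using in_L[OF n1(2)] in_L[OF q] L by (simp add: comm_in_sgp)
qed

definition small_comms :: "'a bp set \<Rightarrow> 'a set set \<Rightarrow> 'a bp set" where
  "small_comms H \<W> = {comm s1 s2 | s1 s2. s1 \<in> H \<and> s2 \<in> H \<and> (\<exists>W\<in>\<W>. fixes_on (- W) s1 \<and> fixes_on (- W) s2)}"

text \<open>The condition \<open>push\<close> provides room in \<open>U\<close> for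
  \<open>W\<close>, which carries \<open>s1\<close> and \<open>s2\<close>, and for one more copy
  each to carry the correcting factors in \<open>comm s1 h1\<close> and
  \<open>comm s2 h2\<close>.\<close>

lemma der_le_commensurated:
  fixes H L :: "'a bp set"
  assumes H: "sgp H" and L: "sgp L"
    and wc: "\<And>g \<tau>. g \<in> der H \<Longrightarrow> \<tau> \<in> L \<Longrightarrow> \<exists>n>0. cj g (npow n \<tau>) \<in> L"
    and t: "t \<in> L" "\<And>i. i > 0 \<Longrightarrow> ap (npow i t) ` U \<inter> U = {}"
    and frag: "der H \<subseteq> gen (small_comms H \<W>)"
    and push: "\<And>W. W \<in> \<W> \<Longrightarrow> \<exists>h1\<in>H. \<exists>h2\<in>H. \<exists>g\<in>der H. W \<inter> ap h1 ` W = {} \<and> W \<inter> ap h2 ` W = {}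
      \<and> ap h1 ` W \<inter> ap h2 ` W = {} \<and> ap g ` (W \<union> ap h1 ` W \<union> ap h2 ` W) \<subseteq> U"
  shows "der H \<subseteq> L"
proof -
  have "comm s1 s2 \<in> L" if s: "s1 \<in> H" "s2 \<in> H" and W: "W \<in> \<W>"
    and f: "fixes_on (- W) s1" "fixes_on (- W) s2" for s1 s2 W
  proof -
    obtain h1 h2 g where h: "h1 \<in> H" "h2 \<in> H" and g: "g \<in> der H"
      and disj: "W \<inter> ap h1 ` W = {}" "W \<inter> ap h2 ` W = {}" "ap h1 ` W \<inter> ap h2 ` W = {}"
      and gU: "ap g ` (W \<union> ap h1 ` W \<union> ap h2 ` W) \<subseteq> U"
      using push[OF W] by (elim bexE conjE) iprover
    have sub: "W \<union> ap h1 ` W \<union> ap h2 ` W \<subseteq> ap (- g) ` U"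
    proof
      fix x assume "x \<in> W \<union> ap h1 ` W \<union> ap h2 ` W"
      hence "ap g x \<in> U" using gU by blast
      thus "x \<in> ap (- g) ` U" by (metis ap_uminus_ap image_eqI)
    qed
    have eq: "comm s h = s + cj h (- s)" for s h :: "'a bp"
      by (simp add: comm_def cj_def grp del: add_uminus_conv_diff)
    have supp: "fixes_on (- (ap (- g) ` U)) (comm s h)"
      if "fixes_on (- W) s" "ap h ` W \<subseteq> ap (- g) ` U" for s h
      unfolding eq using that sub fixes_on_cj_compl[of W "- s" h]
      by (intro fixes_on_add) (auto elim!: fixes_on_mono)
    have "comm s1 s2 = comm (comm s1 h1) (comm s2 h2)"
      unfolding eq[of s1 h1] eq[of s2 h2] using f disj 
      by (intro comm_perturb[where A = W and B = "ap h1 ` W" and C = "ap h2 ` W", symmetric])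
        (simp_all add: fixes_on_cj_compl)
    also have "\<dots> \<in> L"
    proof (rule comm_in_commensurated[OF L wc t])
      show "- g \<in> der H" by (rule sgp_neg[OF sgp_der g])
      show "comm s1 h1 \<in> der H" "comm s2 h2 \<in> der H" using s h by (simp_all add: comm_in_der)
      show "fixes_on (- (ap (- g) ` U)) (comm s1 h1)" using f(1) sub by (intro supp) auto
      show "fixes_on (- (ap (- g) ` U)) (comm s2 h2)" using f(2) sub by (intro supp) auto
    qed
    finally show ?thesis .
  qed
  hence "gen (small_comms H \<W>) \<subseteq> L"
    by (intro gen_le[OF L]) (auto simp: small_comms_def)
  with frag show ?thesis by simp
qed

section \<open>Words and cylinders\<close>

definition cat :: "nat list \<Rightarrow> (nat \<Rightarrow> nat) \<Rightarrow> nat \<Rightarrow> nat" (infixr "\<frown>" 65) where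
  "w \<frown> y = (\<lambda>n. if n < length w then w ! n else y (n - length w))"

definition pre :: "nat \<Rightarrow> (nat \<Rightarrow> nat) \<Rightarrow> nat list" where
  "pre n x = map x [0..<n]"

definition dr :: "nat \<Rightarrow> (nat \<Rightarrow> nat) \<Rightarrow> nat \<Rightarrow> nat" where
  "dr n x = (\<lambda>i. x (n + i))"

lemma length_pre [simp]: "length (pre n x) = n"
  by (simp add: pre_def)

lemma nth_pre [simp]: "i < n \<Longrightarrow> pre n x ! i = x i"
  by (simp add: pre_def)

lemma cat_pre_dr [simp]: "pre n x \<frown> dr n x = x"
  by (auto simp: cat_def dr_def)

lemma cat_append: "(w @ s) \<frown> y = w \<frown> s \<frown> y"
  by (auto simp: cat_def nth_append fun_eq_iff)

lemma cat_nth [simp]: "i < length w \<Longrightarrow> (w \<frown> y) i = w ! i"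
  by (simp add: cat_def)

lemma cat_shift [simp]: "(w \<frown> y) (length w + n) = y n"
  by (simp add: cat_def)

lemma pre_cat [simp]: "pre (length w) (w \<frown> y) = w"
  by (rule nth_equalityI) auto

lemma dr_cat [simp]: "dr (length w) (w \<frown> y) = y"
  by (simp add: cat_def dr_def)

lemma cat_eq_iff [simp]: "w \<frown> y = w \<frown> z \<longleftrightarrow> y = z"
  by (metis dr_cat)

lemma pre_eq_iff: "pre n x = pre n y \<longleftrightarrow> (\<forall>i<n. x i = y i)"
  by (metis length_pre nth_equalityI nth_pre)

lemma take_pre: "m \<le> n \<Longrightarrow> take m (pre n x) = pre m x"
  by (rule nth_equalityI) auto

lemma pre_prefix: "m \<le> n \<Longrightarrow> prefix (pre m x) (pre n x)"
  by (metis take_is_prefix take_pre)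

lemma Nagree_neq: "x \<noteq> y \<Longrightarrow> x (Nagree x y) \<noteq> y (Nagree x y)"
  unfolding Nagree_def by (rule LeastI_ex) (auto simp: fun_eq_iff)

lemma Nagree_less: "i < Nagree x y \<Longrightarrow> x i = y i"
  unfolding Nagree_def using not_less_Least by blast

lemma Nagree_eqI: "(\<And>i. i < n \<Longrightarrow> x i = y i) \<Longrightarrow> x n \<noteq> y n \<Longrightarrow> Nagree x y = n"
  unfolding Nagree_def by (rule Least_equality) (auto simp: not_less[symmetric])

lemma Nagree_ge: "x \<noteq> y \<Longrightarrow> n \<le> Nagree x y \<longleftrightarrow> pre n x = pre n y"
  by (metis Nagree_less Nagree_neq dual_order.strict_trans2 linorder_not_less pre_eq_iff)

lemma Nagree_commute: "Nagree x y = Nagree y x"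
  by (simp add: Nagree_def eq_commute)

lemma Nagree_cat: "y \<noteq> z \<Longrightarrow> Nagree (w \<frown> y) (w \<frown> z) = length w + Nagree y z"
  by (rule Nagree_eqI) (simp_all add: Nagree_neq, simp add: cat_def Nagree_less)

lemma lex_less_iff: "lex_less x y \<longleftrightarrow> x \<noteq> y \<and> x (Nagree x y) < y (Nagree x y)"
proof
  assume "lex_less x y"
  then obtain n where n: "\<forall>i<n. x i = y i" "x n < y n" by (auto simp: lex_less_def)
  hence "Nagree x y = n" by (intro Nagree_eqI) auto
  thus "x \<noteq> y \<and> x (Nagree x y) < y (Nagree x y)" using n by auto
next
  assume "x \<noteq> y \<and> x (Nagree x y) < y (Nagree x y)"
  hence "(\<forall>i<Nagree x y. x i = y i) \<and> x (Nagree x y) < y (Nagree x y)" by (simp add: Nagree_less)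
  thus "lex_less x y" unfolding lex_less_def by blast
qed

lemma lex_less_linear: "x = y \<or> lex_less x y \<or> lex_less y x"
  by (metis Nagree_commute Nagree_neq lex_less_iff linorder_neq_iff)

lemma lex_less_irrefl [simp]: "\<not> lex_less x x"
  by (simp add: lex_less_iff)

lemma lex_less_trans: "lex_less x y \<Longrightarrow> lex_less y z \<Longrightarrow> lex_less x z"
proof -
  assume "lex_less x y" "lex_less y z"
  then obtain m n where "\<forall>i<m. x i = y i" "x m < y m" "\<forall>i<n. y i = z i" "y n < z n"
    by (auto simp: lex_less_def)
  hence "(\<forall>i<min m n. x i = z i) \<and> x (min m n) < z (min m n)"
    by (cases m n rule: linorder_cases) (auto simp: min_def)
  thus ?thesis unfolding lex_less_def by blast
qed

lemma lex_less_asym: "lex_less x y \<Longrightarrow> \<not> lex_less y x"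
  using lex_less_trans by fastforce

lemma lex_less_cat [simp]: "lex_less (w \<frown> y) (w \<frown> z) \<longleftrightarrow> lex_less y z"
  by (cases "y = z") (simp_all add: lex_less_iff Nagree_cat)

lemma order_pres_onD: "order_pres_on B g \<Longrightarrow> x \<in> B \<Longrightarrow> y \<in> B \<Longrightarrow> lex_less x y \<Longrightarrow> lex_less (g x) (g y)"
  by (simp add: order_pres_on_def)

lemma order_pres_on_ap_iff:
  assumes "order_pres_on B (ap p)" "x \<in> B" "y \<in> B"
  shows "lex_less (ap p x) (ap p y) \<longleftrightarrow> lex_less x y"
  by (metis assms lex_less_asym lex_less_irrefl lex_less_linear order_pres_onD)

section \<open>The boundary of the tree and its balls\<close>

locale tree =
  fixes d k :: nat
  assumes d2: "d \<ge> 2" and k2: "k \<ge> 2"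
begin

abbreviation \<Omega> :: "(nat \<Rightarrow> nat) set" where "\<Omega> \<equiv> Bd d k"

text \<open>The common model of all proper balls: rays below a vertex other than the root, where
  already the first choice is among \<open>d\<close> children.\<close>

definition Tl :: "(nat \<Rightarrow> nat) set" where "Tl = {y. \<forall>n. y n < d}"

text \<open>\<open>vw\<close> describes the vertices other than the root, as words of child choices, and \<open>tw\<close> the
  words leading from such a vertex to a descendant; \<open>cyl w\<close> is the ball of rays through \<open>w\<close>.\<close>
definition tw :: "nat list \<Rightarrow> bool" where "tw s \<longleftrightarrow> set s \<subseteq> {..<d}"

definition vw :: "nat list \<Rightarrow> bool" where "vw w \<longleftrightarrow> w \<noteq> [] \<and> hd w < k \<and> tw (tl w)"

definition cyl :: "nat list \<Rightarrow> (nat \<Rightarrow> nat) set" where "cyl w = (\<lambda>y. w \<frown> y) ` Tl"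

lemma vw_append: "vw w \<Longrightarrow> vw (w @ s) \<longleftrightarrow> tw s"
  by (auto simp: vw_def tw_def)

lemma vw_prefix: "vw (w @ s) \<Longrightarrow> w \<noteq> [] \<Longrightarrow> vw w"
  by (auto simp: vw_def tw_def)

lemma vw_not_Nil: "vw w \<Longrightarrow> w \<noteq> []"
  by (simp add: vw_def)

lemma vw_length: "vw w \<Longrightarrow> length w > 0"
  by (simp add: vw_def)

lemma vw_hd_iff: "vw (a # s) \<longleftrightarrow> a < k \<and> tw s"
  by (simp add: vw_def)

lemma tw_simps [simp]: "tw []" "tw (a # s) \<longleftrightarrow> a < d \<and> tw s" "tw (s @ t) \<longleftrightarrow> tw s \<and> tw t"
  by (auto simp: tw_def)

lemma Tl_const: "a < d \<Longrightarrow> (\<lambda>_. a) \<in> Tl"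
  by (simp add: Tl_def)

lemma Tl_dr: "y \<in> Tl \<Longrightarrow> dr n y \<in> Tl"
  by (simp add: Tl_def dr_def)

lemma Tl_pre: "y \<in> Tl \<Longrightarrow> tw (pre n y)"
  by (auto simp: Tl_def tw_def pre_def)

lemma Tl_cat: "s \<frown> y \<in> Tl \<longleftrightarrow> tw s \<and> y \<in> Tl"
proof
  assume "s \<frown> y \<in> Tl"
  thus "tw s \<and> y \<in> Tl"
    using Tl_pre[of "s \<frown> y" "length s"] Tl_dr[of "s \<frown> y" "length s"] by simp
qed (auto simp: Tl_def tw_def cat_def subset_iff)

lemma X_dr: "x \<in> \<Omega> \<Longrightarrow> n > 0 \<Longrightarrow> dr n x \<in> Tl"
  by (cases n) (auto simp: Bd_def Tl_def dr_def)

lemma X_pre: "x \<in> \<Omega> \<Longrightarrow> n > 0 \<Longrightarrow> vw (pre n x)"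
proof -
  assume x: "x \<in> \<Omega>" and n: "n > 0"
  have "x i < d" if "i > 0" for i using x that by (auto simp: Bd_def gr0_conv_Suc)
  moreover have "x 0 < k" using x by (simp add: Bd_def)
  moreover have "pre n x = x 0 # map x [1..<n]" using n by (simp add: pre_def upt_conv_Cons)
  ultimately show ?thesis by (auto simp: vw_def tw_def)
qed

lemma X_cat: "vw w \<Longrightarrow> w \<frown> y \<in> \<Omega> \<longleftrightarrow> y \<in> Tl"
proof
  assume "vw w" "w \<frown> y \<in> \<Omega>"
  thus "y \<in> Tl" using X_dr[of "w \<frown> y" "length w"] vw_length by simp
next
  assume w: "vw w" and y: "y \<in> Tl"
  then obtain a s where [simp]: "w = a # s" by (cases w) (auto simp: vw_def)
  have "w \<frown> y = [a] \<frown> s \<frown> y" by (simp flip: cat_append)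
  moreover have "s \<frown> y \<in> Tl" using w y by (simp add: Tl_cat vw_hd_iff)
  moreover have "[a] \<frown> z \<in> \<Omega>" if "z \<in> Tl" for z
    using w that by (simp add: Bd_def Tl_def cat_def vw_hd_iff)
  ultimately show "w \<frown> y \<in> \<Omega>" by simp
qed

lemma cyl_iff: "vw w \<Longrightarrow> x \<in> cyl w \<longleftrightarrow> x \<in> \<Omega> \<and> pre (length w) x = w"
  unfolding cyl_def using X_cat X_dr vw_length by (auto simp: image_iff) (metis cat_pre_dr)

lemma cylI: "y \<in> Tl \<Longrightarrow> w \<frown> y \<in> cyl w"
  by (simp add: cyl_def)

lemma cylE: "x \<in> cyl w \<Longrightarrow> (\<And>y. y \<in> Tl \<Longrightarrow> x = w \<frown> y \<Longrightarrow> P) \<Longrightarrow> P"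
  by (auto simp: cyl_def)

lemma cat_in_cyl [simp]: "w \<frown> y \<in> cyl w \<longleftrightarrow> y \<in> Tl"
  by (auto simp: cyl_def)

lemma cyl_sub_X: "vw w \<Longrightarrow> cyl w \<subseteq> \<Omega>"
  by (auto simp: cyl_iff)

lemma cyl_append_sub: "tw s \<Longrightarrow> cyl (w @ s) \<subseteq> cyl w"
  by (auto simp: cyl_def cat_append Tl_cat)

lemma cyl_nonempty: "cyl w \<noteq> {}"
  using Tl_const[of 0] d2 by (auto simp: cyl_def)

lemma cyl_ex: "vw w \<Longrightarrow> \<exists>x. x \<in> \<Omega> \<and> x \<in> cyl w"
  using cyl_nonempty cyl_sub_X by blast

lemma X_in_cyl: "x \<in> \<Omega> \<Longrightarrow> n > 0 \<Longrightarrow> x \<in> cyl (pre n x)"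
  by (simp add: cyl_iff X_pre)

text \<open>The ultrametric dichotomy: two balls are disjoint or nested.\<close>

lemma cyl_meet_prefix:
  assumes "x \<in> cyl v" "x \<in> cyl w" "vw v" "vw w" "length v \<le> length w"
  obtains s where "w = v @ s" "tw s"
  using assms by (metis cyl_iff pre_prefix prefixE vw_append)

lemma cyl_pre_sub: "x \<in> cyl w \<Longrightarrow> vw w \<Longrightarrow> length w \<le> n \<Longrightarrow> cyl (pre n x) \<subseteq> cyl w"
proof -
  assume x: "x \<in> cyl w" and w: "vw w" and n: "length w \<le> n"
  have "x \<in> \<Omega>" "n > 0" using x n vw_length[OF w] cyl_sub_X[OF w] by (auto, linarith)
  then obtain s where "pre n x = w @ s" "tw s"
    using cyl_meet_prefix[OF x X_in_cyl w X_pre] n by (metis length_pre)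
  thus ?thesis using cyl_append_sub by simp
qed

lemma cyl_disjoint_same_length:
  "vw v \<Longrightarrow> vw w \<Longrightarrow> length v = length w \<Longrightarrow> v \<noteq> w \<Longrightarrow> cyl v \<inter> cyl w = {}"
  by (auto simp: cyl_iff)

lemma Nagree_cyl: "x \<in> cyl w \<Longrightarrow> y \<in> cyl w \<Longrightarrow> x \<noteq> y \<Longrightarrow> length w \<le> Nagree x y"
  by (auto simp: cyl_def Nagree_cat)

lemma Nagree_cylI: "x \<in> cyl w \<Longrightarrow> vw w \<Longrightarrow> y \<in> \<Omega> \<Longrightarrow> x = y \<or> length w \<le> Nagree x y \<Longrightarrow> y \<in> cyl w"
  using Nagree_ge[of x y "length w"] by (cases "x = y") (auto simp: cyl_iff)

lemma finite_words: "finite {w. vw w \<and> length w = n}"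
proof (rule finite_subset)
  have "set w \<subseteq> {..<d + k}" if "vw w" for w
    using that by (cases w) (auto simp: vw_def tw_def)
  thus "{w. vw w \<and> length w = n} \<subseteq> {w. set w \<subseteq> {..<d + k} \<and> length w = n}"
    by blast
qed (simp add: finite_lists_length_eq)

lemma bdist_le_iff:
  assumes "x \<noteq> y" shows "bdist d x y \<le> 1 / real d ^ n \<longleftrightarrow> n \<le> Nagree x y"
  using assms d2 by (auto simp: bdist_def divide_simps)

lemma ex_power_less: "r > 0 \<Longrightarrow> \<exists>n. 1 / real d ^ n < r"
  using real_arch_pow_inv[of r "1 / real d"] d2 by (auto simp: power_one_over)

lemma bdist_le_power_iff: "bdist d x y \<le> 1 / real d ^ n \<longleftrightarrow> pre n x = pre n y"
  using bdist_le_iff[of x y n] d2 by (cases "x = y") (auto simp: Nagree_ge bdist_def)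

lemma is_ball_cases:
  assumes "is_ball d k B"
  obtains "B = \<Omega>" | w where "vw w" "B = cyl w"
proof -
  obtain \<xi> r where xi: "\<xi> \<in> \<Omega>" and r: "r > 0" and B: "B = {eta \<in> \<Omega>. bdist d \<xi> eta \<le> r}"
    using assms unfolding is_ball_def by blast
  \<comment> \<open>Distances take only the values 0 and d^-n, so the radius may be lowered to the
    largest such power below it. The value \<open>n = 0\<close> gives the whole boundary.\<close>
  define n where "n = (LEAST n. 1 / real d ^ n \<le> r)"
  have "\<exists>n. 1 / real d ^ n \<le> r" using ex_power_less[OF r] less_imp_le by blast
  hence n: "1 / real d ^ n \<le> r" unfolding n_def by (rule LeastI_ex)
  have iff: "bdist d \<xi> y \<le> r \<longleftrightarrow> pre n \<xi> = pre n y" for y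
  proof
    assume "bdist d \<xi> y \<le> r"
    hence "n \<le> Nagree \<xi> y" if "\<xi> \<noteq> y"
      unfolding n_def using that by (intro Least_le) (simp add: bdist_def)
    thus "pre n \<xi> = pre n y" using Nagree_ge by metis
  next
    assume "pre n \<xi> = pre n y"
    hence "bdist d \<xi> y \<le> 1 / real d ^ n" by (simp add: bdist_le_power_iff)
    thus "bdist d \<xi> y \<le> r" using n by linarith
  qed
  have B': "y \<in> B \<longleftrightarrow> y \<in> \<Omega> \<and> pre n y = pre n \<xi>" for y unfolding B mem_Collect_eq iff by metis
  show ?thesis
  proof (cases n)
    case 0
    hence "B = \<Omega>" using B' by (auto simp: pre_def)
    thus ?thesis by (rule that)
  next
    case (Suc m)
    hence "vw (pre n \<xi>)" using xi by (simp add: X_pre)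
    moreover have "B = cyl (pre n \<xi>)" using B' cyl_iff[OF calculation] by auto
    ultimately show ?thesis by (rule that)
  qed
qed

text \<open>As k \<ge> 2, the root has a child \<open>a\<close> different from the first letter of
  \<open>w\<close>.\<close>

lemma cyl_neq_X: "vw w \<Longrightarrow> cyl w \<noteq> \<Omega>"
proof
  assume w: "vw w" "cyl w = \<Omega>"
  define a where "a = (if hd w = 0 then 1 else 0 :: nat)"
  have "vw [a]" using k2 by (simp add: vw_def a_def)
  then obtain x where x: "x \<in> \<Omega>" "x \<in> cyl [a]" using cyl_ex by blast
  hence "x \<in> cyl w" using w by simp
  have "pre 1 x = [a]" "pre (length w) x = w"
    using x(2) \<open>x \<in> cyl w\<close> cyl_iff[OF \<open>vw [a]\<close>] cyl_iff[OF w(1)] by auto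
  hence "x 0 = a" "x 0 = w ! 0"
    using nth_pre[of 0 "length w" x] vw_length[OF w(1)] by (simp_all add: pre_def)
  hence "a = w ! 0" by simp
  thus False using w(1) by (auto simp: a_def vw_def hd_conv_nth split: if_splits)
qed

lemma is_ball_cyl: "vw w \<Longrightarrow> is_ball d k (cyl w)"
proof -
  assume w: "vw w"
  then obtain x where x: "x \<in> \<Omega>" "x \<in> cyl w" using cyl_ex by blast
  have "cyl w = {y \<in> \<Omega>. bdist d x y \<le> 1 / real d ^ length w}"
    using w x by (auto simp: bdist_le_power_iff cyl_iff)
  thus ?thesis unfolding is_ball_def using x d2
    by (intro bexI[of _ x] exI[of _ "1 / real d ^ length w"]) auto
qed

lemma is_proper_ball_iff: "is_proper_ball d k B \<longleftrightarrow> (\<exists>w. vw w \<and> B = cyl w)"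
  unfolding is_proper_ball_def using is_ball_cyl cyl_neq_X is_ball_cases by metis

end

section \<open>Almost automorphisms, locally\<close>

text \<open>Meant for the permutation of the \<open>d\<close> children of a vertex induced by an
  order preserving homothety. Counting up from 0 gives \<open>i \<le> f i\<close>, counting down
  from \<open>d - 1\<close> the converse.\<close>

lemma strict_mono_self_map:
  fixes f :: "nat \<Rightarrow> nat"
  assumes "\<And>i j. i < j \<Longrightarrow> j < d \<Longrightarrow> f i < f j" "\<And>i. i < d \<Longrightarrow> f i < d" "i < d"
  shows "f i = i"
proof -
  have low: "i \<le> f i" if "i < d" for i
    using that
  proof (induction i)
    case (Suc i)
    thus ?case using assms(1)[of i "Suc i"] by fastforce
  qed simp
  have up: "f i + j \<le> f (i + j)" if "i + j < d" for j
    using that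
  proof (induction j)
    case (Suc j)
    thus ?case using assms(1)[of "i + j" "Suc (i + j)"] by fastforce
  qed simp
  show ?thesis
    using low[of i] up[of "d - 1 - i"] assms(2)[of "d - 1"] assms(3) by simp
qed

context tree
begin

lemma fixes_on_image: "fixes_on (- \<Omega>) p \<Longrightarrow> x \<in> \<Omega> \<Longrightarrow> ap p x \<in> \<Omega>"
  by (rule supp_image)

text \<open>\<open>hm p w v\<close>: \<open>p\<close> is a homothety of the ball of \<open>w\<close> onto the ball of \<open>v\<close>. \<open>pr p w v\<close>: it is moreover
  order preserving, that is, the prefix \<open>w\<close> is replaced by \<open>v\<close>.\<close>
definition hm :: "(nat \<Rightarrow> nat) bp \<Rightarrow> nat list \<Rightarrow> nat list \<Rightarrow> bool" where
  "hm p w v \<longleftrightarrow> vw w \<and> vw v \<and> ap p ` cyl w = cyl v \<and> (\<forall>x\<in>cyl w. \<forall>y\<in>cyl w. x \<noteq> y \<longrightarrow>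
     Nagree (ap p x) (ap p y) + length w = Nagree x y + length v)"

definition pr :: "(nat \<Rightarrow> nat) bp \<Rightarrow> nat list \<Rightarrow> nat list \<Rightarrow> bool" where
  "pr p w v \<longleftrightarrow> vw w \<and> vw v \<and> (\<forall>y\<in>Tl. ap p (w \<frown> y) = v \<frown> y)"

text \<open>Finite partitions into balls are traded for whole levels of the tree, which are easier
  to refine and compare. The level is \<open>Suc n\<close> because the root is not among the words
  of \<open>vw\<close>.\<close>

definition locally :: "((nat \<Rightarrow> nat) bp \<Rightarrow> nat list \<Rightarrow> nat list \<Rightarrow> bool) \<Rightarrow> (nat \<Rightarrow> nat) bp \<Rightarrow> bool" where
  "locally R p \<longleftrightarrow> fixes_on (- \<Omega>) p \<and> (\<exists>n. \<forall>w. vw w \<and> length w = Suc n \<longrightarrow> (\<exists>v. R p w v))"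

text \<open>What \<open>hm\<close> and \<open>pr\<close> share and what makes
  \<open>locally R\<close> a group, so that AAut and V are handled by the same lemmas.\<close>

definition good :: "((nat \<Rightarrow> nat) bp \<Rightarrow> nat list \<Rightarrow> nat list \<Rightarrow> bool) \<Rightarrow> bool" where
  "good R \<longleftrightarrow> (\<forall>p w v. R p w v \<longrightarrow> vw w \<and> vw v \<and> ap p ` cyl w = cyl v)
     \<and> (\<forall>p w v s. R p w v \<longrightarrow> tw s \<longrightarrow> (\<exists>s'. tw s' \<and> length s' = length s \<and> R p (w @ s) (v @ s')))
     \<and> (\<forall>p q w v u. R p w v \<longrightarrow> R q v u \<longrightarrow> R (q + p) w u)
     \<and> (\<forall>p w v. R p w v \<longrightarrow> R (- p) v w) \<and> (\<forall>w. vw w \<longrightarrow> R 0 w w)"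

lemma goodD:
  assumes "good R"
  shows "R p w v \<Longrightarrow> vw w" "R p w v \<Longrightarrow> vw v" "R p w v \<Longrightarrow> ap p ` cyl w = cyl v"
    and "R p w v \<Longrightarrow> tw s \<Longrightarrow> \<exists>s'. tw s' \<and> length s' = length s \<and> R p (w @ s) (v @ s')"
    and "R p w v \<Longrightarrow> R q v u \<Longrightarrow> R (q + p) w u"
    and "R p w v \<Longrightarrow> R (- p) v w" "vw w \<Longrightarrow> R 0 w w"
proof -
  note g = assms[unfolded good_def]
  note a = g[THEN conjunct1, rule_format]
    and b = g[THEN conjunct2, THEN conjunct1, rule_format]
    and c = g[THEN conjunct2, THEN conjunct2, THEN conjunct1, rule_format]
    and e = g[THEN conjunct2, THEN conjunct2, THEN conjunct2, THEN conjunct1, rule_format]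
    and f = g[THEN conjunct2, THEN conjunct2, THEN conjunct2, THEN conjunct2, rule_format]
  show "R p w v \<Longrightarrow> vw w" by (rule a[THEN conjunct1])
  show "R p w v \<Longrightarrow> vw v" by (rule a[THEN conjunct2, THEN conjunct1])
  show "R p w v \<Longrightarrow> ap p ` cyl w = cyl v" by (rule a[THEN conjunct2, THEN conjunct2])
  show "R p w v \<Longrightarrow> tw s \<Longrightarrow> \<exists>s'. tw s' \<and> length s' = length s \<and> R p (w @ s) (v @ s')" by (rule b)
  show "R p w v \<Longrightarrow> R q v u \<Longrightarrow> R (q + p) w u" by (rule c)
  show "R p w v \<Longrightarrow> R (- p) v w" by (rule e)
  show "vw w \<Longrightarrow> R 0 w w" by (rule f)
qed

text \<open>Below level \<open>Suc n\<close> both words grow by the same number of letters, and the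
  image word starts nonempty, so the depth drops by at most \<open>n\<close>. This uniform bound is
  what allows composition: a deep ball stays deep enough for the next map.\<close>

lemma locally_long:
  assumes R: "good R" and p: "locally R p"
  shows "\<exists>n. \<forall>w. vw w \<longrightarrow> n < length w \<longrightarrow> (\<exists>v. R p w v \<and> length w \<le> length v + n)"
proof -
  obtain n where n: "\<And>w. vw w \<Longrightarrow> length w = Suc n \<Longrightarrow> \<exists>v. R p w v"
    using p by (auto simp: locally_def)
  have "\<exists>v. R p w v \<and> length w \<le> length v + n" if w: "vw w" "n < length w" for w
  proof -
    define w0 s where "w0 = take (Suc n) w" and "s = drop (Suc n) w"
    have ws: "w = w0 @ s" "length w0 = Suc n" using w by (auto simp: w0_def s_def)
    hence "vw w0" using w vw_prefix by (metis length_greater_0_conv zero_less_Suc)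
    moreover have "tw s" using w ws vw_append calculation by blast
    ultimately obtain v s' where "R p w0 v" "length s' = length s" "R p w (v @ s')"
      using n[of w0] ws goodD(4)[OF R] by metis
    moreover have "vw v" using calculation goodD(2)[OF R] by blast
    ultimately show ?thesis using ws vw_length by (intro exI[of _ "v @ s'"]) (auto simp: Suc_leI)
  qed
  thus ?thesis by blast
qed

lemma locally_add:
  assumes R: "good R" and p: "locally R p" and q: "locally R q"
  shows "locally R (p + q)"
proof -
  obtain m where m: "\<And>w. vw w \<Longrightarrow> m < length w \<Longrightarrow> \<exists>v. R p w v \<and> length w \<le> length v + m"
    using locally_long[OF R p] by blast
  obtain n where n: "\<And>w. vw w \<Longrightarrow> n < length w \<Longrightarrow> \<exists>v. R q w v \<and> length w \<le> length v + n"
    using locally_long[OF R q] by blast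
  have "\<exists>u. R (p + q) w u" if w: "vw w" "length w = Suc (m + n)" for w
  proof -
    obtain v where v: "R q w v" "length w \<le> length v + n" using n[of w] w by auto
    hence "vw v" "m < length v" using w goodD(2)[OF R] by auto
    then obtain u where "R p v u" using m by blast
    thus ?thesis using goodD(5)[OF R v(1)] by blast
  qed
  thus ?thesis using p q by (auto simp: locally_def intro: fixes_on_add)
qed

text \<open>The finitely many image balls of a level cover the boundary, so a word longer than all
  of theirs extends one of them.\<close>

lemma locally_neg:
  assumes R: "good R" and p: "locally R p"
  shows "locally R (- p)"
proof -
  obtain n where n: "\<And>w. vw w \<Longrightarrow> length w = Suc n \<Longrightarrow> \<exists>v. R p w v"
    and fx: "fixes_on (- \<Omega>) p"
    using p by (auto simp: locally_def)
  obtain f where f: "\<And>w. vw w \<Longrightarrow> length w = Suc n \<Longrightarrow> R p w (f w)"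
    using n by metis
  obtain m where m: "\<And>w. vw w \<Longrightarrow> length w = Suc n \<Longrightarrow> length (f w) \<le> m"
    using finite_imageI[OF finite_words[of "Suc n"], of "\<lambda>w. length (f w)"]
    unfolding finite_nat_set_iff_bounded_le by auto
  have "\<exists>v. R (- p) u v" if u: "vw u" "length u = Suc m" for u
  proof -
    obtain x where x: "x \<in> \<Omega>" "x \<in> cyl u" using cyl_ex u by blast
    define y where "y = ap (- p) x"
    have y: "y \<in> \<Omega>" unfolding y_def by (rule fixes_on_image) (use fx x in auto)
    define w where "w = pre (Suc n) y"
    have w: "vw w" "length w = Suc n" "y \<in> cyl w" using y X_pre X_in_cyl by (auto simp: w_def)
    have Rf: "R p w (f w)" by (rule f) (use w in auto)
    have "x \<in> cyl (f w)"
      using goodD(3)[OF R Rf] w(3) by (metis y_def ap_ap_uminus image_eqI)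
    then obtain s where s: "u = f w @ s" "tw s"
      using cyl_meet_prefix[OF _ x(2) goodD(2)[OF R Rf] u(1)] m[OF w(1,2)] u(2) by auto
    thus ?thesis using goodD(4)[OF R goodD(6)[OF R Rf]] by blast
  qed
  thus ?thesis using fx by (auto simp: locally_def)
qed

lemma sgp_locally: "good R \<Longrightarrow> sgp {p. locally R p}"
  using goodD(7)[of R] by (auto simp: sgp_def locally_add locally_neg) (auto simp: locally_def fixes_on_def)

lemma pr_image: "pr p w v \<Longrightarrow> ap p ` cyl w = cyl v"
  by (auto simp: pr_def cyl_def image_iff)

lemma good_pr: "good pr"
  unfolding good_def
  by (auto simp: pr_image) (auto simp: pr_def vw_append cat_append Tl_cat ap_uminus_eq intro!: exI)

lemma pr_hm: "pr p w v \<Longrightarrow> hm p w v"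
  unfolding hm_def using pr_image[of p w v] by (auto simp: pr_def cyl_def Nagree_cat)

lemma hm_Nagree:
  "hm p w v \<Longrightarrow> x \<in> cyl w \<Longrightarrow> y \<in> cyl w \<Longrightarrow> x \<noteq> y \<Longrightarrow>
   Nagree (ap p x) (ap p y) + length w = Nagree x y + length v"
  by (auto simp: hm_def)

lemma hm_in: "hm p w v \<Longrightarrow> x \<in> cyl w \<Longrightarrow> ap p x \<in> cyl v"
  by (auto simp: hm_def)

text \<open>A sub-ball is given by a lower bound on \<open>Nagree\<close> to one of its points, and
  a homothety shifts \<open>Nagree\<close> by a constant.\<close>

lemma hm_extend:
  assumes h: "hm p w v" and s: "tw s"
  shows "\<exists>s'. tw s' \<and> length s' = length s \<and> hm p (w @ s) (v @ s')"
proof -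
  have w: "vw w" "vw v" "vw (w @ s)" using h s by (auto simp: hm_def vw_append)
  obtain x where x: "x \<in> \<Omega>" "x \<in> cyl (w @ s)" using cyl_ex w by blast
  have xw: "x \<in> cyl w" using x s cyl_append_sub by blast
  define v' where "v' = pre (length v + length s) (ap p x)"
  have gx: "ap p x \<in> cyl v" using hm_in[OF h xw] .
  hence gX: "ap p x \<in> \<Omega>" using cyl_sub_X w by blast
  have v': "vw v'" "ap p x \<in> cyl v'" using gX vw_length[OF w(2)] by (auto simp: v'_def X_pre X_in_cyl)
  obtain s' where s': "v' = v @ s'" "tw s'"
    using cyl_meet_prefix[OF gx v'(2) w(2) v'(1)] by (auto simp: v'_def)
  have len: "length s' = length s" using s'(1) by (metis add_left_cancel length_append length_pre v'_def)
  have iff: "ap p y \<in> cyl v' \<longleftrightarrow> y \<in> cyl (w @ s)" if y: "y \<in> cyl w" for y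
  proof (cases "y = x")
    case False
    have X: "y \<in> \<Omega>" "ap p y \<in> \<Omega>" using y hm_in[OF h y] cyl_sub_X w by auto
    have "ap p y \<in> cyl v' \<longleftrightarrow> length v' \<le> Nagree (ap p x) (ap p y)"
      using False X v' by (metis Nagree_cyl Nagree_cylI ap_eq)
    also have "\<dots> \<longleftrightarrow> length (w @ s) \<le> Nagree x y"
      using hm_Nagree[OF h xw y] False by (auto simp: v'_def)
    also have "\<dots> \<longleftrightarrow> y \<in> cyl (w @ s)"
      using False X x w by (metis Nagree_cyl Nagree_cylI)
    finally show ?thesis .
  qed (use v' x in auto)
  have "ap p ` cyl (w @ s) = cyl v'"
  proof
    show "ap p ` cyl (w @ s) \<subseteq> cyl v'" using iff cyl_append_sub[OF s] by blast
    show "cyl v' \<subseteq> ap p ` cyl (w @ s)"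
    proof
      fix z assume z: "z \<in> cyl v'"
      hence "z \<in> cyl v" using s' cyl_append_sub by blast
      then obtain y where "y \<in> cyl w" "z = ap p y" using h unfolding hm_def by blast
      thus "z \<in> ap p ` cyl (w @ s)" using iff z by blast
    qed
  qed
  moreover have "Nagree (ap p a) (ap p b) + length (w @ s) = Nagree a b + length v'"
    if "a \<in> cyl (w @ s)" "b \<in> cyl (w @ s)" "a \<noteq> b" for a b
    using hm_Nagree[OF h, of a b] that cyl_append_sub[OF s] by (auto simp: s' len)
  ultimately show ?thesis using w v' s' len by (intro exI[of _ s']) (auto simp: hm_def)
qed

lemma good_hm: "good hm"
  unfolding good_def
proof (intro conjI allI impI)
  fix p q w v u assume h: "hm p w v" "hm q v u"
  show "hm (q + p) w u" unfolding hm_def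
  proof (intro conjI ballI impI)
    show "ap (q + p) ` cyl w = cyl u" using h by (simp add: hm_def flip: image_image)
    fix x y assume xy: "x \<in> cyl w" "y \<in> cyl w" "x \<noteq> y"
    show "Nagree (ap (q + p) x) (ap (q + p) y) + length w = Nagree x y + length u"
      using hm_Nagree[OF h(1) xy] hm_Nagree[OF h(2) hm_in[OF h(1) xy(1)] hm_in[OF h(1) xy(2)]] xy(3)
      by simp
  qed (use h in \<open>auto simp: hm_def\<close>)
next
  fix p w v assume h: "hm p w v"
  show "hm (- p) v w" unfolding hm_def
  proof (intro conjI ballI impI)
    have "cyl v = ap p ` cyl w" using h by (simp add: hm_def)
    thus "ap (- p) ` cyl v = cyl w" by (simp add: image_image)
    fix x y assume xy: "x \<in> cyl v" "y \<in> cyl v" "x \<noteq> y"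
    then obtain a b where ab: "a \<in> cyl w" "b \<in> cyl w" "x = ap p a" "y = ap p b"
      using h unfolding hm_def by blast
    thus "Nagree (ap (- p) x) (ap (- p) y) + length v = Nagree x y + length w"
      using hm_Nagree[OF h ab(1,2)] xy by auto
  qed (use h in \<open>auto simp: hm_def\<close>)
qed (use hm_extend in \<open>auto simp: hm_def\<close>)

text \<open>A homothety between balls permutes the \<open>d\<close> children at each vertex, and an
  order preserving permutation is trivial; so every letter after the prefix is copied.\<close>

lemma order_pres_hm_pr:
  assumes h: "hm p w v" and o: "order_pres_on (cyl w) (ap p)"
  shows "pr p w v"
proof -
  have w: "vw w" "vw v" using h by (auto simp: hm_def)
  have "ap p (w \<frown> y) = v \<frown> y" if y: "y \<in> Tl" for y
  proof -
    let ?x = "w \<frown> y"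
    have x: "?x \<in> cyl w" using y by (rule cylI)
    have "ap p ?x (length v + n) = y n" for n
    proof -
      \<comment> \<open>Probe rays which leave \<open>?x\<close> after \<open>n\<close> letters of
        \<open>y\<close> and then repeat the letter \<open>i\<close>. Only \<open>z (y n)\<close>
        follows \<open>?x\<close> one step further.\<close>
      define z where "z i = w \<frown> pre n y \<frown> (\<lambda>_. i)" for i :: nat
      have z: "z i \<in> cyl w" if "i < d" for i
        unfolding z_def by (rule cylI) (use that y in \<open>auto simp: Tl_cat Tl_pre Tl_const\<close>)
      have Nz: "Nagree (z i) (z j) = length w + n" if "i \<noteq> j" for i j
      proof -
        have "Nagree (\<lambda>_. i) (\<lambda>_. j) = 0" using that by (intro Nagree_eqI) auto
        moreover have "(\<lambda>_::nat. i) \<noteq> (\<lambda>_. j)" using that by (meson fun_cong)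
        ultimately show ?thesis unfolding z_def by (subst Nagree_cat; simp add: Nagree_cat)
      qed
      have z_neq: "z i \<noteq> z j" if "i \<noteq> j" for i j
        unfolding z_def using that by (auto dest: fun_cong)
      have z_less: "lex_less (z i) (z j)" if "i < j" for i j
        unfolding z_def using that by simp (simp add: lex_less_def exI[of _ 0])
      define f where "f i = ap p (z i) (length v + n)" for i
      have f_mono: "f i < f j" if "i < j" "j < d" for i j
      proof -
        have zz: "z i \<in> cyl w" "z j \<in> cyl w" "z i \<noteq> z j" using z z_neq that by auto
        hence "Nagree (ap p (z i)) (ap p (z j)) = length v + n"
          using hm_Nagree[OF h zz] Nz[of i j] that by auto
        moreover have "lex_less (ap p (z i)) (ap p (z j))"
          using order_pres_onD[OF o zz(1,2)] z_less that by blast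
        ultimately show ?thesis by (simp add: lex_less_iff f_def)
      qed
      have f_less: "f i < d" if "i < d" for i
      proof -
        have "ap p (z i) \<in> cyl v" using hm_in[OF h z[OF that]] .
        then obtain y' where "y' \<in> Tl" "ap p (z i) = v \<frown> y'" by (rule cylE)
        thus ?thesis by (simp add: f_def Tl_def)
      qed
      have yn: "y n < d" using y by (simp add: Tl_def)
      have "ap p ?x (length v + n) = f (y n)"
      proof (cases "?x = z (y n)")
        case False
        have "pre (length w + Suc n) ?x = pre (length w + Suc n) (z (y n))"
        proof -
          let ?w = "w @ pre (Suc n) y"
          have "[y n] \<frown> (\<lambda>_. y n) = (\<lambda>_. y n)" by (auto simp: cat_def)
          hence "z (y n) = ?w \<frown> (\<lambda>_. y n)"
            unfolding z_def by (simp add: cat_append pre_def)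
          moreover have "?x = ?w \<frown> dr (Suc n) y" by (simp add: cat_append)
          ultimately show ?thesis using pre_cat[of ?w] by simp
        qed
        hence "length w + Suc n \<le> Nagree ?x (z (y n))" using Nagree_ge[OF False] by simp
        hence "length v + n < Nagree (ap p ?x) (ap p (z (y n)))"
          using hm_Nagree[OF h x z[OF yn] False] by simp
        thus ?thesis unfolding f_def by (rule Nagree_less)
      qed (simp add: f_def)
      also have "f (y n) = y n"
        using f_mono f_less yn by (rule strict_mono_self_map)
      finally show ?thesis .
    qed
    moreover obtain y' where "y' \<in> Tl" "ap p ?x = v \<frown> y'"
      using hm_in[OF h x] by (rule cylE)
    ultimately have "y' = y" by auto
    with \<open>ap p ?x = v \<frown> y'\<close> show ?thesis by simp
  qed
  thus ?thesis using w by (simp add: pr_def)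
qed


section \<open>From admissible partitions and homotheties to levels and prefixes\<close>

lemma partition_cyl:
  assumes "admissible_partition d k P"
  shows "\<exists>n. \<forall>w. vw w \<longrightarrow> n < length w \<longrightarrow> (\<exists>B\<in>P. cyl w \<subseteq> B)"
proof -
  have P: "finite P" "\<Union>P = \<Omega>" "\<forall>B\<in>P. \<exists>w. vw w \<and> B = cyl w"
    using assms by (auto simp: admissible_partition_def is_proper_ball_iff)
  then obtain f where f: "\<And>B. B \<in> P \<Longrightarrow> vw (f B) \<and> B = cyl (f B)" by metis
  obtain n where n: "\<And>B. B \<in> P \<Longrightarrow> length (f B) \<le> n"
    using finite_imageI[OF P(1), of "\<lambda>B. length (f B)"]
    unfolding finite_nat_set_iff_bounded_le by auto
  have "\<exists>B\<in>P. cyl w \<subseteq> B" if w: "vw w" "n < length w" for w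
  proof -
    obtain x where x: "x \<in> \<Omega>" "x \<in> cyl w" using cyl_ex w by blast
    then obtain B where B: "B \<in> P" "x \<in> B" using P(2) by blast
    have "vw (f B)" "x \<in> cyl (f B)" using f[OF B(1)] B(2) by simp_all
    then obtain s where "w = f B @ s" "tw s"
      using cyl_meet_prefix[OF _ x(2)] w n[OF B(1)] by (metis le_less_trans less_imp_le)
    hence "cyl w \<subseteq> B" using f[OF B(1)] cyl_append_sub by metis
    thus ?thesis using B by blast
  qed
  thus ?thesis by blast
qed

lemma level_partition: "admissible_partition d k (cyl ` {w. vw w \<and> length w = Suc n})"
  unfolding admissible_partition_def
proof (intro conjI)
  show "disjoint (cyl ` {w. vw w \<and> length w = Suc n})"
    using cyl_disjoint_same_length by (fastforce simp: disjoint_def)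
  show "\<Union> (cyl ` {w. vw w \<and> length w = Suc n}) = \<Omega>"
  proof
    show "\<Omega> \<subseteq> \<Union> (cyl ` {w. vw w \<and> length w = Suc n})"
      using X_in_cyl X_pre by fastforce
  qed (use cyl_sub_X in blast)
qed (use finite_words in \<open>auto simp: is_proper_ball_iff\<close>)

text \<open>The metric half of \<open>hm\<close>: nothing is said about the image being a
  ball.\<close>

definition shift_on :: "nat list \<Rightarrow> nat \<Rightarrow> (nat \<Rightarrow> nat) bp \<Rightarrow> bool" where
  "shift_on w m p \<longleftrightarrow> (\<forall>x\<in>cyl w. \<forall>y\<in>cyl w. x \<noteq> y \<longrightarrow> Nagree (ap p x) (ap p y) + length w = Nagree x y + m)"

text \<open>Two rays that separate right after \<open>w\<close> force the factor to be a quotient of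
  powers of \<open>d\<close>.\<close>

lemma homothety_on_cyl: "homothety_on d (cyl w) (ap p) \<longleftrightarrow> (\<exists>m. shift_on w m p)"
proof
  assume "homothety_on d (cyl w) (ap p)"
  then obtain c where c: "c > 0" "\<And>x y. x \<in> cyl w \<Longrightarrow> y \<in> cyl w \<Longrightarrow> bdist d (ap p x) (ap p y) = c * bdist d x y"
    by (auto simp: homothety_on_def)
  have eq: "real d ^ Nagree x y = c * real d ^ Nagree (ap p x) (ap p y)"
    if "x \<in> cyl w" "y \<in> cyl w" "x \<noteq> y" for x y
    using c(2)[OF that(1,2)] that(3) d2 by (simp add: bdist_def field_simps)
  define x0 y0 where "x0 = w \<frown> (\<lambda>_. 0)" and "y0 = w \<frown> (\<lambda>_. 1)"
  have xy0: "x0 \<in> cyl w" "y0 \<in> cyl w" using d2 by (auto simp: x0_def y0_def Tl_const)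
  have ne: "(\<lambda>_::nat. 0::nat) \<noteq> (\<lambda>_. 1)" by (meson fun_cong zero_neq_one)
  have "Nagree (\<lambda>_. 0) (\<lambda>_. 1) = 0" by (intro Nagree_eqI) auto
  hence N0: "Nagree x0 y0 = length w" and ne0: "x0 \<noteq> y0"
    using ne by (simp_all add: x0_def y0_def Nagree_cat)
  define m where "m = Nagree (ap p x0) (ap p y0)"
  have e0: "real d ^ length w = c * real d ^ m" using eq[OF xy0 ne0] by (simp add: N0 m_def)
  have "Nagree (ap p x) (ap p y) + length w = Nagree x y + m"
    if "x \<in> cyl w" "y \<in> cyl w" "x \<noteq> y" for x y
  proof -
    have "real d ^ (Nagree (ap p x) (ap p y) + length w) = real d ^ (Nagree x y + m)"
      unfolding power_add e0 eq[OF that] by simp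
    thus ?thesis using d2 by (simp add: power_inject_exp)
  qed
  thus "\<exists>m. shift_on w m p" by (auto simp: shift_on_def)
next
  assume "\<exists>m. shift_on w m p"
  then obtain m where m: "shift_on w m p" by blast
  have "bdist d (ap p x) (ap p y) = (real d ^ length w / real d ^ m) * bdist d x y"
    if "x \<in> cyl w" "y \<in> cyl w" for x y
  proof (cases "x = y")
    case False
    hence "Nagree (ap p x) (ap p y) + length w = Nagree x y + m" using m that by (auto simp: shift_on_def)
    hence "real d ^ Nagree (ap p x) (ap p y) * real d ^ length w = real d ^ Nagree x y * real d ^ m"
      by (metis power_add)
    thus ?thesis using False d2 by (simp add: bdist_def field_simps)
  qed (simp add: bdist_def)
  moreover have "real d ^ length w / real d ^ m > 0" using d2 by simp
  ultimately show "homothety_on d (cyl w) (ap p)" unfolding homothety_on_def by blast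
qed

lemma hm_homothety: "hm p w v \<Longrightarrow> homothety_on d (cyl w) (ap p)"
  unfolding homothety_on_cyl by (auto simp: hm_def shift_on_def)

text \<open>A homothetic image of a cylinder is again a cylinder as soon as its diameter is less
  than 1: each vertex of the image tree has \<open>d\<close> children, so all children occur. Without the
  restriction \<open>m > 0\<close> the image could be a union of \<open>d < k\<close> balls of radius \<open>1/d\<close>.\<close>
lemma shift_on_hm:
  assumes w: "vw w" and m: "m > 0" and sh: "shift_on w m p" and fx: "fixes_on (- \<Omega>) p"
    and cont: "bcontinuous d k (ap (- p))"
  shows "\<exists>v. length v = m \<and> hm p w v"
proof -
  obtain x0 where x0: "x0 \<in> \<Omega>" "x0 \<in> cyl w" using cyl_ex w by blast
  define v where "v = pre m (ap p x0)"
  have gX: "ap p x \<in> \<Omega>" if "x \<in> \<Omega>" for x using fixes_on_image[OF fx that] .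
  have v: "vw v" "ap p x0 \<in> cyl v" using gX[OF x0(1)] m by (auto simp: v_def X_pre X_in_cyl)
  have sh': "Nagree (ap p x) (ap p y) + length w = Nagree x y + m"
    if "x \<in> cyl w" "y \<in> cyl w" "x \<noteq> y" for x y
    using sh that by (auto simp: shift_on_def)
  have sub: "ap p ` cyl w \<subseteq> cyl v"
  proof safe
    fix x assume x: "x \<in> cyl w"
    show "ap p x \<in> cyl v"
    proof (cases "x = x0")
      case False
      have "length w \<le> Nagree x0 x" using Nagree_cyl[OF x0(2) x] False by auto
      hence "m \<le> Nagree (ap p x0) (ap p x)" using sh'[OF x0(2) x] False by auto
      thus ?thesis using Nagree_cylI[OF v(2) v(1) gX] x cyl_sub_X[OF w] by (auto simp: v_def)
    qed (use v in simp)
  qed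
  \<comment> \<open>Density of the image in \<open>cyl v\<close>, one letter at a time: the map from
    the \<open>d\<close> children of \<open>u\<close> to the possible next letters is injective,
    hence onto.\<close>
  have approx: "\<exists>x\<in>cyl w. pre (m + n) (ap p x) = pre (m + n) y" if y: "y \<in> cyl v" for y n
  proof (induction n)
    case 0
    show ?case using y v x0(2) by (intro bexI[of _ x0]) (auto simp: cyl_iff v_def)
  next
    case (Suc n)
    then obtain x where x: "x \<in> cyl w" "pre (m + n) (ap p x) = pre (m + n) y" by blast
    have xX: "x \<in> \<Omega>" using x cyl_sub_X[OF w] by blast
    define u where "u = pre (length w + n) x"
    have u: "vw u" "x \<in> cyl u" "cyl u \<subseteq> cyl w"
      using xX vw_length[OF w] cyl_pre_sub[OF x(1) w] by (auto simp: u_def X_pre X_in_cyl)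
    define z where "z i = u \<frown> (\<lambda>_. i)" for i :: nat
    have zu: "z i \<in> cyl u" if "i < d" for i using that by (simp add: z_def Tl_const)
    hence zw: "z i \<in> cyl w" if "i < d" for i using that u(3) by blast
    have zz: "z i \<noteq> z j" "Nagree (z i) (z j) = length w + n" if "i \<noteq> j" for i j
    proof -
      have "Nagree (\<lambda>_. i) (\<lambda>_. j) = 0" using that by (intro Nagree_eqI) auto
      moreover have "(\<lambda>_::nat. i) \<noteq> (\<lambda>_. j)" using that by (meson fun_cong)
      ultimately show "z i \<noteq> z j" "Nagree (z i) (z j) = length w + n"
        by (simp_all add: z_def Nagree_cat u_def)
    qed
    define f where "f i = ap p (z i) (m + n)" for i
    have "inj_on f {..<d}"
    proof (rule inj_onI, rule ccontr)
      fix i j assume ij: "i \<in> {..<d}" "j \<in> {..<d}" "f i = f j" "i \<noteq> j"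
      have "Nagree (ap p (z i)) (ap p (z j)) = m + n"
        using sh'[OF zw zw zz(1)] zz(2) ij by fastforce
      hence "f i \<noteq> f j" unfolding f_def using Nagree_neq zz(1)[OF ij(4)] by (metis ap_eq)
      thus False using ij by simp
    qed
    moreover have "f ` {..<d} \<subseteq> {..<d}"
    proof safe
      fix i assume "i < d"
      hence "ap p (z i) \<in> \<Omega>" using zw gX cyl_sub_X[OF w] by blast
      thus "f i < d" using m by (cases "m + n") (auto simp: f_def Bd_def)
    qed
    ultimately have "f ` {..<d} = {..<d}" by (intro endo_inj_surj) auto
    moreover have "y (m + n) < d"
      using y cyl_sub_X[OF v(1)] m by (cases "m + n") (auto simp: Bd_def)
    ultimately obtain i where i: "i < d" "f i = y (m + n)" by (metis imageE lessThan_iff)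
    have "pre (m + n) (ap p (z i)) = pre (m + n) (ap p x)"
    proof (cases "z i = x")
      case False
      have "length w + n \<le> Nagree (z i) x" using Nagree_cyl[OF zu[OF i(1)] u(2) False] by (simp add: u_def)
      hence "m + n \<le> Nagree (ap p (z i)) (ap p x)" using sh'[OF zw[OF i(1)] x(1) False] by simp
      thus ?thesis using Nagree_ge False by (metis ap_eq)
    qed simp
    hence "pre (m + Suc n) (ap p (z i)) = pre (m + Suc n) y"
      using i x by (simp add: pre_def f_def)
    thus ?case using zw i by blast
  qed
  \<comment> \<open>Continuity of the inverse puts \<open>ap (- p) y\<close> so close to some point
    of \<open>cyl w\<close> that it lies in this ball itself.\<close>
  have "cyl v \<subseteq> ap p ` cyl w"
  proof
    fix y assume y: "y \<in> cyl v"
    hence yX: "y \<in> \<Omega>" using cyl_sub_X v by blast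
    have "1 / real d ^ length w > 0" using d2 by simp
    then obtain \<delta> where \<delta>: "\<delta> > 0"
      "\<And>y'. y' \<in> \<Omega> \<Longrightarrow> bdist d y y' < \<delta> \<Longrightarrow> bdist d (ap (- p) y) (ap (- p) y') < 1 / real d ^ length w"
      using cont yX unfolding bcontinuous_def by meson
    obtain n where n: "1 / real d ^ n < \<delta>" using ex_power_less \<delta>(1) by blast
    obtain x where x: "x \<in> cyl w" "pre (m + n) (ap p x) = pre (m + n) y" using approx[OF y] by blast
    have xX: "x \<in> \<Omega>" using x cyl_sub_X[OF w] by blast
    have "pre n y = pre n (ap p x)" using x(2) by (simp add: pre_eq_iff)
    hence "bdist d y (ap p x) < \<delta>" using bdist_le_power_iff[of y "ap p x" n] n by simp
    hence "bdist d (ap (- p) y) x < 1 / real d ^ length w" using \<delta>(2)[OF gX[OF xX]] by simp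
    hence "pre (length w) (ap (- p) y) = pre (length w) x"
      using bdist_le_power_iff[of _ _ "length w"] by fastforce
    moreover have "ap (- p) y \<in> \<Omega>" by (rule fixes_on_image) (use fx yX in auto)
    ultimately have "ap (- p) y \<in> cyl w" using x by (simp add: cyl_iff[OF w])
    thus "y \<in> ap p ` cyl w" by (metis ap_ap_uminus image_eqI)
  qed
  hence "hm p w v" unfolding hm_def using sub w v sh' by (auto simp: v_def)
  thus ?thesis by (intro exI[of _ v]) (simp add: v_def)
qed

lemma homothety_on_mono: "homothety_on d B g \<Longrightarrow> A \<subseteq> B \<Longrightarrow> homothety_on d A g"
  unfolding homothety_on_def by (meson subsetD)

lemma inv_into_ap: "fixes_on (- \<Omega>) p \<Longrightarrow> y \<in> \<Omega> \<Longrightarrow> inv_into \<Omega> (ap p) y = ap (- p) y"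
  using fixes_on_image[of "- p" y] by (intro inv_into_f_eq) (auto simp: inj_on_def)

lemma bij_betw_fixes_on: "fixes_on (- \<Omega>) p \<Longrightarrow> bij_betw (ap p) \<Omega> \<Omega>"
  unfolding bij_betw_def using fixes_on_image[of p] fixes_on_image[of "- p"]
  by (auto simp: inj_on_def) (metis ap_ap_uminus image_eqI)

lemma bhomeo_iff: "bhomeo d k (ap p) \<longleftrightarrow> fixes_on (- \<Omega>) p \<and> bcontinuous d k (ap p) \<and> bcontinuous d k (ap (- p))"
proof -
  have "bhomeo d k (ap p) \<longleftrightarrow> fixes_on (- \<Omega>) p \<and> bcontinuous d k (ap p) \<and> bcontinuous d k (inv_into \<Omega> (ap p))"
    using bij_betw_fixes_on[of p] by (auto simp: bhomeo_def fixes_on_def)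
  moreover have "bcontinuous d k (inv_into \<Omega> (ap p)) \<longleftrightarrow> bcontinuous d k (ap (- p))" if "fixes_on (- \<Omega>) p"
    unfolding bcontinuous_def using inv_into_ap[OF that] by (simp cong: ball_cong)
  ultimately show ?thesis by blast
qed

lemma locally_hm_continuous:
  assumes p: "locally hm p" shows "bcontinuous d k (ap p)"
  unfolding bcontinuous_def
proof (intro ballI allI impI)
  fix x :: "nat \<Rightarrow> nat" and e :: real assume x: "x \<in> \<Omega>" and e: "e > 0"
  obtain n where n: "\<And>w. vw w \<Longrightarrow> n < length w \<Longrightarrow> \<exists>v. hm p w v \<and> length w \<le> length v + n"
    using locally_long[OF good_hm p] by blast
  obtain M where M: "1 / real d ^ M < e" using ex_power_less[OF e] by blast
  define w where "w = pre (Suc (M + n)) x"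
  have w: "vw w" "x \<in> cyl w" using x by (auto simp: w_def X_pre X_in_cyl)
  obtain v where v: "hm p w v" "M \<le> length v" using n[OF w(1)] by (auto simp: w_def)
  have vv: "vw v" using v by (simp add: hm_def)
  have "bdist d (ap p x) (ap p y) < e" if y: "y \<in> \<Omega>" "bdist d x y < 1 / real d ^ Suc (M + n)" for y
  proof -
    have "pre (Suc (M + n)) x = pre (Suc (M + n)) y"
      using y(2) bdist_le_power_iff[of x y "Suc (M + n)"] by simp
    hence "y \<in> cyl w" using y w by (simp add: cyl_iff w_def)
    hence "ap p x \<in> cyl v" "ap p y \<in> cyl v" using hm_in[OF v(1)] w by auto
    hence "pre (length v) (ap p x) = pre (length v) (ap p y)" using vv by (simp add: cyl_iff)
    hence "pre M (ap p x) = pre M (ap p y)" using v(2) by (simp add: pre_eq_iff)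
    thus ?thesis using bdist_le_power_iff[of "ap p x" "ap p y" M] M by simp
  qed
  thus "\<exists>\<delta>>0. \<forall>y\<in>\<Omega>. bdist d x y < \<delta> \<longrightarrow> bdist d (ap p x) (ap p y) < e"
    using d2 by (intro exI[of _ "1 / real d ^ Suc (M + n)"]) auto
qed

lemma AAut_iff: "ap p \<in> AAut d k \<longleftrightarrow> locally hm p"
proof
  assume "ap p \<in> AAut d k"
  then obtain P where fx: "fixes_on (- \<Omega>) p" and c: "bcontinuous d k (ap (- p))"
    and P: "admissible_partition d k P" "\<And>B. B \<in> P \<Longrightarrow> homothety_on d B (ap p)"
    by (auto simp: AAut_def bhomeo_iff)
  obtain n where n: "\<And>w. vw w \<Longrightarrow> n < length w \<Longrightarrow> \<exists>B\<in>P. cyl w \<subseteq> B"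
    using partition_cyl[OF P(1)] by blast
  \<comment> \<open>One level below the partition: the additional letter makes the exponent
    \<open>Suc m\<close> positive, as \<open>shift_on_hm\<close> requires.\<close>
  have "\<exists>v. hm p w v" if w: "vw w" "length w = Suc (Suc n)" for w
  proof -
    obtain w0 a where w0: "w = w0 @ [a]" using w by (cases w rule: rev_cases) auto
    hence l: "length w0 = Suc n" using w by simp
    hence v0: "vw w0" using w(1) vw_prefix[of w0 "[a]"] w0 by force
    have tw: "tw [a]" using w(1) w0 vw_append[OF v0] by simp
    obtain B where "B \<in> P" "cyl w0 \<subseteq> B" using n[OF v0] l by auto
    hence "homothety_on d (cyl w0) (ap p)" using P(2) homothety_on_mono by blast
    then obtain m where "shift_on w0 m p" by (auto simp: homothety_on_cyl)
    hence "shift_on w (Suc m) p" using cyl_append_sub[OF tw, of w0] by (fastforce simp: shift_on_def w0)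
    thus ?thesis using shift_on_hm[OF w(1) _ _ fx c] by blast
  qed
  thus "locally hm p" using fx by (auto simp: locally_def)
next
  assume p: "locally hm p"
  then obtain n where n: "\<And>w. vw w \<Longrightarrow> length w = Suc n \<Longrightarrow> \<exists>v. hm p w v" and fx: "fixes_on (- \<Omega>) p"
    by (auto simp: locally_def)
  have "\<forall>B \<in> cyl ` {w. vw w \<and> length w = Suc n}. homothety_on d B (ap p)"
    using n hm_homothety by blast
  thus "ap p \<in> AAut d k"
    using level_partition[of n] fx locally_hm_continuous[OF p] locally_hm_continuous[OF locally_neg[OF good_hm p]]
    unfolding AAut_def mem_Collect_eq bhomeo_iff by blast
qed

lemma locally_pr_hm: "locally pr p \<Longrightarrow> locally hm p"
  using pr_hm unfolding locally_def by blast

lemma Vgrp_iff: "ap p \<in> Vgrp d k \<longleftrightarrow> locally pr p"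
proof
  assume "ap p \<in> Vgrp d k"
  then obtain P where p: "locally hm p"
    and P: "admissible_partition d k P" "\<And>B. B \<in> P \<Longrightarrow> order_pres_on B (ap p)"
    by (auto simp: Vgrp_def AAut_iff)
  obtain m where m: "\<And>w. vw w \<Longrightarrow> m < length w \<Longrightarrow> \<exists>v. hm p w v"
    using locally_long[OF good_hm p] by blast
  obtain n where n: "\<And>w. vw w \<Longrightarrow> n < length w \<Longrightarrow> \<exists>B\<in>P. cyl w \<subseteq> B"
    using partition_cyl[OF P(1)] by blast
  have "\<exists>v. pr p w v" if w: "vw w" "length w = Suc (m + n)" for w
  proof -
    obtain v where v: "hm p w v" using m[OF w(1)] w by auto
    obtain B where B: "B \<in> P" "cyl w \<subseteq> B" using n[OF w(1)] w by auto
    hence "order_pres_on (cyl w) (ap p)" using P(2)[OF B(1)] unfolding order_pres_on_def by blast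
    thus ?thesis using order_pres_hm_pr[OF v] by blast
  qed
  thus "locally pr p" using p by (auto simp: locally_def)
next
  assume p: "locally pr p"
  then obtain n where n: "\<And>w. vw w \<Longrightarrow> length w = Suc n \<Longrightarrow> \<exists>v. pr p w v"
    by (auto simp: locally_def)
  have o: "order_pres_on (cyl w) (ap p)" if "pr p w v" for w v
    using that by (auto simp: order_pres_on_def cyl_def pr_def)
  have "\<forall>B \<in> cyl ` {w. vw w \<and> length w = Suc n}. homothety_on d B (ap p) \<and> order_pres_on B (ap p)"
    using n hm_homothety pr_hm o by blast
  thus "ap p \<in> Vgrp d k"
    using level_partition[of n] locally_pr_hm[OF p] unfolding Vgrp_def mem_Collect_eq AAut_iff by blast
qed

section \<open>The four groups as sets of bijections\<close>

definition AA where "AA = {p. locally hm p}"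
definition VV where "VV = {p. locally pr p}"
definition FF where "FF = {p \<in> VV. order_pres_on \<Omega> (ap p)}"
definition cyc_pres where "cyc_pres p \<longleftrightarrow> (\<forall>a\<in>\<Omega>. \<forall>b\<in>\<Omega>. \<forall>c\<in>\<Omega>.
  cyc_ordered a b c \<longrightarrow> cyc_ordered (ap p a) (ap p b) (ap p c))"
definition TT where "TT = {p \<in> VV. cyc_pres p}"

lemma AA_iff: "ap p \<in> AAut d k \<longleftrightarrow> p \<in> AA"
  and VV_iff: "ap p \<in> Vgrp d k \<longleftrightarrow> p \<in> VV"
  and FF_iff: "ap p \<in> Fgrp d k \<longleftrightarrow> p \<in> FF"
  and TT_iff: "ap p \<in> Tgrp d k \<longleftrightarrow> p \<in> TT"
  by (simp_all add: AA_def VV_def FF_def TT_def AAut_iff Vgrp_iff Fgrp_def Tgrp_def cyc_pres_def)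

lemma sgp_AA: "sgp AA" and sgp_VV: "sgp VV"
  by (simp_all add: AA_def VV_def sgp_locally good_hm good_pr)

lemma VV_AA: "VV \<subseteq> AA"
  by (auto simp: AA_def VV_def locally_pr_hm)

lemma AA_fixes: "p \<in> AA \<Longrightarrow> fixes_on (- \<Omega>) p"
  by (simp add: AA_def locally_def)

lemma AA_image: "p \<in> AA \<Longrightarrow> x \<in> \<Omega> \<Longrightarrow> ap p x \<in> \<Omega>"
  by (rule fixes_on_image[OF AA_fixes])

lemma FF_VV: "FF \<subseteq> VV" and TT_VV: "TT \<subseteq> VV"
  by (auto simp: FF_def TT_def)

lemma sgp_FF: "sgp FF"
  unfolding sgp_def
proof (intro conjI ballI)
  show "0 \<in> FF" using sgp_0[OF sgp_VV] by (simp add: FF_def order_pres_on_def)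
  fix a assume a: "a \<in> FF"
  hence aV: "a \<in> VV" "a \<in> AA" "- a \<in> VV" "- a \<in> AA" and o: "order_pres_on \<Omega> (ap a)"
    using sgp_neg[OF sgp_VV] VV_AA by (auto simp: FF_def)
  have "order_pres_on \<Omega> (ap (- a))"
    unfolding order_pres_on_def
    using order_pres_on_ap_iff[OF o AA_image[OF aV(4)] AA_image[OF aV(4)]] by simp
  thus "- a \<in> FF" using aV by (simp add: FF_def)
  fix b assume b: "b \<in> FF"
  hence "b \<in> VV" "b \<in> AA" "order_pres_on \<Omega> (ap b)" using VV_AA by (auto simp: FF_def)
  thus "a + b \<in> FF"
    using aV o sgp_add[OF sgp_VV] AA_image by (auto simp: FF_def order_pres_on_def)
qed

lemma cyc_ordered_neq: "cyc_ordered a b c \<Longrightarrow> a \<noteq> b \<and> b \<noteq> c \<and> a \<noteq> c"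
  unfolding cyc_ordered_def by (metis lex_less_asym lex_less_irrefl)

lemma cyc_ordered_linear: "a \<noteq> b \<Longrightarrow> b \<noteq> c \<Longrightarrow> a \<noteq> c \<Longrightarrow> cyc_ordered a b c \<or> cyc_ordered a c b"
  unfolding cyc_ordered_def by (metis lex_less_linear)

lemma cyc_ordered_asym: "cyc_ordered a b c \<Longrightarrow> \<not> cyc_ordered a c b"
  unfolding cyc_ordered_def by (metis lex_less_asym)

text \<open>Three distinct points have exactly one of the two orientations, so an injective map
  preserving one of them reflects it as well.\<close>

lemma cyc_ordered_iff:
  assumes "cyc_pres p" "a \<in> \<Omega>" "b \<in> \<Omega>" "c \<in> \<Omega>"
  shows "cyc_ordered (ap p a) (ap p b) (ap p c) \<longleftrightarrow> cyc_ordered a b c"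
  using assms unfolding cyc_pres_def
  by (metis ap_eq cyc_ordered_asym cyc_ordered_linear cyc_ordered_neq)

lemma sgp_TT: "sgp TT"
  unfolding sgp_def
proof (intro conjI ballI)
  show "0 \<in> TT" using sgp_0[OF sgp_VV] by (simp add: TT_def cyc_pres_def)
  fix a assume a: "a \<in> TT"
  hence aV: "a \<in> VV" "a \<in> AA" "- a \<in> VV" "- a \<in> AA" and o: "cyc_pres a"
    using sgp_neg[OF sgp_VV] VV_AA by (auto simp: TT_def)
  have "cyc_pres (- a)"
    unfolding cyc_pres_def
    using cyc_ordered_iff[OF o AA_image[OF aV(4)] AA_image[OF aV(4)] AA_image[OF aV(4)]] by simp
  thus "- a \<in> TT" using aV by (simp add: TT_def)
  fix b assume b: "b \<in> TT"
  hence "b \<in> VV" "b \<in> AA" "cyc_pres b" using VV_AA by (auto simp: TT_def)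
  thus "a + b \<in> TT"
    using aV o sgp_add[OF sgp_VV] AA_image by (auto simp: TT_def cyc_pres_def)
qed

lemma FF_TT: "FF \<subseteq> TT"
proof
  fix p assume p: "p \<in> FF"
  hence o: "lex_less (ap p a) (ap p b)" if "lex_less a b" "a \<in> \<Omega>" "b \<in> \<Omega>" for a b
    using that by (auto simp: FF_def order_pres_on_def)
  have "cyc_pres p" unfolding cyc_pres_def cyc_ordered_def by (intro ballI impI) (use o in blast)
  thus "p \<in> TT" using p by (simp add: FF_def TT_def)
qed

end

section \<open>Prefix replacement maps\<close>

context tree
begin

text \<open>\<open>tp P Q\<close> is the element with the tree pair \<open>(P, Q)\<close>: it replaces the prefix \<open>P ! i\<close> by \<open>Q ! i\<close>
  and fixes the points outside the balls in \<open>P\<close>. \<open>mt P Q\<close> says that this makes sense.\<close>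
primrec tpf :: "(nat list \<times> nat list) list \<Rightarrow> (nat \<Rightarrow> nat) \<Rightarrow> nat \<Rightarrow> nat" where
  "tpf [] x = x"
| "tpf (c # L) x = (if x \<in> cyl (fst c) then snd c \<frown> dr (length (fst c)) x else tpf L x)"

definition un :: "nat list list \<Rightarrow> (nat \<Rightarrow> nat) set" where
  "un P = \<Union> (cyl ` set P)"

definition code :: "nat list list \<Rightarrow> bool" where
  "code P \<longleftrightarrow> (\<forall>w\<in>set P. vw w) \<and> distinct P \<and> (\<forall>v\<in>set P. \<forall>w\<in>set P. v \<noteq> w \<longrightarrow> cyl v \<inter> cyl w = {})"

definition mt :: "nat list list \<Rightarrow> nat list list \<Rightarrow> bool" where
  "mt P Q \<longleftrightarrow> code P \<and> code Q \<and> length P = length Q \<and> un P = un Q"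

definition tp :: "nat list list \<Rightarrow> nat list list \<Rightarrow> (nat \<Rightarrow> nat) bp" where
  "tp P Q = Abs_bp (tpf (zip P Q))"

lemma un_disjoint: "A \<inter> un P = {} \<longleftrightarrow> (\<forall>v\<in>set P. A \<inter> cyl v = {})"
  by (auto simp: un_def)

lemma code_Cons: "code (w # P) \<longleftrightarrow> vw w \<and> code P \<and> cyl w \<inter> un P = {}"
proof
  assume c: "code (w # P)"
  hence "w \<notin> set P" by (simp add: code_def)
  hence "cyl w \<inter> cyl v = {}" if "v \<in> set P" for v
    using c that unfolding code_def by (metis list.set_intros)
  thus "vw w \<and> code P \<and> cyl w \<inter> un P = {}" using c by (simp add: code_def un_disjoint)
next
  assume a: "vw w \<and> code P \<and> cyl w \<inter> un P = {}"
  hence d: "cyl w \<inter> cyl v = {}" "cyl v \<inter> cyl w = {}" if "v \<in> set P" for v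
    using that by (simp_all add: un_disjoint Int_commute)
  hence "w \<notin> set P" using cyl_nonempty[of w] by auto
  thus "code (w # P)" using a d by (simp add: code_def)
qed

lemma tpf_at:
  "code P \<Longrightarrow> length P = length Q \<Longrightarrow> i < length P \<Longrightarrow> y \<in> Tl \<Longrightarrow> tpf (zip P Q) (P ! i \<frown> y) = Q ! i \<frown> y"
proof (induction P arbitrary: Q i)
  case (Cons w P)
  then obtain v Q' where [simp]: "Q = v # Q'" by (cases Q) auto
  show ?case
  proof (cases i)
    case (Suc j)
    hence "P ! j \<frown> y \<in> un P" using Cons.prems by (auto simp: un_def intro: cylI)
    hence "P ! j \<frown> y \<notin> cyl w" using Cons.prems by (auto simp: code_Cons)
    thus ?thesis using Suc Cons by (auto simp: code_Cons)
  qed (use Cons.prems in \<open>auto simp: cylI\<close>)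
qed simp

lemma tpf_off: "length P = length Q \<Longrightarrow> x \<notin> un P \<Longrightarrow> tpf (zip P Q) x = x"
  by (induction P Q rule: list_induct2) (auto simp: un_def)

lemma un_UN: "un P = (\<Union>i<length P. cyl (P ! i))"
  unfolding un_def set_conv_nth by blast

lemma un_nth: "x \<in> un P \<longleftrightarrow> (\<exists>i<length P. \<exists>y\<in>Tl. x = P ! i \<frown> y)"
  by (auto simp: un_UN cyl_def)

lemma mt_sym: "mt P Q \<Longrightarrow> mt Q P" and mt_trans: "mt P Q \<Longrightarrow> mt Q R \<Longrightarrow> mt P R"
  and mt_length: "mt P Q \<Longrightarrow> length Q = length P"
  by (auto simp: mt_def)

lemma tpf_inverse:
  assumes m: "mt P Q" shows "tpf (zip Q P) (tpf (zip P Q) x) = x"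
proof (cases "x \<in> un P")
  case True
  then obtain i y where i: "i < length P" "y \<in> Tl" "x = P ! i \<frown> y" by (auto simp: un_nth)
  thus ?thesis using m tpf_at[of P Q i y] tpf_at[of Q P i y] by (simp add: mt_def)
next
  case False
  thus ?thesis using m tpf_off[of P Q x] tpf_off[of Q P x] by (simp add: mt_def)
qed

lemma ap_tp: "mt P Q \<Longrightarrow> ap (tp P Q) = tpf (zip P Q)"
  unfolding tp_def using tpf_inverse mt_sym by (intro ap_Abs bij_betw_byWitness[where f' = "tpf (zip Q P)"]) auto

lemma tp_at: "mt P Q \<Longrightarrow> i < length P \<Longrightarrow> y \<in> Tl \<Longrightarrow> ap (tp P Q) (P ! i \<frown> y) = Q ! i \<frown> y"
  by (simp add: ap_tp tpf_at mt_def)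

lemma tp_pr: "mt P Q \<Longrightarrow> i < length P \<Longrightarrow> pr (tp P Q) (P ! i) (Q ! i)"
  unfolding pr_def using tp_at by (auto simp: mt_def code_def)

lemma tp_off: "mt P Q \<Longrightarrow> fixes_on (- un P) (tp P Q)"
  by (simp add: fixes_on_def ap_tp tpf_off mt_def)

lemma tp_unique:
  assumes "mt P Q" "\<And>i. i < length P \<Longrightarrow> pr p (P ! i) (Q ! i)" "fixes_on (- un P) p"
  shows "p = tp P Q"
proof (rule bp_eqI)
  fix x
  show "ap p x = ap (tp P Q) x"
  proof (cases "x \<in> un P")
    case True
    then obtain i y where i: "i < length P" "y \<in> Tl" "x = P ! i \<frown> y" by (auto simp: un_nth)
    thus ?thesis using assms(2)[OF i(1)] tp_at[OF assms(1) i(1,2)] by (simp add: pr_def)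
  next
    case False
    thus ?thesis using assms(3) tp_off[OF assms(1)] by (simp add: fixes_on_def)
  qed
qed

lemma tp_comp: "mt P Q \<Longrightarrow> mt Q R \<Longrightarrow> tp Q R + tp P Q = tp P R"
  using goodD(5)[OF good_pr tp_pr[of P Q] tp_pr[of Q R]] tp_off[of P Q] tp_off[of Q R]
  by (intro tp_unique) (auto intro: mt_trans fixes_on_add simp: mt_length, simp add: mt_def fixes_on_add)

lemma tp_id: "mt P P \<Longrightarrow> tp P P = 0"
  by (rule tp_unique[symmetric]) (auto simp: mt_def code_def pr_def fixes_on_def)

lemma tp_neg: "mt P Q \<Longrightarrow> - tp P Q = tp Q P"
  by (rule minus_unique) (simp add: tp_comp[of Q P Q] mt_sym, metis mt_sym mt_trans tp_id)

lemma tp_all2: "mt P Q \<Longrightarrow> list_all2 (pr (tp P Q)) P Q"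
  using tp_pr by (auto simp: list_all2_conv_all_nth mt_length)

lemma tp_eqI: "mt P Q \<Longrightarrow> list_all2 (pr p) P Q \<Longrightarrow> fixes_on (- un P) p \<Longrightarrow> tp P Q = p"
  by (rule tp_unique[symmetric]) (auto simp: list_all2_conv_all_nth)

lemma un_image:
  assumes "length P = length P'" "\<And>i. i < length P \<Longrightarrow> pr g (P ! i) (P' ! i)"
  shows "ap g ` un P = un P'"
proof -
  have "ap g ` cyl (P ! i) = cyl (P' ! i)" if "i < length P'" for i
    using pr_image assms that by simp
  thus ?thesis using assms(1) by (simp add: image_UN un_UN)
qed

lemma cj_tp:
  assumes m: "mt P Q" "mt P' Q'" "length P' = length P"
    and g: "\<And>i. i < length P \<Longrightarrow> pr g (P ! i) (P' ! i)" "\<And>i. i < length P \<Longrightarrow> pr g (Q ! i) (Q' ! i)"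
  shows "cj g (tp P Q) = tp P' Q'"
proof (rule tp_unique[OF m(2)])
  fix i assume "i < length P'"
  hence i: "i < length P" using m(3) by simp
  show "pr (cj g (tp P Q)) (P' ! i) (Q' ! i)"
    using goodD(5)[OF good_pr goodD(6)[OF good_pr g(1)[OF i]]
      goodD(5)[OF good_pr tp_pr[OF m(1) i] g(2)[OF i]]]
    by (simp add: cj_def)
next
  show "fixes_on (- un P') (cj g (tp P Q))"
    using fixes_on_cj_compl[OF tp_off[OF m(1)], of g] un_image[of P P' g] m g by simp
qed

lemma un_sub: "code P \<Longrightarrow> un P \<subseteq> \<Omega>"
  using cyl_sub_X by (fastforce simp: un_def code_def)

lemma tp_VV:
  assumes m: "mt P Q" shows "tp P Q \<in> VV"
proof -
  define n where "n = Max (insert 0 (length ` set P))"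
  have n: "length w \<le> n" if "w \<in> set P" for w using that by (simp add: n_def)
  have c: "code P" using m by (simp add: mt_def)
  have "\<exists>v. pr (tp P Q) w v" if w: "vw w" "length w = Suc n" for w
  proof (cases "cyl w \<inter> un P = {}")
    case True
    hence "pr (tp P Q) w w" using tp_off[OF m] w by (auto simp: pr_def fixes_on_def dest: cylI)
    thus ?thesis by blast
  next
    case False
    then obtain x i where x: "x \<in> cyl w" "i < length P" "x \<in> cyl (P ! i)"
      by (auto simp: un_def in_set_conv_nth)
    then obtain s where "w = P ! i @ s" "tw s"
      using cyl_meet_prefix[OF x(3,1) _ w(1)] c w(2) n[of "P ! i"] by (auto simp: code_def)
    thus ?thesis using goodD(4)[OF good_pr tp_pr[OF m x(2)]] by blast
  qed
  moreover have "fixes_on (- \<Omega>) (tp P Q)"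
    using tp_off[OF m] un_sub[OF c] by (auto intro: fixes_on_mono)
  ultimately show ?thesis unfolding VV_def locally_def by blast
qed

section \<open>Sorted complete prefix codes\<close>

definition wlt :: "nat list \<Rightarrow> nat list \<Rightarrow> bool" where
  "wlt v w \<longleftrightarrow> (\<forall>x\<in>cyl v. \<forall>y\<in>cyl w. lex_less x y)"

definition kids :: "nat list \<Rightarrow> nat list list" where
  "kids w = map (\<lambda>i. w @ [i]) [0..<d]"

text \<open>The leaves, from left to right, of a finite subtree in which every inner vertex has all its
  children.\<close>
inductive cp :: "nat list list \<Rightarrow> bool" where
  base: "cp (map (\<lambda>i. [i]) [0..<k])"
| step: "cp (A @ [w] @ B) \<Longrightarrow> cp (A @ kids w @ B)"

lemma length_kids [simp]: "length (kids w) = d"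
  by (simp add: kids_def)

lemma set_kids: "set (kids w) = {w @ [i] | i. i < d}"
  by (auto simp: kids_def)

lemma un_append [simp]: "un (P @ Q) = un P \<union> un Q"
  and un_Cons [simp]: "un (w # P) = cyl w \<union> un P" and un_Nil [simp]: "un [] = {}"
  by (auto simp: un_def)

lemma un_kids [simp]: "un (kids w) = cyl w"
proof
  have "cyl (w @ [i]) \<subseteq> cyl w" if "i < d" for i using that by (intro cyl_append_sub) simp
  thus "un (kids w) \<subseteq> cyl w" unfolding un_def set_kids by blast
  show "cyl w \<subseteq> un (kids w)"
  proof
    fix x assume "x \<in> cyl w"
    then obtain y where y: "y \<in> Tl" "x = w \<frown> y" by (rule cylE)
    have "y = pre 1 y \<frown> dr 1 y" by simp
    also have "pre 1 y = [y 0]" by (simp add: pre_def)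
    finally have "x = (w @ [y 0]) \<frown> dr 1 y" using y by (simp add: cat_append)
    moreover have "y 0 < d" "dr 1 y \<in> Tl" using y Tl_dr by (auto simp: Tl_def)
    ultimately show "x \<in> un (kids w)" by (auto simp: un_def set_kids intro: cylI)
  qed
qed

lemma wlt_irrefl: "\<not> wlt w w"
  using cyl_nonempty[of w] unfolding wlt_def by (metis ex_in_conv lex_less_irrefl)

lemma wlt_asym: "wlt v w \<Longrightarrow> \<not> wlt w v"
  using cyl_nonempty[of w] cyl_nonempty[of v] lex_less_asym by (fastforce simp: wlt_def)

lemma wlt_disjoint: "wlt v w \<Longrightarrow> cyl v \<inter> cyl w = {}"
  unfolding wlt_def by (metis disjoint_iff lex_less_irrefl)

lemma wlt_first: "i < j \<Longrightarrow> wlt (w @ i # s) (w @ j # t)"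
proof -
  assume "i < j"
  hence "lex_less ((i # s) \<frown> x) ((j # t) \<frown> y)" for x y
    unfolding lex_less_def by (intro exI[of _ 0]) simp
  thus ?thesis by (auto simp: wlt_def cyl_def cat_append)
qed

lemma wlt_sub: "wlt v w \<Longrightarrow> cyl v' \<subseteq> cyl v \<Longrightarrow> cyl w' \<subseteq> cyl w \<Longrightarrow> wlt v' w'"
  unfolding wlt_def by blast

lemma sorted_wrt_code: "sorted_wrt wlt P \<Longrightarrow> \<forall>w\<in>set P. vw w \<Longrightarrow> code P"
  by (induction P) (auto simp: code_Cons un_def dest: wlt_disjoint, simp add: code_def)

lemma cp_props: "cp P \<Longrightarrow> sorted_wrt wlt P \<and> (\<forall>w\<in>set P. vw w) \<and> un P = \<Omega>"
proof (induction rule: cp.induct)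
  case base
  have "wlt [i] [j]" if "i < j" for i j using wlt_first[OF that, of "[]" "[]" "[]"] by simp
  hence "sorted_wrt wlt (map (\<lambda>i. [i]) [0..<k])"
    by (auto simp: sorted_wrt_map sorted_wrt_iff_nth_less)
  moreover have "un (map (\<lambda>i. [i]) [0..<k]) = \<Omega>"
  proof
    show "\<Omega> \<subseteq> un (map (\<lambda>i. [i]) [0..<k])"
    proof
      fix x assume x: "x \<in> \<Omega>"
      hence "x \<in> cyl (pre 1 x)" using X_in_cyl by simp
      moreover have "pre 1 x = [x 0]" by (simp add: pre_def)
      moreover have "x 0 < k" using x by (simp add: Bd_def)
      ultimately show "x \<in> un (map (\<lambda>i. [i]) [0..<k])" by (auto simp: un_def)
    qed
    have "cyl [i] \<subseteq> \<Omega>" if "i < k" for i using that by (intro cyl_sub_X) (simp add: vw_hd_iff)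
    thus "un (map (\<lambda>i. [i]) [0..<k]) \<subseteq> \<Omega>" by (simp add: un_def UN_subset_iff)
  qed
  ultimately show ?case by (auto simp: vw_hd_iff)
next
  case (step A w B)
  have w: "vw w" using step by simp
  have ex_sub: "cyl v \<subseteq> cyl w" if "v \<in> set (kids w)" for v
    using that cyl_append_sub[of "[_]" w] by (auto simp: set_kids)
  have "sorted_wrt wlt (kids w)"
    unfolding kids_def by (auto simp: sorted_wrt_map sorted_wrt_iff_nth_less intro: wlt_first)
  moreover have s: "sorted_wrt wlt A" "sorted_wrt wlt B" "\<forall>u\<in>set A. wlt u w"
    "\<forall>u\<in>set B. wlt w u" "\<forall>u\<in>set A. \<forall>v\<in>set B. wlt u v"
    using step by (simp_all add: sorted_wrt_append)
  moreover have "wlt u v" if "u \<in> set A" "v \<in> set (kids w)" for u v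
    by (rule wlt_sub[OF bspec[OF s(3) that(1)] subset_refl ex_sub[OF that(2)]])
  moreover have "wlt v u" if "u \<in> set B" "v \<in> set (kids w)" for u v
    by (rule wlt_sub[OF bspec[OF s(4) that(1)] ex_sub[OF that(2)] subset_refl])
  ultimately have "sorted_wrt wlt (A @ kids w @ B)" by (simp add: sorted_wrt_append ball_Un)
  thus ?case using step w by (auto simp: set_kids vw_append)
qed

lemma cp_sorted: "cp P \<Longrightarrow> sorted_wrt wlt P" and cp_vw: "cp P \<Longrightarrow> w \<in> set P \<Longrightarrow> vw w"
  and cp_un: "cp P \<Longrightarrow> un P = \<Omega>" and cp_code: "cp P \<Longrightarrow> code P"
  using cp_props[of P] sorted_wrt_code[of P] by auto

lemma cp_mt: "cp P \<Longrightarrow> cp Q \<Longrightarrow> length P = length Q \<Longrightarrow> mt P Q"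
  by (simp add: mt_def cp_code cp_un)

text \<open>The invariant behind every matching of sizes: a code grows only in steps of
  \<open>d - 1\<close>.\<close>

lemma cp_length: "cp P \<Longrightarrow> \<exists>j. length P = k + j * (d - 1)"
proof (induction rule: cp.induct)
  case (step A w B)
  then obtain j where "length (A @ [w] @ B) = k + j * (d - 1)" by blast
  hence "length (A @ kids w @ B) = k + Suc j * (d - 1)" using d2 by simp
  thus ?case by blast
qed (auto intro: exI[of _ 0])

lemma cp_expand:
  assumes "cp (A @ [w] @ B)"
  shows "\<exists>E. length E = Suc (j * (d - 1)) \<and> (\<forall>e\<in>set E. \<exists>s. tw s \<and> e = w @ s) \<and> cp (A @ E @ B)"
proof (induction j)
  case 0
  show ?case using assms by (intro exI[of _ "[w]"]) auto
next
  case (Suc j)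
  then obtain E where E: "length E = Suc (j * (d - 1))" "\<forall>e\<in>set E. \<exists>s. tw s \<and> e = w @ s" "cp (A @ E @ B)"
    by blast
  then obtain e E' where E': "E = e # E'" by (cases E) auto
  have "cp (A @ (kids e @ E') @ B)" using cp.step[of A e "E' @ B"] E E' by simp
  moreover have "\<forall>e\<in>set (kids e @ E'). \<exists>s. tw s \<and> e = w @ s" using E E' by (auto simp: set_kids)
  moreover have "length (kids e @ E') = Suc (Suc j * (d - 1))" using E E' d2 by simp
  ultimately show ?case by blast
qed

text \<open>Undo one caret. The siblings of a longest word \<open>w\<close> all belong to
  \<open>S\<close>: a word of \<open>S\<close> meeting a sibling is not longer, and were it a proper
  prefix of the sibling, its ball would contain that of \<open>w\<close>. Replacing the siblings by
  their parent makes \<open>S\<close> smaller.\<close>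

lemma complete_cp:
  assumes "finite S" "\<And>w. w \<in> S \<Longrightarrow> vw w" "\<And>v w. v \<in> S \<Longrightarrow> w \<in> S \<Longrightarrow> v \<noteq> w \<Longrightarrow> cyl v \<inter> cyl w = {}"
    and "\<Union> (cyl ` S) = \<Omega>"
  shows "\<exists>P. cp P \<and> set P = S"
  using assms
proof (induction "card S" arbitrary: S rule: less_induct)
  case less
  note fin = less.prems(1) and vS = less.prems(2) and disj = less.prems(3) and cover = less.prems(4)
  have cov: "\<exists>w\<in>S. x \<in> cyl w" if "x \<in> \<Omega>" for x using cover that by blast
  show ?case
  proof (cases "\<forall>w\<in>S. length w \<le> 1")
    case True
    have S1: "\<exists>a. a < k \<and> w = [a]" if "w \<in> S" for w
      using True vS[OF that] that by (cases w) (auto simp: vw_hd_iff vw_not_Nil dest: vw_not_Nil)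
    have "[i] \<in> S" if "i < k" for i
    proof -
      have v: "vw [i]" using that by (simp add: vw_hd_iff)
      obtain x where x: "x \<in> \<Omega>" "x \<in> cyl [i]" using cyl_ex v by blast
      then obtain w where w: "w \<in> S" "x \<in> cyl w" using cov by blast
      then obtain a where "w = [a]" using S1 by blast
      hence "w = [i]" using x w cyl_iff[OF v] cyl_iff[OF vS[OF w(1)]] by simp
      thus ?thesis using w by simp
    qed
    hence "{[a] | a. a < k} = S" using S1 by blast
    moreover have "set (map (\<lambda>i. [i]) [0..<k]) = {[a] | a. a < k}" by auto
    ultimately have "set (map (\<lambda>i. [i]) [0..<k]) = S" by simp
    thus ?thesis using cp.base by blast
  next
    case False
    have "S \<noteq> {}" using False by auto
    hence "Max (length ` S) \<in> length ` S" using fin by (intro Max_in) auto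
    then obtain w where w: "w \<in> S" "length w = Max (length ` S)" by (metis imageE)
    hence w: "w \<in> S" "\<And>u. u \<in> S \<Longrightarrow> length u \<le> length w" using fin by auto
    have "length w \<ge> 2" using False w by fastforce
    moreover then obtain w' a where w'a: "w = w' @ [a]" by (cases w rule: rev_cases) auto
    ultimately have w': "w = w' @ [a]" "w' \<noteq> []" by auto
    have v': "vw w'" using vS[OF w(1)] w' vw_prefix by blast
    have a: "a < d" using vS[OF w(1)] vw_append[OF v', of "[a]"] w' by simp
    have sub: "cyl w \<subseteq> cyl w'" using cyl_append_sub[of "[a]" w'] a w' by simp
    have exS: "w' @ [j] \<in> S" if j: "j < d" for j
    proof -
      have vj: "vw (w' @ [j])" using v' j by (simp add: vw_append)
      obtain x where x: "x \<in> \<Omega>" "x \<in> cyl (w' @ [j])" using cyl_ex vj by blast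
      then obtain u where u: "u \<in> S" "x \<in> cyl u" using cov by blast
      have "length u \<le> length (w' @ [j])" using w(2)[OF u(1)] w' by simp
      then obtain s where s: "w' @ [j] = u @ s" "tw s"
        using cyl_meet_prefix[OF u(2) x(2) vS[OF u(1)] vj] by blast
      have "s = []"
      proof (rule ccontr)
        assume "s \<noteq> []"
        then obtain s' b where s': "s = s' @ [b]" by (cases s rule: rev_cases) auto
        hence "w' = u @ s'" "tw s'" using s by auto
        hence "cyl w \<subseteq> cyl u" using sub cyl_append_sub by blast
        moreover have "u \<noteq> w" using \<open>w' = u @ s'\<close> w' by auto
        ultimately show False using disj[OF u(1) w(1)] cyl_nonempty[of w] by blast
      qed
      thus ?thesis using s u by simp
    qed
    define E where "E = set (kids w')"
    have E: "E \<subseteq> S" "finite E" "card E = d" "\<Union> (cyl ` E) = cyl w'"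
    proof -
      show "card E = d" unfolding E_def by (subst distinct_card) (auto simp: kids_def distinct_map inj_on_def)
      show "\<Union> (cyl ` E) = cyl w'" using un_kids[of w'] by (simp add: un_def E_def)
    qed (use exS in \<open>auto simp: E_def set_kids\<close>)
    have w'S: "w' \<notin> S" using disj[OF _ w(1)] sub cyl_nonempty[of w] w' by blast
    define S' where "S' = insert w' (S - E)"
    have card: "card S' < card S"
    proof -
      have "card S' = Suc (card (S - E))" unfolding S'_def using w'S fin by simp
      also have "card (S - E) = card S - d" using E by (simp add: card_Diff_subset)
      finally show ?thesis using card_mono[OF fin E(1)] E(3) d2 by simp
    qed
    have disjE: "cyl v \<inter> cyl w' = {}" if "v \<in> S - E" for v
      using disj[of v] E(1,4) that by blast
    have "\<exists>P. cp P \<and> set P = S'"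
    proof (rule less.hyps[OF card])
      show "finite S'" using fin by (simp add: S'_def)
      show "vw v" if "v \<in> S'" for v using that vS v' by (auto simp: S'_def)
      show "cyl u \<inter> cyl v = {}" if "u \<in> S'" "v \<in> S'" "u \<noteq> v" for u v
        using that disj disjE by (auto simp: S'_def)
      show "\<Union> (cyl ` S') = \<Omega>"
        unfolding S'_def cover[symmetric] image_insert Union_insert E(4)[symmetric] using E(1) by blast
    qed
    then obtain P where P: "cp P" "set P = S'" by blast
    then obtain A B where AB: "P = A @ [w'] @ B" by (metis S'_def append_Cons append_Nil insertI1 split_list)
    have "distinct P" using cp_code[OF P(1)] by (simp add: code_def)
    hence "set (A @ B) = S - E" using AB P w'S by (auto simp: S'_def)
    hence "set (A @ kids w' @ B) = S" using E(1) by (auto simp: E_def)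
    moreover have "cp (A @ kids w' @ B)" using cp.step P AB by blast
    ultimately show ?thesis by blast
  qed
qed

lemma sorted_wlt_unique: "sorted_wrt wlt P \<Longrightarrow> sorted_wrt wlt Q \<Longrightarrow> set P = set Q \<Longrightarrow> P = Q"
proof (induction P arbitrary: Q)
  case (Cons v P)
  then obtain w Q' where Q: "Q = w # Q'" by (cases Q) auto
  have "v = w"
  proof (rule ccontr)
    assume "v \<noteq> w"
    hence "v \<in> set Q'" "w \<in> set P" using Cons.prems Q by auto
    thus False using Cons.prems Q wlt_asym by auto
  qed
  moreover have "v \<notin> set P" "w \<notin> set Q'" using Cons.prems Q wlt_irrefl by auto
  ultimately have "set P = set Q'" using Cons.prems(3) Q by auto
  thus ?case using Cons Q \<open>v = w\<close> by auto
qed simp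

text \<open>\<open>P\<close> is a whole level, \<open>Q\<close> lists the image balls in the order
  of \<open>P\<close>, and \<open>Q'\<close> is \<open>Q\<close> sorted from left to right. A large
  \<open>m\<close> serves to stay below given vertices or to guarantee enough leaves.\<close>

lemma locally_cases:
  assumes R: "good R" and p: "locally R p"
  obtains P Q Q' where "cp P" "cp Q'" "mset Q = mset Q'" "mt P Q" "list_all2 (R p) P Q"
    "\<And>w. w \<in> set P \<union> set Q \<Longrightarrow> m < length w"
proof -
  have fx: "fixes_on (- \<Omega>) p" using p by (auto simp: locally_def)
  obtain n0 where n0: "\<And>w. vw w \<Longrightarrow> n0 < length w \<Longrightarrow> \<exists>v. R p w v \<and> length w \<le> length v + n0"
    using locally_long[OF R p] by blast
  \<comment> \<open>The images lose at most \<open>n0\<close> letters, so they too are longer than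
    \<open>m\<close>.\<close>
  define n where "n = n0 + m"
  define S where "S = {w. vw w \<and> length w = Suc n}"
  have "\<exists>v. R p w v \<and> length w \<le> length v + n0" if "w \<in> S" for w
    using n0[of w] that by (simp add: S_def n_def)
  hence "\<forall>w\<in>S. \<exists>v. R p w v \<and> length w \<le> length v + n0" by blast
  from bchoice[OF this] obtain f where f: "\<And>w. w \<in> S \<Longrightarrow> R p w (f w)"
    "\<And>w. w \<in> S \<Longrightarrow> length w \<le> length (f w) + n0" by blast
  have "\<exists>P. cp P \<and> set P = S"
  proof (rule complete_cp)
    show "\<Union> (cyl ` S) = \<Omega>"
      using level_partition[of n] by (simp add: admissible_partition_def S_def)
  qed (use finite_words cyl_disjoint_same_length in \<open>auto simp: S_def\<close>)
  then obtain P where P: "cp P" "set P = S" by blast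
  define Q where "Q = map f P"
  have rel: "list_all2 (R p) P Q" 
    unfolding Q_def list.rel_map by (rule list.rel_refl_strong) (use f(1) P(2) in simp)
  have im: "cyl (f w) = ap p ` cyl w" if "w \<in> S" for w using goodD(3)[OF R f(1)[OF that]] by simp
  have disj: "cyl (f v) \<inter> cyl (f w) = {}" if "v \<in> S" "w \<in> S" "v \<noteq> w" for v w
  proof -
    have "cyl v \<inter> cyl w = {}" using cp_code[OF P(1)] that P(2) by (simp add: code_def)
    thus ?thesis by (simp add: im that flip: image_Int[OF bij_is_inj[OF bij_ap]])
  qed
  have "inj_on f S" using disj cyl_nonempty by (metis Int_absorb inj_onI)
  moreover have "vw (f w)" if "w \<in> S" for w using goodD(2)[OF R f(1)[OF that]] .
  ultimately have cQ: "code Q" using cp_code[OF P(1)] P(2) disj by (auto simp: code_def Q_def distinct_map)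
  have "un Q = ap p ` un P" using P(2) im by (simp add: un_def Q_def image_UN)
  also have "\<dots> = \<Omega>" using bij_betw_fixes_on[OF fx] cp_un[OF P(1)] by (simp add: bij_betw_def)
  finally have uQ: "un Q = \<Omega>" .
  have mPQ: "mt P Q" using cQ uQ P by (simp add: mt_def cp_code cp_un Q_def)
  have "\<exists>Q'. cp Q' \<and> set Q' = set Q"
    using cQ uQ by (intro complete_cp) (auto simp: code_def un_def)
  then obtain Q' where Q': "cp Q'" "set Q' = set Q" by blast
  have "mset Q = mset Q'"
    using Q' cQ cp_code[OF Q'(1)] by (simp add: code_def set_eq_iff_mset_eq_distinct)
  moreover have "m < length w" if w: "w \<in> set P \<union> set Q" for w
  proof (cases "w \<in> S")
    case True
    thus ?thesis by (simp add: S_def n_def)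
  next
    case False
    then obtain u where "u \<in> S" "w = f u" using w P(2) by (auto simp: Q_def)
    thus ?thesis using f(2)[of u] by (simp add: S_def n_def)
  qed
  ultimately show ?thesis using that P(1) Q'(1) mPQ rel by blast
qed

lemma VV_fixes: "p \<in> VV \<Longrightarrow> fixes_on (- \<Omega>) p"
  using VV_AA AA_fixes by blast

lemma VV_cases:
  assumes "p \<in> VV"
  obtains P Q Q' where "cp P" "cp Q'" "mset Q = mset Q'" "mt P Q" "p = tp P Q"
    "\<And>w. w \<in> set P \<union> set Q \<Longrightarrow> m < length w"
proof -
  have "locally pr p" using assms by (simp add: VV_def)
  then obtain P Q Q' where PQ: "cp P" "cp Q'" "mset Q = mset Q'" "mt P Q" "list_all2 (pr p) P Q"
    "\<And>w. w \<in> set P \<union> set Q \<Longrightarrow> m < length w"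
    using locally_cases[OF good_pr, of p m] by metis
  have "p = tp P Q"
    using tp_eqI[OF PQ(4,5)] cp_un[OF PQ(1)] VV_fixes[OF assms] by simp
  thus ?thesis using that PQ by blast
qed

text \<open>An order preserving map lists the image balls from left to right, so \<open>Q\<close> is
  already sorted.\<close>

lemma FF_cases:
  assumes "p \<in> FF"
  obtains P Q where "cp P" "cp Q" "length P = length Q" "p = tp P Q"
    "\<And>w. w \<in> set P \<union> set Q \<Longrightarrow> m < length w"
proof -
  have "p \<in> VV" using assms FF_VV by blast
  then obtain P Q Q' where PQ: "cp P" "cp Q'" "mset Q = mset Q'" "mt P Q" "p = tp P Q"
    "\<And>w. w \<in> set P \<union> set Q \<Longrightarrow> m < length w"
    using VV_cases[of p m] by metis
  have o: "order_pres_on \<Omega> (ap p)" using assms by (simp add: FF_def)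
  have "sorted_wrt wlt Q" unfolding sorted_wrt_iff_nth_less
  proof (intro allI impI)
    fix i j assume ij: "i < j" "j < length Q"
    hence l: "i < length P" "j < length P" using PQ(4) by (auto simp: mt_def)
    have P: "wlt (P ! i) (P ! j)" using cp_sorted[OF PQ(1)] ij l by (simp add: sorted_wrt_iff_nth_less)
    have sub: "cyl (P ! i) \<subseteq> \<Omega>" "cyl (P ! j) \<subseteq> \<Omega>" using cyl_sub_X cp_vw[OF PQ(1)] l by auto
    have im: "cyl (Q ! i) = ap p ` cyl (P ! i)" "cyl (Q ! j) = ap p ` cyl (P ! j)"
      using pr_image[OF tp_pr[OF PQ(4)]] l PQ(5) by auto
    show "wlt (Q ! i) (Q ! j)" unfolding wlt_def im
      using P sub by (auto simp: wlt_def intro!: order_pres_onD[OF o])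
  qed
  hence "Q = Q'" using sorted_wlt_unique cp_sorted[OF PQ(2)] PQ(3) by (metis set_mset_mset)
  thus ?thesis using that[of P Q] PQ by (auto simp: mt_def)
qed

lemma all2_order:
  assumes a: "list_all2 (pr p) L L'" and s: "sorted_wrt wlt L" "sorted_wrt wlt L'"
    and xy: "x \<in> un L" "y \<in> un L" "lex_less x y"
  shows "lex_less (ap p x) (ap p y)"
proof -
  obtain i j a b where i: "i < length L" "a \<in> Tl" "x = L ! i \<frown> a" and j: "j < length L" "b \<in> Tl" "y = L ! j \<frown> b"
    using xy by (auto simp: un_nth)
  have len: "length L = length L'" using a by (rule list_all2_lengthD)
  have e: "ap p x = L' ! i \<frown> a" "ap p y = L' ! j \<frown> b"
    using a i j unfolding list_all2_conv_all_nth pr_def by auto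
  consider "i < j" | "i = j" | "j < i" by linarith
  thus ?thesis
  proof cases
    case 1
    hence "wlt (L' ! i) (L' ! j)" using s(2) j len by (simp add: sorted_wrt_iff_nth_less)
    thus ?thesis unfolding e wlt_def using i j by (simp add: cylI)
  next
    case 2
    thus ?thesis using xy(3) i j e by simp
  next
    case 3
    hence "wlt (L ! j) (L ! i)" using s(1) i by (simp add: sorted_wrt_iff_nth_less)
    hence "lex_less y x" unfolding wlt_def using i j by (simp add: cylI)
    thus ?thesis using xy(3) lex_less_asym by blast
  qed
qed

lemma tp_FF: "cp P \<Longrightarrow> cp Q \<Longrightarrow> length P = length Q \<Longrightarrow> tp P Q \<in> FF"
  unfolding FF_def order_pres_on_def
  using all2_order[OF tp_all2[OF cp_mt[of P Q]]] by (auto simp: tp_VV cp_mt cp_sorted cp_un)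

end

section \<open>The group F\<close>

lemma upt_ends:
  assumes "1 < n"
  shows "[0..<n] = 0 # [1..<n]" "[0..<n] = [0..<n - 1] @ [n - 1]" "[1..<n] = [1..<n - 1] @ [n - 1]"
proof -
  show "[0..<n] = 0 # [1..<n]" using assms by (simp add: upt_conv_Cons)
  obtain m where "n = Suc m" using assms by (cases n) auto
  thus "[0..<n] = [0..<n - 1] @ [n - 1]" "[1..<n] = [1..<n - 1] @ [n - 1]" using assms by auto
qed

context tree
begin

lemma cp_contains: "vw w \<Longrightarrow> \<exists>A B. cp (A @ [w] @ B)"
proof (induction w rule: rev_induct)
  case Nil
  thus ?case by (simp add: vw_def)
next
  case (snoc a w)
  show ?case
  proof (cases "w = []")
    case True
    hence "a < k" using snoc.prems by (simp add: vw_hd_iff)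
    hence "[a] \<in> set (map (\<lambda>i. [i]) [0..<k])" by auto
    then obtain A B where "map (\<lambda>i. [i]) [0..<k] = A @ [a] # B" by (metis split_list)
    thus ?thesis using cp.base True by (metis append_Cons append_Nil)
  next
    case False
    hence v: "vw w" using snoc.prems vw_prefix by blast
    hence a: "a < d" using snoc.prems vw_append[OF v, of "[a]"] by simp
    obtain A B where AB: "cp (A @ [w] @ B)" using snoc.IH v by blast
    have "w @ [a] \<in> set (kids w)" using a by (auto simp: set_kids)
    then obtain A' B' where "kids w = A' @ (w @ [a]) # B'" by (metis split_list)
    hence "cp ((A @ A') @ [w @ [a]] @ (B' @ B))" using cp.step[OF AB] by simp
    thus ?thesis by blast
  qed
qed

text \<open>The vertices with n + 1 letters on the leftmost and on the rightmost ray, which are the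
  two end points fixed by F; \<open>inner n\<close> is the interval left between their
  balls.\<close>

definition lw :: "nat \<Rightarrow> nat list" where "lw n = 0 # replicate n 0"
definition rw :: "nat \<Rightarrow> nat list" where "rw n = (k - 1) # replicate n (d - 1)"
definition inner :: "nat \<Rightarrow> (nat \<Rightarrow> nat) set" where "inner n = \<Omega> - (cyl (lw n) \<union> cyl (rw n))"

lemma lw_Suc: "lw (Suc n) = lw n @ [0]" and rw_Suc: "rw (Suc n) = rw n @ [d - 1]"
  by (simp_all add: lw_def rw_def replicate_append_same)

lemma length_lw [simp]: "length (lw n) = Suc n" and length_rw [simp]: "length (rw n) = Suc n"
  by (simp_all add: lw_def rw_def)

lemma vw_lw [simp]: "vw (lw n)" and vw_rw [simp]: "vw (rw n)"
  using d2 k2 by (auto simp: lw_def rw_def vw_hd_iff tw_def)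

lemma kids_ends: "kids w = (w @ [0]) # map (\<lambda>i. w @ [i]) [1..<d]"
  "kids w = map (\<lambda>i. w @ [i]) [0..<d - 1] @ [w @ [d - 1]]"
  using d2 unfolding kids_def by (subst upt_ends(1), simp_all) (subst upt_ends(2), simp_all)

lemma base_ends: "map (\<lambda>i. [i]) [0..<k] = lw 0 # map (\<lambda>i. [i]) [1..<k]"
  "map (\<lambda>i. [i]) [0..<k] = map (\<lambda>i. [i]) [0..<k - 1] @ [rw 0]"
  "map (\<lambda>i. [i]) [1..<k] = map (\<lambda>i. [i]) [1..<k - 1] @ [rw 0]"
  using upt_ends[of k] k2 by (simp_all add: lw_def rw_def)

lemma cp_ends: "\<exists>M. cp (lw n # M @ [rw n])"
proof (induction n)
  case 0
  show ?case using cp.base unfolding base_ends(1) base_ends(3) by blast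
next
  case (Suc n)
  then obtain M where "cp ([] @ [lw n] @ (M @ [rw n]))" by auto
  hence "cp ((kids (lw n) @ M) @ [rw n] @ [])" using cp.step by fastforce
  hence *: "cp ((kids (lw n) @ M) @ kids (rw n) @ [])" by (rule cp.step)
  have eq: "(kids (lw n) @ M) @ kids (rw n) @ [] =
      lw (Suc n) # (map (\<lambda>i. lw n @ [i]) [1..<d] @ M @ map (\<lambda>i. rw n @ [i]) [0..<d - 1]) @ [rw (Suc n)]"
    by (simp add: kids_ends(1)[of "lw n"] kids_ends(2)[of "rw n"] lw_Suc rw_Suc)
  show ?case using *[unfolded eq] by blast
qed

lemma ends_middle:
  assumes "cp (lw n # M @ [rw n])"
  shows "un M = inner n" "cyl (lw n) \<inter> cyl (rw n) = {}"
proof -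
  have c: "sorted_wrt wlt (lw n # M @ [rw n])" "cyl (lw n) \<union> un M \<union> cyl (rw n) = \<Omega>"
    using cp_sorted[OF assms] cp_un[OF assms] by auto
  have "cyl (lw n) \<inter> cyl w = {}" "cyl (rw n) \<inter> cyl w = {}" if "w \<in> set M" for w
    using wlt_disjoint[of "lw n" w] wlt_disjoint[of w "rw n"] c(1) that
    by (simp_all add: sorted_wrt_append Int_commute)
  hence "cyl (lw n) \<inter> un M = {}" "cyl (rw n) \<inter> un M = {}" by (simp_all add: un_disjoint)
  moreover have "cyl (lw n) \<inter> cyl (rw n) = {}"
    using wlt_disjoint[of "lw n" "rw n"] c(1) by (simp add: sorted_wrt_append)
  ultimately have "cyl (lw n) \<inter> un M = {}" "cyl (rw n) \<inter> un M = {}" "cyl (lw n) \<inter> cyl (rw n) = {}"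
    by blast+
  thus "un M = inner n" "cyl (lw n) \<inter> cyl (rw n) = {}" using c(2) unfolding inner_def by blast+
qed

lemma lw_rw_disjoint: "cyl (lw n) \<inter> cyl (rw n) = {}"
  using cp_ends ends_middle(2) by blast

lemma lw_first: "x \<in> cyl (lw n) \<Longrightarrow> y \<in> \<Omega> \<Longrightarrow> y \<notin> cyl (lw n) \<Longrightarrow> lex_less x y"
  and rw_last: "x \<in> \<Omega> \<Longrightarrow> x \<notin> cyl (rw n) \<Longrightarrow> y \<in> cyl (rw n) \<Longrightarrow> lex_less x y"
proof -
  obtain M where M: "cp (lw n # M @ [rw n])" using cp_ends by blast
  have s: "\<forall>w\<in>set (M @ [rw n]). wlt (lw n) w" "\<forall>w\<in>set (lw n # M). wlt w (rw n)"
    using cp_sorted[OF M] by (auto simp: sorted_wrt_append)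
  have u: "cyl (lw n) \<union> un (M @ [rw n]) = \<Omega>" "un (lw n # M) \<union> cyl (rw n) = \<Omega>"
    using cp_un[OF M] by auto
  show "lex_less x y" if "x \<in> cyl (lw n)" "y \<in> \<Omega>" "y \<notin> cyl (lw n)"
  proof -
    have "y \<in> un (M @ [rw n])" using u(1) that by blast
    then obtain w where "w \<in> set (M @ [rw n])" "y \<in> cyl w" unfolding un_def by blast
    thus ?thesis using s(1) that(1) unfolding wlt_def by blast
  qed
  show "lex_less x y" if "x \<in> \<Omega>" "x \<notin> cyl (rw n)" "y \<in> cyl (rw n)"
  proof -
    have "x \<in> un (lw n # M)" using u(2) that by blast
    then obtain w where "w \<in> set (lw n # M)" "x \<in> cyl w" unfolding un_def by blast
    thus ?thesis using s(2) that(3) unfolding wlt_def by blast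
  qed
qed

lemma cyl_lw_Suc: "cyl (lw (Suc n)) \<subseteq> cyl (lw n)" and cyl_rw_Suc: "cyl (rw (Suc n)) \<subseteq> cyl (rw n)"
  using d2 by (auto simp: lw_Suc rw_Suc intro!: cyl_append_sub)

lemma inner_mono: "n \<le> m \<Longrightarrow> inner n \<subseteq> inner m"
proof (induction m rule: dec_induct)
  case (step m)
  thus ?case using cyl_lw_Suc[of m] cyl_rw_Suc[of m] unfolding inner_def by blast
qed simp

text \<open>An element of F matches leaves by position only. So the leaves at the two ends of the
  source and the leaf \<open>v\<close> of the target are expanded until the positions of
  \<open>M\<close>, which covers \<open>inner n\<close>, fall among the leaves below
  \<open>v\<close>.\<close>

lemma F_push: "vw v \<Longrightarrow> \<exists>f\<in>FF. ap f ` inner n \<subseteq> cyl v"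
proof -
  assume v: "vw v"
  obtain A B where Q: "cp (A @ [v] @ B)" using cp_contains v by blast
  obtain M where P: "cp (lw n # M @ [rw n])" using cp_ends by blast
  obtain a where a: "length (lw n # M @ [rw n]) = k + a * (d - 1)" using cp_length[OF P] by blast
  obtain b where b: "length (A @ [v] @ B) = k + b * (d - 1)" using cp_length[OF Q] by blast
  have "cp ([] @ [lw n] @ (M @ [rw n]))" using P by simp
  \<comment> \<open>\<open>length A\<close> expansions put more than \<open>length A\<close> leaves
    to the left of \<open>M\<close>, and \<open>length B + b\<close> expansions more than
    \<open>length B\<close> to its right. With \<open>a + length A + length B\<close> expansions of
    \<open>v\<close> the two codes get the same size.\<close>
  from cp_expand[OF this, of "length A"] obtain E1 where
    E1: "length E1 = Suc (length A * (d - 1))" "cp ((E1 @ M) @ [rw n] @ [])" by auto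
  from cp_expand[OF E1(2), of "length B + b"] obtain E2 where
    E2: "length E2 = Suc ((length B + b) * (d - 1))" "cp (E1 @ M @ E2)" by auto
  from cp_expand[OF Q, of "a + length A + length B"] obtain E where
    E: "length E = Suc ((a + length A + length B) * (d - 1))"
    "\<forall>e\<in>set E. \<exists>s. tw s \<and> e = v @ s" "cp (A @ E @ B)" by auto
  have len: "length (E1 @ M @ E2) = length (A @ E @ B)"
    using a b E1 E2 E by (simp add: algebra_simps)
  have d1: "n \<le> n * (d - 1)" for n using d2 by (cases "d - 1") auto
  have lA: "length A < length E1" unfolding E1(1) by (rule le_imp_less_Suc[OF d1])
  have lB: "length B < length E2" unfolding E2(1) by (rule le_imp_less_Suc[OF order_trans[OF le_add1 d1]])
  define f where "f = tp (E1 @ M @ E2) (A @ E @ B)"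
  have m: "mt (E1 @ M @ E2) (A @ E @ B)" using E2(2) E(3) len by (rule cp_mt)
  have "f \<in> FF" unfolding f_def using E2(2) E(3) len by (rule tp_FF)
  moreover have "ap f x \<in> cyl v" if "x \<in> inner n" for x
  proof -
    have "x \<in> un M" using that ends_middle(1)[OF P] by simp
    then obtain i y where i: "i < length M" "y \<in> Tl" "x = M ! i \<frown> y" by (auto simp: un_nth)
    let ?j = "length E1 + i"
    have j: "?j < length (E1 @ M @ E2)" "(E1 @ M @ E2) ! ?j = M ! i" using i by (auto simp: nth_append)
    have "length A \<le> ?j" "?j - length A < length E" using lA lB len i by auto
    hence e: "(A @ E @ B) ! ?j = E ! (?j - length A)" "E ! (?j - length A) \<in> set E"
      by (auto simp: nth_append)
    then obtain s where s: "tw s" "(A @ E @ B) ! ?j = v @ s" using E(2) by force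
    have "ap f x = (v @ s) \<frown> y" using tp_at[OF m j(1) i(2)] j s i by (simp add: f_def)
    thus ?thesis using s i by (simp add: cat_append Tl_cat)
  qed
  ultimately show ?thesis by blast
qed

subsection \<open>Truncation at the end points\<close>

text \<open>The injection \<open>squeeze n\<close> squeezes the two extreme balls of radius \<open>d\<^sup>-\<^sup>n\<^sup>-\<^sup>1\<close> into
  sub-balls not containing the end points. Its image is an interval, so that
  conjugation with \<open>squeeze n\<close> embeds \<open>F\<close> into the elements of \<open>F\<close> with support away from the
  end points.\<close>
definition squeeze :: "nat \<Rightarrow> (nat \<Rightarrow> nat) \<Rightarrow> nat \<Rightarrow> nat" where
  "squeeze n = tpf [(lw n, lw n @ [d - 1]), (rw n, rw n @ [0])]"

definition squeezew :: "nat \<Rightarrow> nat list \<Rightarrow> nat list" where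
  "squeezew n w = (if prefix (lw n) w then lw n @ (d - 1) # drop (Suc n) w
     else if prefix (rw n) w then rw n @ 0 # drop (Suc n) w else w)"

lemma cat_in_cyl_iff:
  assumes "vw u" "vw w" "length u \<le> length w" "y \<in> Tl"
  shows "w \<frown> y \<in> cyl u \<longleftrightarrow> prefix u w"
proof
  assume "w \<frown> y \<in> cyl u"
  thus "prefix u w" using cyl_meet_prefix[of "w \<frown> y" u w] assms by (metis cylI prefixI)
next
  assume "prefix u w"
  then obtain s where "w = u @ s" by (rule prefixE)
  thus "w \<frown> y \<in> cyl u" using assms by (simp add: cat_append Tl_cat vw_append)
qed

lemma squeeze_simps:
  "y \<in> Tl \<Longrightarrow> squeeze n (lw n \<frown> y) = lw n \<frown> [d - 1] \<frown> y"
  "y \<in> Tl \<Longrightarrow> squeeze n (rw n \<frown> y) = rw n \<frown> [0] \<frown> y"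
  "x \<notin> cyl (lw n) \<Longrightarrow> x \<notin> cyl (rw n) \<Longrightarrow> squeeze n x = x"
proof -
  show "squeeze n (lw n \<frown> y) = lw n \<frown> [d - 1] \<frown> y" if "y \<in> Tl"
    using that dr_cat[of "lw n" y] by (simp add: squeeze_def cat_append)
  show "squeeze n (rw n \<frown> y) = rw n \<frown> [0] \<frown> y" if "y \<in> Tl"
  proof -
    have "rw n \<frown> y \<notin> cyl (lw n)" using lw_rw_disjoint that cylI by blast
    thus ?thesis using that dr_cat[of "rw n" y] by (simp add: squeeze_def cat_append)
  qed
  show "squeeze n x = x" if "x \<notin> cyl (lw n)" "x \<notin> cyl (rw n)"
    using that by (simp add: squeeze_def)
qed

lemma squeeze_word:
  assumes w: "vw w" "Suc n \<le> length w"
  shows "y \<in> Tl \<Longrightarrow> squeeze n (w \<frown> y) = squeezew n w \<frown> y" "vw (squeezew n w)"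
proof -
  consider s where "w = lw n @ s" "tw s" | s where "w = rw n @ s" "tw s"
    | "\<not> prefix (lw n) w" "\<not> prefix (rw n) w"
    using w(1) by (metis prefixE vw_append vw_lw vw_rw)
  hence "(\<forall>y\<in>Tl. squeeze n (w \<frown> y) = squeezew n w \<frown> y) \<and> vw (squeezew n w)"
  proof cases
    case 1
    hence "squeezew n w = lw n @ (d - 1) # s" by (simp add: squeezew_def)
    moreover have "(lw n @ (d - 1) # s) \<frown> y = lw n \<frown> [d - 1] \<frown> s \<frown> y" for y
      by (simp flip: cat_append)
    ultimately show ?thesis using 1 d2 by (simp add: squeeze_simps Tl_cat cat_append[of "lw n" s] vw_append)
  next
    case 2
    have "lw n \<noteq> rw n" using k2 by (simp add: lw_def rw_def)
    hence "\<not> prefix (lw n) w" using 2 by (metis append_eq_append_conv length_lw length_rw prefixE)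
    hence "squeezew n w = rw n @ 0 # s" using 2 by (simp add: squeezew_def)
    moreover have "(rw n @ 0 # s) \<frown> y = rw n \<frown> [0] \<frown> s \<frown> y" for y
      by (simp flip: cat_append)
    ultimately show ?thesis using 2 d2 by (simp add: squeeze_simps Tl_cat cat_append[of "rw n" s] vw_append)
  next
    case 3
    thus ?thesis using w cat_in_cyl_iff[of "lw n" w] cat_in_cyl_iff[of "rw n" w]
      by (auto simp: squeezew_def intro!: squeeze_simps)
  qed
  thus "y \<in> Tl \<Longrightarrow> squeeze n (w \<frown> y) = squeezew n w \<frown> y" "vw (squeezew n w)" by auto
qed

lemma squeeze_lw: "x \<in> cyl (lw n) \<Longrightarrow> squeeze n x \<in> cyl (lw n @ [d - 1])"
  and squeeze_rw: "x \<in> cyl (rw n) \<Longrightarrow> squeeze n x \<in> cyl (rw n @ [0])"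
  by (auto elim!: cylE simp: squeeze_simps cylI simp flip: cat_append)

lemma squeeze_cases:
  assumes "x \<in> \<Omega>"
  obtains y where "y \<in> Tl" "x = lw n \<frown> y" "x \<in> cyl (lw n)" "x \<notin> cyl (rw n)"
      "squeeze n x = lw n \<frown> [d - 1] \<frown> y" "squeeze n x \<in> cyl (lw n)" "squeeze n x \<notin> cyl (rw n)"
  | y where "y \<in> Tl" "x = rw n \<frown> y" "x \<in> cyl (rw n)" "x \<notin> cyl (lw n)"
      "squeeze n x = rw n \<frown> [0] \<frown> y" "squeeze n x \<in> cyl (rw n)" "squeeze n x \<notin> cyl (lw n)"
  | "x \<in> inner n" "squeeze n x = x" "x \<notin> cyl (rw n)" "x \<notin> cyl (lw n)"
proof -
  have d0: "d - 1 < d" "0 < d" using d2 by auto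
  consider "x \<in> cyl (lw n)" | "x \<in> cyl (rw n)" | "x \<notin> cyl (lw n)" "x \<notin> cyl (rw n)" by blast
  thus ?thesis
  proof cases
    case 1
    then obtain y where y: "y \<in> Tl" "x = lw n \<frown> y" by (rule cylE)
    have "squeeze n x \<in> cyl (lw n)" using y d0 by (simp add: squeeze_simps Tl_cat)
    thus ?thesis using that(1)[OF y 1] squeeze_simps(1)[OF y(1)] y(2) lw_rw_disjoint 1 by blast
  next
    case 2
    then obtain y where y: "y \<in> Tl" "x = rw n \<frown> y" by (rule cylE)
    have "squeeze n x \<in> cyl (rw n)" using y d0 by (simp add: squeeze_simps Tl_cat)
    thus ?thesis using that(2)[OF y 2] squeeze_simps(2)[OF y(1)] y(2) lw_rw_disjoint 2 by blast
  next
    case 3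
    thus ?thesis using that(3) assms squeeze_simps(3) by (simp add: inner_def)
  qed
qed

lemma squeeze_X: "x \<in> \<Omega> \<Longrightarrow> squeeze n x \<in> \<Omega>"
  by (erule squeeze_cases[where n = n])
    (use subsetD[OF cyl_sub_X[OF vw_lw]] subsetD[OF cyl_sub_X[OF vw_rw]] in \<open>simp_all only: inner_def Diff_iff\<close>)

lemma squeeze_less:
  assumes "x \<in> \<Omega>" "y \<in> \<Omega>" "lex_less x y" shows "lex_less (squeeze n x) (squeeze n y)"
proof -
  note X = squeeze_X[OF assms(1), of n] squeeze_X[OF assms(2), of n]
  have not: "\<not> lex_less y x" using assms(3) lex_less_asym by blast
  show ?thesis
  proof (rule squeeze_cases[OF assms(1), of n])
    fix a assume a: "a \<in> Tl" "x = lw n \<frown> a" "squeeze n x = lw n \<frown> [d - 1] \<frown> a" "squeeze n x \<in> cyl (lw n)"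
    show ?thesis
    proof (rule squeeze_cases[OF assms(2), of n])
      fix b assume "y = lw n \<frown> b" "squeeze n y = lw n \<frown> [d - 1] \<frown> b"
      thus ?thesis using a assms(3) by simp
    next
      fix b assume "squeeze n y \<notin> cyl (lw n)"
      thus ?thesis using lw_first a X by blast
    next
      assume "squeeze n y = y" "y \<notin> cyl (lw n)"
      thus ?thesis using lw_first a X by metis
    qed
  next
    fix a assume a: "a \<in> Tl" "x = rw n \<frown> a" "squeeze n x = rw n \<frown> [0] \<frown> a" "x \<in> cyl (rw n)"
    show ?thesis
    proof (rule squeeze_cases[OF assms(2), of n])
      fix b assume "y = rw n \<frown> b" "squeeze n y = rw n \<frown> [0] \<frown> b"
      thus ?thesis using a assms(3) by simp
    next
      fix b assume "y \<notin> cyl (rw n)"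
      thus ?thesis using rw_last[OF assms(2) _ a(4)] not by blast
    next
      assume "y \<notin> cyl (rw n)"
      thus ?thesis using rw_last[OF assms(2) _ a(4)] not by blast
    qed
  next
    assume a: "squeeze n x = x" "x \<notin> cyl (rw n)" "x \<notin> cyl (lw n)"
    show ?thesis
    proof (rule squeeze_cases[OF assms(2), of n])
      fix b assume "y \<in> cyl (lw n)"
      thus ?thesis using lw_first[OF _ assms(1) a(3)] not by blast
    next
      fix b assume "squeeze n y \<in> cyl (rw n)"
      thus ?thesis using rw_last[OF assms(1) a(2)] a(1) by simp
    next
      assume "squeeze n y = y"
      thus ?thesis using a assms(3) by simp
    qed
  qed
qed

text \<open>The first \<open>d - 1\<close> children of \<open>lw n\<close> are missed by
  \<open>squeeze n\<close> and lie to the left of its range. They reappear as the outer leaves in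
  \<open>cp_squeeze\<close>.\<close>

lemma squeeze_above: "i < d - 1 \<Longrightarrow> z \<in> cyl (lw n @ [i]) \<Longrightarrow> x \<in> \<Omega> \<Longrightarrow> lex_less z (squeeze n x)"
proof -
  assume i: "i < d - 1" and z: "z \<in> cyl (lw n @ [i])" and x: "x \<in> \<Omega>"
  have "i < d" using i by simp
  hence zl: "z \<in> cyl (lw n)" using z cyl_append_sub[of "[i]" "lw n"] by auto
  show ?thesis
  proof (cases "squeeze n x \<in> cyl (lw n)")
    case True
    hence "x \<in> cyl (lw n)" by (rule_tac squeeze_cases[OF x, of n]) auto
    hence "squeeze n x \<in> cyl (lw n @ [d - 1])" by (rule squeeze_lw)
    thus ?thesis using wlt_first[OF i, of "lw n" "[]" "[]"] z by (simp add: wlt_def)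
  next
    case False
    thus ?thesis using lw_first[OF zl squeeze_X[OF x]] by blast
  qed
qed

lemma squeeze_below: "0 < i \<Longrightarrow> i < d \<Longrightarrow> z \<in> cyl (rw n @ [i]) \<Longrightarrow> x \<in> \<Omega> \<Longrightarrow> lex_less (squeeze n x) z"
proof -
  assume i: "0 < i" "i < d" and z: "z \<in> cyl (rw n @ [i])" and x: "x \<in> \<Omega>"
  have zl: "z \<in> cyl (rw n)" using z i cyl_append_sub[of "[i]" "rw n"] by auto
  show ?thesis
  proof (cases "squeeze n x \<in> cyl (rw n)")
    case True
    hence "x \<in> cyl (rw n)" by (rule_tac squeeze_cases[OF x, of n]) auto
    hence "squeeze n x \<in> cyl (rw n @ [0])" by (rule squeeze_rw)
    thus ?thesis using wlt_first[OF i(1), of "rw n" "[]" "[]"] z by (simp add: wlt_def)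
  next
    case False
    thus ?thesis using rw_last[OF squeeze_X[OF x] _ zl] by blast
  qed
qed


text \<open>The list is shown to be sorted, disjoint and covering, rather than built up by
  expansions: by \<open>complete_cp\<close> its words form a complete code, and sorting determines
  the order of the list.\<close>

lemma cp_squeeze:
  assumes P: "cp P" and long: "\<And>w. w \<in> set P \<Longrightarrow> Suc n \<le> length w"
  shows "cp (map (\<lambda>i. lw n @ [i]) [0..<d - 1] @ map (squeezew n) P @ map (\<lambda>i. rw n @ [i]) [1..<d])"
proof -
  define A where "A = map (\<lambda>i. lw n @ [i]) [0..<d - 1]"
  define M where "M = map (squeezew n) P"
  define B where "B = map (\<lambda>i. rw n @ [i]) [1..<d]"
  have exl: "kids (lw n) = A @ [lw n @ [d - 1]]" and exr: "kids (rw n) = (rw n @ [0]) # B"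
    using kids_ends[of "lw n"] kids_ends[of "rw n"] by (simp_all add: A_def B_def)
  have vP: "vw w" if "w \<in> set P" for w using cp_vw[OF P that] .
  have cylM: "cyl (squeezew n w) = squeeze n ` cyl w" if "w \<in> set P" for w
    using squeeze_word(1)[OF vP[OF that] long[OF that]] by (auto simp: cyl_def image_iff)
  have sub: "cyl w \<subseteq> \<Omega>" if "w \<in> set P" for w using cyl_sub_X[OF vP[OF that]] .
  have above: "wlt u (squeezew n w)" if "u \<in> set A" "w \<in> set P" for u w
    using that sub[OF that(2)] squeeze_above unfolding wlt_def cylM[OF that(2)] by (auto simp: A_def)
  have below: "wlt (squeezew n w) u" if u: "u \<in> set B" and w: "w \<in> set P" for u w
  proof -
    obtain i where i: "0 < i" "i < d" "u = rw n @ [i]" using u by (auto simp: B_def)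
    show ?thesis
      using sub[OF w] squeeze_below[OF i(1,2), of _ n] unfolding wlt_def cylM[OF w] i(3) by blast
  qed
  have outer: "wlt u v" if "u \<in> set A" "v \<in> set B" for u v
  proof -
    have u: "u \<in> set (kids (lw n))" and v: "v \<in> set (kids (rw n))" using that exl exr by auto
    have "cyl u \<subseteq> cyl (lw n)" using u un_kids[of "lw n"] unfolding un_def by blast
    moreover have "cyl v \<subseteq> cyl (rw n)" using v un_kids[of "rw n"] unfolding un_def by blast
    moreover have "wlt (lw n) (rw n)"
      unfolding wlt_def using lw_first lw_rw_disjoint cyl_sub_X[OF vw_rw] by blast
    ultimately show ?thesis using wlt_sub by blast
  qed
  have "sorted_wrt wlt M"
    unfolding M_def sorted_wrt_map
  proof (rule sorted_wrt_mono_rel[OF _ cp_sorted[OF P]])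
    fix u v assume uv: "u \<in> set P" "v \<in> set P" "wlt u v"
    show "wlt (squeezew n u) (squeezew n v)"
      using uv(3) sub uv squeeze_less unfolding wlt_def cylM[OF uv(1)] cylM[OF uv(2)] by blast
  qed
  moreover have "sorted_wrt wlt A" "sorted_wrt wlt B"
    unfolding A_def B_def by (auto simp: sorted_wrt_map sorted_wrt_iff_nth_less intro: wlt_first)
  ultimately have srt: "sorted_wrt wlt (A @ M @ B)"
    using above below outer by (auto simp: sorted_wrt_append M_def)
  have vw: "vw w" if "w \<in> set (A @ M @ B)" for w
  proof -
    have "vw w" if "w \<in> set A \<union> set B" for w
      using that by (auto simp: A_def B_def vw_append)
    moreover have "vw w" if "w \<in> set M" for w
      using that squeeze_word(2)[OF vP long] by (auto simp: M_def)
    ultimately show ?thesis using that by auto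
  qed
  have unM: "un M = squeeze n ` \<Omega>"
    unfolding cp_un[OF P, symmetric] by (simp add: un_def M_def image_UN cylM)
  have "un (A @ M @ B) = \<Omega>"
  proof
    show "un (A @ M @ B) \<subseteq> \<Omega>" using vw cyl_sub_X by (auto simp: un_def)
    show "\<Omega> \<subseteq> un (A @ M @ B)"
    proof
      fix x assume x: "x \<in> \<Omega>"
      have l: "cyl (lw n) = un A \<union> cyl (lw n @ [d - 1])" using un_kids[of "lw n"] by (simp add: exl)
      have r: "cyl (rw n) = cyl (rw n @ [0]) \<union> un B" using un_kids[of "rw n"] by (simp add: exr)
      have il: "x \<in> squeeze n ` \<Omega>" if xc: "x \<in> cyl (lw n @ [d - 1])"
      proof -
        obtain y where y: "y \<in> Tl" "x = (lw n @ [d - 1]) \<frown> y" using xc by (rule cylE)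
        hence "x = squeeze n (lw n \<frown> y)" "lw n \<frown> y \<in> \<Omega>" by (auto simp: squeeze_simps cat_append X_cat)
        thus ?thesis by blast
      qed
      have ir: "x \<in> squeeze n ` \<Omega>" if xc: "x \<in> cyl (rw n @ [0])"
      proof -
        obtain y where y: "y \<in> Tl" "x = (rw n @ [0]) \<frown> y" using xc by (rule cylE)
        hence "x = squeeze n (rw n \<frown> y)" "rw n \<frown> y \<in> \<Omega>" by (auto simp: squeeze_simps cat_append X_cat)
        thus ?thesis by blast
      qed
      have "x \<in> squeeze n ` \<Omega>" if "x \<in> inner n"
        using that x squeeze_simps(3)[of x n, symmetric] unfolding inner_def by (intro image_eqI[of _ _ x]) auto
      thus "x \<in> un (A @ M @ B)" using il ir l r x unM unfolding inner_def by auto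
    qed
  qed
  moreover have c: "code (A @ M @ B)" using sorted_wrt_code[OF srt] vw by blast
  ultimately have "\<exists>Q. cp Q \<and> set Q = set (A @ M @ B)"
    by (intro complete_cp) (auto simp: code_def un_def)
  then obtain Q where "cp Q" "set Q = set (A @ M @ B)" by blast
  moreover from this have "Q = A @ M @ B" using sorted_wlt_unique[OF cp_sorted srt] by blast
  ultimately show ?thesis by (simp add: A_def M_def B_def)
qed

lemma inner_in_range: "x \<in> inner n \<Longrightarrow> squeeze n x = x"
  by (simp add: inner_def squeeze_simps(3))

text \<open>Squeeze both codes of a tree pair for \<open>a\<close> and add the same outer leaves on
  both sides, where \<open>b\<close> is then trivial. The words must be longer than \<open>n\<close>
  for \<open>squeeze n\<close> to act on them by \<open>squeezew n\<close>.\<close>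

lemma squeeze_conj:
  assumes "a \<in> FF"
  shows "\<exists>b\<in>FF. (\<forall>x\<in>\<Omega>. ap b (squeeze n x) = squeeze n (ap a x)) \<and> fixes_on (\<Omega> - squeeze n ` \<Omega>) b"
proof -
  obtain P Q where PQ: "cp P" "cp Q" "length P = length Q" "a = tp P Q"
    and long: "\<And>w. w \<in> set P \<union> set Q \<Longrightarrow> n < length w"
    using FF_cases[OF assms, of n] by metis
  define A where "A = map (\<lambda>i. lw n @ [i]) [0..<d - 1]"
  define B where "B = map (\<lambda>i. rw n @ [i]) [1..<d]"
  have c: "cp (A @ map (squeezew n) P @ B)" "cp (A @ map (squeezew n) Q @ B)"
    unfolding A_def B_def using long
    by (auto intro!: cp_squeeze[OF PQ(1), unfolded One_nat_def] cp_squeeze[OF PQ(2), unfolded One_nat_def] Suc_leI)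
  define b where "b = tp (A @ map (squeezew n) P @ B) (A @ map (squeezew n) Q @ B)"
  have len: "length (A @ map (squeezew n) P @ B) = length (A @ map (squeezew n) Q @ B)" using PQ by simp
  have m: "mt (A @ map (squeezew n) P @ B) (A @ map (squeezew n) Q @ B)" using cp_mt[OF c len] .
  have phP: "squeeze n (P ! i \<frown> y) = squeezew n (P ! i) \<frown> y" "squeeze n (Q ! i \<frown> y) = squeezew n (Q ! i) \<frown> y"
    if "i < length P" "y \<in> Tl" for i y
    using that PQ long cp_vw[OF PQ(1)] cp_vw[OF PQ(2)] by (auto intro!: squeeze_word(1) Suc_leI)
  have "ap b (squeeze n x) = squeeze n (ap a x)" if x: "x \<in> \<Omega>" for x
  proof -
    obtain i y where i: "i < length P" "y \<in> Tl" "x = P ! i \<frown> y"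
      using x cp_un[OF PQ(1)] un_nth[of x P] by auto
    have "ap b (squeeze n x) = squeezew n (Q ! i) \<frown> y"
      using tp_at[OF m _ i(2), of "length A + i"] i phP(1)[OF i(1,2)] PQ(3)
      by (simp add: b_def nth_append)
    also have "\<dots> = squeeze n (ap a x)"
      using phP(2)[OF i(1,2)] tp_at[OF cp_mt[OF PQ(1-3)] i(1,2)] i PQ by simp
    finally show ?thesis .
  qed
  moreover have "fixes_on (\<Omega> - squeeze n ` \<Omega>) b" unfolding fixes_on_def
  proof
    fix z assume z: "z \<in> \<Omega> - squeeze n ` \<Omega>"
    then obtain i y where i: "i < length (A @ map (squeezew n) P @ B)" "y \<in> Tl" "z = (A @ map (squeezew n) P @ B) ! i \<frown> y"
      using cp_un[OF c(1)] un_nth[of z "A @ map (squeezew n) P @ B"] by blast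
    have "\<not> (length A \<le> i \<and> i < length A + length P)"
    proof
      assume a: "length A \<le> i \<and> i < length A + length P"
      define j where "j = i - length A"
      have j: "j < length P" "i = length A + j" using a by (auto simp: j_def)
      hence "z = squeeze n (P ! j \<frown> y)" using i phP(1)[OF j(1) i(2)] by (simp add: nth_append)
      moreover have "P ! j \<frown> y \<in> \<Omega>" using j i cp_vw[OF PQ(1)] by (simp add: X_cat)
      ultimately show False using z by blast
    qed
    hence "(A @ map (squeezew n) Q @ B) ! i = (A @ map (squeezew n) P @ B) ! i"
      using PQ(3) by (auto simp: nth_append)
    thus "ap b z = z" using tp_at[OF m i(1,2)] i(3) by (simp add: b_def)
  qed
  moreover have "b \<in> FF" unfolding b_def using c len by (rule tp_FF)
  ultimately show ?thesis by blast
qed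

lemma squeeze_range_sub: "squeeze n ` \<Omega> \<subseteq> inner (Suc n)"
proof
  fix z assume "z \<in> squeeze n ` \<Omega>"
  then obtain x where x: "x \<in> \<Omega>" "z = squeeze n x" by blast
  have "z \<notin> cyl (lw (Suc n))"
    using squeeze_above[of 0 z n x] x d2 unfolding lw_Suc by auto
  moreover have "z \<notin> cyl (rw (Suc n))"
    using squeeze_below[of "d - 1" z n x] x d2 unfolding rw_Suc by auto
  ultimately show "z \<in> inner (Suc n)" using squeeze_X[OF x(1)] x(2) by (simp add: inner_def)
qed

lemma FF_fixes: "p \<in> FF \<Longrightarrow> fixes_on (- \<Omega>) p"
  using FF_VV VV_AA AA_fixes by blast

lemma FF_image: "p \<in> FF \<Longrightarrow> x \<in> \<Omega> \<Longrightarrow> ap p x \<in> \<Omega>"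
  by (rule fixes_on_image[OF FF_fixes])

lemma fixes_off_range:
  "b \<in> FF \<Longrightarrow> fixes_on (\<Omega> - squeeze n ` \<Omega>) b \<Longrightarrow> fixes_on (- (squeeze n ` \<Omega>)) b"
  using FF_fixes[of b] unfolding fixes_on_def by blast

lemma truncate:
  assumes "a \<in> FF"
  obtains b where "b \<in> FF" "\<And>x. x \<in> \<Omega> \<Longrightarrow> ap b (squeeze n x) = squeeze n (ap a x)"
    "fixes_on (- (squeeze n ` \<Omega>)) b" "fixes_on (- inner (Suc n)) b"
proof -
  obtain b where b: "b \<in> FF" "\<forall>x\<in>\<Omega>. ap b (squeeze n x) = squeeze n (ap a x)" "fixes_on (\<Omega> - squeeze n ` \<Omega>) b"
    using squeeze_conj[OF assms] by blast
  moreover have f: "fixes_on (- (squeeze n ` \<Omega>)) b" using fixes_off_range b by blast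
  moreover have "fixes_on (- inner (Suc n)) b"
    using f squeeze_range_sub[of n] by (auto intro: fixes_on_mono)
  ultimately show ?thesis using that by blast
qed

lemma truncate_neg:
  assumes "\<And>x. x \<in> \<Omega> \<Longrightarrow> ap b (squeeze n x) = squeeze n (ap a x)" "a \<in> FF" "x \<in> \<Omega>"
  shows "ap (- b) (squeeze n x) = squeeze n (ap (- a) x)"
  using assms(1)[of "ap (- a) x"] FF_image[of "- a" x] sgp_neg[OF sgp_FF assms(2)] assms(3)
  by (simp add: ap_uminus_eq)

text \<open>The commutator of the truncations \<open>a'\<close> and \<open>b'\<close> corresponds to
  \<open>comm a b\<close> under \<open>squeeze n\<close>. But \<open>comm a b\<close> lives on
  \<open>inner n\<close>, where \<open>squeeze n\<close> is the identity, so the two commutators are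
  equal although their entries differ.\<close>

lemma FF_comm_small:
  assumes a: "a \<in> FF" and b: "b \<in> FF" and c: "fixes_on (- inner n) (comm a b)"
  shows "comm a b \<in> small_comms FF (range inner)"
proof -
  obtain a' where a': "a' \<in> FF" "\<And>x. x \<in> \<Omega> \<Longrightarrow> ap a' (squeeze n x) = squeeze n (ap a x)"
    "fixes_on (- (squeeze n ` \<Omega>)) a'" "fixes_on (- inner (Suc n)) a'" using truncate[OF a] by blast
  obtain b' where b': "b' \<in> FF" "\<And>x. x \<in> \<Omega> \<Longrightarrow> ap b' (squeeze n x) = squeeze n (ap b x)"
    "fixes_on (- (squeeze n ` \<Omega>)) b'" "fixes_on (- inner (Suc n)) b'" using truncate[OF b] by blast
  have na: "- a \<in> FF" and nb: "- b \<in> FF" using a b sgp_neg[OF sgp_FF] by auto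
  have rel: "ap (comm a' b') (squeeze n x) = squeeze n (ap (comm a b) x)" if x: "x \<in> \<Omega>" for x
    using x truncate_neg[OF a'(2) a] truncate_neg[OF b'(2) b] a'(2) b'(2)
      FF_image[OF na] FF_image[OF nb] FF_image[OF a] FF_image[OF b]
    by (simp add: comm_def)
  have "comm a' b' = comm a b"
  proof (rule bp_eqI)
    fix z
    show "ap (comm a' b') z = ap (comm a b) z"
    proof (cases "z \<in> squeeze n ` \<Omega>")
      case True
      then obtain x where x: "x \<in> \<Omega>" "z = squeeze n x" by blast
      show ?thesis
      proof (cases "x \<in> inner n")
        case True
        have "ap (comm a b) x \<in> inner n" using supp_image[OF c True] .
        thus ?thesis using rel[OF x(1)] x(2) True by (simp add: inner_in_range)
      next
        case False
        have "squeeze n x \<notin> inner n"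
          by (rule squeeze_cases[OF x(1), of n]) (use False in \<open>auto simp: inner_def\<close>)
        thus ?thesis using rel[OF x(1)] x(2) False c by (simp add: fixes_on_def)
      qed
    next
      case False
      hence "z \<notin> inner n" using inner_in_range[of z n] unfolding inner_def by (metis DiffD1 image_eqI)
      hence "ap (comm a b) z = z" using c by (simp add: fixes_on_def)
      moreover have "fixes_on (- (squeeze n ` \<Omega>)) (comm a' b')"
        unfolding comm_def diff_conv_add_uminus using a'(3) b'(3) by (intro fixes_on_add) simp_all
      ultimately show ?thesis using False by (simp add: fixes_on_def)
    qed
  qed
  moreover have "comm a' b' \<in> small_comms FF (range inner)"
    unfolding small_comms_def using a'(1,4) b'(1,4) by blast
  ultimately show ?thesis by simp
qed

section \<open>Germs at the end points, and small supports for F'\<close>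

lemma cp_first_last: "cp P \<Longrightarrow> (\<exists>r M. P = lw r # M) \<and> (\<exists>r M. P = M @ [rw r])"
proof (induction rule: cp.induct)
  case base
  show ?case using base_ends(1) base_ends(2) by (intro conjI exI)
next
  case (step A w B)
  obtain r M where r: "A @ [w] @ B = lw r # M" using step by blast
  obtain s M' where s: "A @ [w] @ B = M' @ [rw s]" using step by blast
  have "\<exists>r M. A @ kids w @ B = lw r # M"
  proof (cases A)
    case Nil
    hence "w = lw r" using r by simp
    hence "A @ kids w @ B = lw (Suc r) # map (\<lambda>i. w @ [i]) [1..<d] @ B"
      using Nil kids_ends(1)[of w] by (simp add: lw_Suc)
    thus ?thesis by blast
  qed (use r in auto)
  moreover have "\<exists>r M. A @ kids w @ B = M @ [rw r]"
  proof (cases B rule: rev_cases)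
    case Nil
    hence "w = rw s" using s by simp
    hence "A @ kids w @ B = (A @ map (\<lambda>i. w @ [i]) [0..<d - 1]) @ [rw (Suc s)]"
      using Nil kids_ends(2)[of w] by (simp add: rw_Suc)
    thus ?thesis by blast
  qed (use s in auto)
  ultimately show ?case by blast
qed

text \<open>Germs at an end point are translations of the depth, so they commute.\<close>
lemma germ_comm:
  assumes e: "\<And>p i j. pr p (e i) (e j) \<Longrightarrow> pr p (e (Suc i)) (e (Suc j))"
    and a: "pr a (e r) (e s)" and b: "pr b (e r') (e s')"
  shows "\<exists>m0. \<forall>m\<ge>m0. pr (comm a b) (e m) (e m)"
proof -
  have e': "pr p (e (j + i)) (e (j + i'))" if "pr p (e i) (e i')" for p i i' j
    using that by (induction j) (auto intro: e)
  \<comment> \<open>The germs shift the depth by \<open>s - r\<close> and \<open>s' - r'\<close>.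
    Starting at \<open>r + s + r' + s'\<close>, the ray stays deep enough for all four factors and
    returns to its starting depth.\<close>
  have 1: "pr (- b) (e (r + s + r' + s')) (e (r + s + r' + r'))"
    using e'[OF goodD(6)[OF good_pr b], of "r + s + r'"] by simp
  have 2: "pr (- a) (e (r + s + r' + r')) (e (r + r' + r' + r))"
    using e'[OF goodD(6)[OF good_pr a], of "r + r' + r'"] by (simp add: ac_simps)
  have 3: "pr b (e (r + r' + r' + r)) (e (r + r' + r + s'))"
    using e'[OF b, of "r + r' + r"] by (simp add: ac_simps)
  have 4: "pr a (e (r + r' + r + s')) (e (r + s + r' + s'))"
    using e'[OF a, of "r + r' + s'"] by (simp add: ac_simps)
  have 5: "pr (comm a b) (e (r + s + r' + s')) (e (r + s + r' + s'))"
    using goodD(5)[OF good_pr 1 goodD(5)[OF good_pr 2 goodD(5)[OF good_pr 3 4]]]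
    by (simp add: comm_def grp del: add_uminus_conv_diff)
  have "pr (comm a b) (e m) (e m)" if "m \<ge> r + s + r' + s'" for m
    using e'[OF 5, of "m - (r + s + r' + s')"] that by simp
  thus ?thesis by blast
qed

lemma pr_extend: "pr p w v \<Longrightarrow> tw s \<Longrightarrow> pr p (w @ s) (v @ s)"
  by (simp add: pr_def vw_append cat_append Tl_cat)

lemma FF_germ:
  assumes "p \<in> FF" shows "\<exists>r s. pr p (lw r) (lw s)" "\<exists>r s. pr p (rw r) (rw s)"
proof -
  obtain P Q where PQ: "cp P" "cp Q" "length P = length Q" "p = tp P Q"
    using FF_cases[OF assms] by metis
  note m = cp_mt[OF PQ(1-3)]
  obtain r M where r: "P = lw r # M" using cp_first_last[OF PQ(1)] by blast
  obtain s N where s: "Q = lw s # N" using cp_first_last[OF PQ(2)] by blast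
  show "\<exists>r s. pr p (lw r) (lw s)" using tp_pr[OF m, of 0] r s PQ by auto
  obtain r M where r: "P = M @ [rw r]" using cp_first_last[OF PQ(1)] by blast
  obtain s N where s: "Q = N @ [rw s]" using cp_first_last[OF PQ(2)] by blast
  have "length M = length N" using PQ r s by simp
  thus "\<exists>r s. pr p (rw r) (rw s)" using tp_pr[OF m, of "length M"] r s PQ by (auto simp: nth_append)
qed

lemma FF_comm_fixes_ends:
  assumes a: "a \<in> FF" and b: "b \<in> FF"
  shows "\<exists>n. fixes_on (- inner n) (comm a b)"
proof -
  have el: "pr p (lw (Suc i)) (lw (Suc j))" if "pr p (lw i) (lw j)" for p i j
    using pr_extend[OF that, of "[0]"] d2 by (simp add: lw_Suc)
  have er: "pr p (rw (Suc i)) (rw (Suc j))" if "pr p (rw i) (rw j)" for p i j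
    using pr_extend[OF that, of "[d - 1]"] d2 by (simp add: rw_Suc)
  obtain m where m: "\<forall>n\<ge>m. pr (comm a b) (lw n) (lw n)"
    using FF_germ(1)[OF a] FF_germ(1)[OF b] germ_comm[of lw, OF el] by blast
  obtain m' where m': "\<forall>n\<ge>m'. pr (comm a b) (rw n) (rw n)"
    using FF_germ(2)[OF a] FF_germ(2)[OF b] germ_comm[of rw, OF er] by blast
  define n where "n = m + m'"
  have "pr (comm a b) (lw n) (lw n)" "pr (comm a b) (rw n) (rw n)" using m m' by (auto simp: n_def)
  hence "fixes_on (cyl (lw n) \<union> cyl (rw n)) (comm a b)" by (auto simp: fixes_on_def pr_def cyl_def)
  moreover have "fixes_on (- \<Omega>) (comm a b)" using FF_fixes comm_in_sgp[OF sgp_FF a b] by blast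
  ultimately have "fixes_on (- inner n) (comm a b)" by (auto simp: fixes_on_def inner_def)
  thus ?thesis by blast
qed

lemma der_FF_small: "der FF \<subseteq> gen (small_comms FF (range inner))"
  unfolding der_def
proof (rule gen_le[OF sgp_gen])
  show "{comm a b |a b. a \<in> FF \<and> b \<in> FF} \<subseteq> gen (small_comms FF (range inner))"
    using FF_comm_fixes_ends FF_comm_small gen.incl by blast
qed

section \<open>Mobility of F'\<close>

lemma interior: "vw v \<Longrightarrow> \<exists>u m. vw u \<and> cyl u \<subseteq> cyl v \<and> cyl u \<subseteq> inner m"
proof -
  assume v: "vw v"
  \<comment> \<open>The letter 0 leaves the rightmost ray and the letter 1 the leftmost one.\<close>
  define u where "u = v @ [0, 1]"
  have t: "tw [0, 1]" using d2 by simp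
  have u: "vw u" "cyl u \<subseteq> cyl v" using v t by (auto simp: u_def vw_append cyl_append_sub)
  have nth: "u ! length v = 0" "u ! Suc (length v) = 1" by (simp_all add: u_def nth_append)
  let ?m = "Suc (length v)"
  have lu: "length u = length (lw ?m)" "length u = length (rw ?m)" by (auto simp: u_def)
  have "u \<noteq> lw ?m"
  proof
    assume "u = lw ?m"
    hence "u ! Suc (length v) = replicate (Suc ?m) 0 ! Suc (length v)" by (simp add: lw_def)
    also have "\<dots> = 0" by (simp del: replicate_Suc)
    finally have "u ! Suc (length v) = 0" .
    thus False using nth by simp
  qed
  moreover have "u \<noteq> rw ?m"
  proof
    assume "u = rw ?m"
    moreover have "length v > 0" using vw_length[OF v] .
    ultimately have "u ! length v = d - 1" by (simp add: rw_def nth_Cons')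
    thus False using nth d2 by simp
  qed
  ultimately have "cyl u \<inter> cyl (lw ?m) = {}" "cyl u \<inter> cyl (rw ?m) = {}"
    using cyl_disjoint_same_length u(1) lu vw_lw vw_rw by metis+
  hence "cyl u \<subseteq> inner ?m" using cyl_sub_X[OF u(1)] unfolding inner_def by blast
  thus ?thesis using u by blast
qed

text \<open>Choose \<open>f\<close> in F that does the pushing and truncate it so far out that the
  truncation \<open>f'\<close> still agrees with \<open>f\<close> on \<open>inner n\<close>. In
  \<open>comm f' h\<close> the second factor is a conjugate of the inverse of \<open>f'\<close>,
  which \<open>h\<close> has moved off \<open>inner n\<close>.\<close>

lemma der_FF_push:
  assumes v: "vw v" shows "\<exists>g\<in>der FF. ap g ` inner n \<subseteq> cyl v"
proof -
  obtain u m0 where u: "vw u" "cyl u \<subseteq> cyl v" "cyl u \<subseteq> inner m0" using interior[OF v] by blast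
  define m where "m = m0 + n"
  have um: "cyl u \<subseteq> inner m" and nm: "inner n \<subseteq> inner m" using u inner_mono[of m0 m] inner_mono[of n m] by (auto simp: m_def)
  obtain f where f: "f \<in> FF" "ap f ` inner n \<subseteq> cyl u" using F_push[OF u(1)] by blast
  obtain f' where f': "f' \<in> FF" "\<And>x. x \<in> \<Omega> \<Longrightarrow> ap f' (squeeze m x) = squeeze m (ap f x)" "fixes_on (- inner (Suc m)) f'"
    using truncate[OF f(1)] by blast
  have eq: "ap f' x = ap f x" if x: "x \<in> inner n" for x
  proof -
    have "x \<in> inner m" "ap f x \<in> inner m" using x nm f(2) um by auto
    thus ?thesis using f'(2)[of x] inner_in_range[of x m] inner_in_range[of "ap f x" m] by (auto simp: inner_def)
  qed
  obtain h where h: "h \<in> FF" "ap h ` inner (Suc m) \<subseteq> cyl (lw (Suc m))" using F_push[OF vw_lw] by blast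
  have fx: "fixes_on (- (ap h ` inner (Suc m))) (cj h (- f'))"
    using f'(3) by (intro fixes_on_cj_compl) simp
  have "ap (comm f' h) x = ap f x" if x: "x \<in> inner n" for x
  proof -
    have "x \<in> inner (Suc m)" using x nm inner_mono[of m "Suc m"] by auto
    hence "x \<notin> cyl (lw (Suc m))" by (simp add: inner_def)
    hence "ap (cj h (- f')) x = x" using fx h(2) unfolding fixes_on_def by blast
    moreover have "comm f' h = f' + cj h (- f')" by (simp add: comm_def cj_def grp del: add_uminus_conv_diff)
    ultimately show ?thesis using eq[OF x] by simp
  qed
  hence "ap (comm f' h) ` inner n \<subseteq> cyl v" using f(2) u(2) by auto
  moreover have "comm f' h \<in> der FF" using f' h by (intro comm_in_der)
  ultimately show ?thesis by blast
qed

lemma der_FF_le: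
  assumes L: "sgp L"
    and wc: "\<And>g \<tau>. g \<in> der FF \<Longrightarrow> \<tau> \<in> L \<Longrightarrow> \<exists>n>0. cj g (npow n \<tau>) \<in> L"
    and t: "t \<in> L" "\<And>i. i > 0 \<Longrightarrow> ap (npow i t) ` cyl u \<inter> cyl u = {}" "vw u"
  shows "der FF \<subseteq> L"
proof (rule der_le_commensurated[OF sgp_FF L wc t(1,2) der_FF_small])
  fix W assume "W \<in> range inner"
  then obtain n where W: "W = inner n" by blast
  have t01: "tw [1]" "tw [0]" using d2 by auto
  \<comment> \<open>The places for the two copies of \<open>W\<close>: outside
    \<open>inner n\<close>, but inside \<open>inner (Suc n)\<close>, which one element of F' moves
    into \<open>cyl u\<close>.\<close>
  have vv: "vw (lw n @ [1])" "vw (rw n @ [0])" using t01 by (simp_all add: vw_append)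
  obtain h1 where h1: "h1 \<in> FF" "ap h1 ` inner n \<subseteq> cyl (lw n @ [1])" using F_push[OF vv(1)] by blast
  obtain h2 where h2: "h2 \<in> FF" "ap h2 ` inner n \<subseteq> cyl (rw n @ [0])" using F_push[OF vv(2)] by blast
  obtain g where g: "g \<in> der FF" "ap g ` inner (Suc n) \<subseteq> cyl u" using der_FF_push[OF t(3)] by blast
  have l: "cyl (lw n @ [1]) \<subseteq> cyl (lw n)" and r: "cyl (rw n @ [0]) \<subseteq> cyl (rw n)"
    using t01 by (auto intro!: cyl_append_sub)
  have l': "cyl (lw n @ [1]) \<inter> cyl (lw (Suc n)) = {}"
    unfolding lw_Suc using vv(1) vw_lw[of "Suc n"] by (intro cyl_disjoint_same_length) (auto simp: lw_Suc)
  have r': "cyl (rw n @ [0]) \<inter> cyl (rw (Suc n)) = {}"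
    unfolding rw_Suc using vv(2) vw_rw[of "Suc n"] d2 by (intro cyl_disjoint_same_length) (auto simp: rw_Suc)
  have "cyl (lw n @ [1]) \<subseteq> inner (Suc n)" "cyl (rw n @ [0]) \<subseteq> inner (Suc n)"
    using l l' r r' cyl_lw_Suc[of n] cyl_rw_Suc[of n] lw_rw_disjoint[of n] cyl_sub_X[OF vv(1)] cyl_sub_X[OF vv(2)]
    unfolding inner_def by blast+
  hence sub: "W \<union> ap h1 ` W \<union> ap h2 ` W \<subseteq> inner (Suc n)"
    using h1(2) h2(2) inner_mono[of n "Suc n"] unfolding W by auto
  have "ap h1 ` W \<subseteq> cyl (lw n)" "ap h2 ` W \<subseteq> cyl (rw n)" using h1(2) h2(2) l r W by blast+
  moreover have "W \<inter> cyl (lw n) = {}" "W \<inter> cyl (rw n) = {}" by (auto simp: W inner_def)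
  ultimately have "W \<inter> ap h1 ` W = {}" "W \<inter> ap h2 ` W = {}" "ap h1 ` W \<inter> ap h2 ` W = {}"
    using lw_rw_disjoint[of n] by blast+
  moreover have "ap g ` (W \<union> ap h1 ` W \<union> ap h2 ` W) \<subseteq> cyl u" using g(2) sub by blast
  ultimately show "\<exists>h1\<in>FF. \<exists>h2\<in>FF. \<exists>g\<in>der FF. W \<inter> ap h1 ` W = {} \<and> W \<inter> ap h2 ` W = {}
      \<and> ap h1 ` W \<inter> ap h2 ` W = {} \<and> ap g ` (W \<union> ap h1 ` W \<union> ap h2 ` W) \<subseteq> cyl u"
    using h1(1) h2(1) g(1) by blast
qed

end

section \<open>Generators of F, T and V\<close>

context tree
begin

lemma code_append: "code (A @ B) \<longleftrightarrow> code A \<and> code B \<and> un A \<inter> un B = {}"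
proof (induction A)
  case Nil
  show ?case by (simp add: code_def)
next
  case (Cons w A)
  thus ?case by (auto simp: code_Cons)
qed

lemma un_set_cong: "set P = set Q \<Longrightarrow> un P = un Q"
  by (simp add: un_def)

lemma mt_mset: "code P \<Longrightarrow> mset P = mset Q \<Longrightarrow> mt P Q"
proof -
  assume c: "code P" and m: "mset P = mset Q"
  hence s: "set P = set Q" by (metis set_mset_mset)
  have "distinct Q" using c m mset_eq_imp_distinct_iff by (auto simp: code_def)
  thus "mt P Q" using c s m un_set_cong[OF s] by (auto simp: mt_def code_def dest: mset_eq_length)
qed

lemma pr_fixed: "vw w \<Longrightarrow> fixes_on (cyl w) p \<Longrightarrow> pr p w w"
  by (auto simp: pr_def fixes_on_def cyl_def)

lemma all2_fixed: "\<forall>w\<in>set A. vw w \<Longrightarrow> fixes_on (un A) p \<Longrightarrow> list_all2 (pr p) A A"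
  by (intro list.rel_refl_strong pr_fixed) (auto simp: un_def fixes_on_def)

lemma all2_kids: "pr p u v \<Longrightarrow> list_all2 (pr p) (kids u) (kids v)"
  using pr_extend[of p u v "[_]"] by (auto simp: kids_def list_all2_conv_all_nth)

lemma tp_local:
  assumes c: "code (A @ L @ B)" "code (A @ L' @ B)" and l: "length L = length L'" "un L = un L'"
  shows "tp (A @ L @ B) (A @ L' @ B) = tp L L'" "mt L L'"
proof -
  show m: "mt L L'" using c l by (simp add: mt_def code_append)
  have f: "fixes_on (- un L) (tp L L')" by (rule tp_off[OF m])
  have "un A \<subseteq> - un L" "un B \<subseteq> - un L" using c(1) by (auto simp: code_append)
  hence "fixes_on (un A) (tp L L')" "fixes_on (un B) (tp L L')" using f fixes_on_mono by blast+
  moreover have "\<forall>w\<in>set A. vw w" "\<forall>w\<in>set B. vw w" using c(1) by (auto simp: code_def)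
  ultimately have "list_all2 (pr (tp L L')) (A @ L @ B) (A @ L' @ B)"
    using tp_all2[OF m] by (intro list_all2_appendI all2_fixed)
  moreover have "mt (A @ L @ B) (A @ L' @ B)" using c l by (simp add: mt_def)
  ultimately show "tp (A @ L @ B) (A @ L' @ B) = tp L L'"
    using f by (intro tp_eqI) (auto elim: fixes_on_mono)
qed

lemma tp_kids:
  assumes "mt (A @ [u] @ B) (A' @ [v] @ B')" "length A = length A'"
    and "mt (A @ kids u @ B) (A' @ kids v @ B')"
  shows "tp (A @ [u] @ B) (A' @ [v] @ B') = tp (A @ kids u @ B) (A' @ kids v @ B')"
proof (rule tp_eqI[OF assms(3), symmetric])
  let ?p = "tp (A @ [u] @ B) (A' @ [v] @ B')"
  have "list_all2 (pr ?p) (A @ [u] @ B) (A' @ [v] @ B')" by (rule tp_all2[OF assms(1)])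
  thus "list_all2 (pr ?p) (A @ kids u @ B) (A' @ kids v @ B')"
    using assms(2) by (auto simp: list_all2_append all2_kids dest: list_all2_lengthD)
  show "fixes_on (- un (A @ kids u @ B)) ?p" using tp_off[OF assms(1)] by simp
qed

text \<open>For neighbouring leaves \<open>u, v\<close>, moves a caret from \<open>u\<close> to \<open>v\<close>.\<close>
definition caret :: "nat list \<Rightarrow> nat list \<Rightarrow> (nat \<Rightarrow> nat) bp" where
  "caret u v = tp (kids u @ [v]) ([u] @ kids v)"

text \<open>The leaf demanded by \<open>A @ B \<noteq> []\<close> lets each generator fix a ball and
  makes all generators conjugate in T. It is a restriction only if k = 2, where a code can consist
  of two leaves.\<close>

definition carets :: "(nat \<Rightarrow> nat) bp set" where
  "carets = {caret u v | u v. \<exists>A B. cp (A @ [u, v] @ B) \<and> A @ B \<noteq> []}"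

text \<open>The number of factors is recorded because it is all that survives once the caret moves
  are identified with each other.\<close>

inductive gsum :: "nat \<Rightarrow> (nat \<Rightarrow> nat) bp \<Rightarrow> bool" where
  gsum_0: "gsum 0 0"
| gsum_Suc: "gsum n p \<Longrightarrow> x \<in> carets \<Longrightarrow> gsum (Suc n) (x + p)"

lemma gsum_gen: "gsum n p \<Longrightarrow> p \<in> gen carets"
  by (induction rule: gsum.induct) (auto intro: gen.intros)

definition expand_nth :: "nat list list \<Rightarrow> nat \<Rightarrow> nat list list" where
  "expand_nth R i = take i R @ kids (R ! i) @ drop (Suc i) R"

lemma expand_nth_append [simp]: "expand_nth (A @ w # B) (length A) = A @ kids w @ B"
  by (simp add: expand_nth_def)

lemma cp_expand_nth: "cp R \<Longrightarrow> i < length R \<Longrightarrow> cp (expand_nth R i)"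
  unfolding expand_nth_def by (rule cp.step) (simp add: id_take_nth_drop[symmetric])

lemma length_expand_nth: "i < length R \<Longrightarrow> length (expand_nth R i) = length R + d - 1"
  using d2 by (simp add: expand_nth_def)

lemma caret_tp:
  assumes "cp (A @ [u, v] @ B)"
  shows "tp (A @ kids u @ [v] @ B) (A @ [u] @ kids v @ B) = caret u v" "mt (kids u @ [v]) ([u] @ kids v)"
proof -
  have "cp (A @ kids u @ ([v] @ B))" "cp ((A @ [u]) @ kids v @ B)"
    using cp.step[of A u "[v] @ B"] cp.step[of "A @ [u]" v B] assms by simp_all
  hence "code (A @ (kids u @ [v]) @ B)" "code (A @ ([u] @ kids v) @ B)" by (simp_all add: cp_code)
  from tp_local[OF this] show "tp (A @ kids u @ [v] @ B) (A @ [u] @ kids v @ B) = caret u v"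
    "mt (kids u @ [v]) ([u] @ kids v)" by (simp_all add: caret_def Un_commute)
qed

text \<open>The additional caret travels across one leaf at a time; a third leaf is present as
  \<open>carets\<close> demands.\<close>

lemma move:
  assumes R: "cp R" "3 \<le> length R"
  shows "i + m < length R \<Longrightarrow> gsum m (tp (expand_nth R i) (expand_nth R (i + m)))"
proof (induction m)
  case 0
  thus ?case using tp_id[of "expand_nth R i"] cp_mt[of "expand_nth R i" "expand_nth R i"] cp_expand_nth[OF R(1)] by (simp add: gsum_0)
next
  case (Suc m)
  let ?j = "i + m"
  have c: "cp (expand_nth R i)" "cp (expand_nth R ?j)" "cp (expand_nth R (Suc ?j))"
    using Suc.prems by (auto intro!: cp_expand_nth R)
  have l: "length (expand_nth R i) = length (expand_nth R ?j)" "length (expand_nth R ?j) = length (expand_nth R (Suc ?j))"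
    using Suc.prems by (simp_all add: length_expand_nth)
  define A B u v where "A = take ?j R" and "B = drop (Suc (Suc ?j)) R" and "u = R ! ?j" and "v = R ! Suc ?j"
  have R': "R = A @ [u, v] @ B"
    using Suc.prems by (simp add: A_def B_def u_def v_def Cons_nth_drop_Suc id_take_nth_drop[symmetric])
  have lA: "length A = ?j" using Suc.prems by (simp add: A_def)
  have "expand_nth R ?j = A @ kids u @ [v] @ B" "expand_nth R (Suc ?j) = A @ [u] @ kids v @ B"
    using expand_nth_append[of A u "v # B"] expand_nth_append[of "A @ [u]" v B] R' lA by simp_all
  hence "tp (expand_nth R ?j) (expand_nth R (Suc ?j)) = caret u v"
    using caret_tp(1)[of A u v B] R(1) R' by simp
  moreover have "A @ B \<noteq> []" using R(2) R' by auto
  hence "caret u v \<in> carets" using R(1) R' unfolding carets_def by blast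
  moreover have "tp (expand_nth R i) (expand_nth R (i + Suc m)) = tp (expand_nth R ?j) (expand_nth R (Suc ?j)) + tp (expand_nth R i) (expand_nth R ?j)"
    using tp_comp[OF cp_mt[OF c(1,2) l(1)] cp_mt[OF c(2,3) l(2)]] by simp
  ultimately show ?case using gsum_Suc[OF Suc.IH] Suc.prems by simp
qed

text \<open>Seen in the finer code where \<open>u\<close> has been expanded, \<open>caret u v\<close> moves a caret across
  \<open>d\<close> words. Abelianising, this makes the class of the generators \<open>(d - 1)\<close>-torsion.\<close>
lemma caret_gsum:
  assumes c: "cp (A @ [u, v] @ B)"
  shows "gsum d (caret u v)"
proof -
  define R where "R = A @ kids u @ [v] @ B"
  have R: "cp R" unfolding R_def using cp.step[of A u "[v] @ B"] c by simp
  have l: "3 \<le> length R" using d2 by (simp add: R_def)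
  obtain e where e: "kids u = (u @ [0]) # e" "length e = d - 1" using kids_ends(1)[of u] by simp
  have x1: "expand_nth R (length A) = A @ kids (u @ [0]) @ e @ [v] @ B"
    unfolding R_def e(1) using expand_nth_append[of A "u @ [0]" "e @ [v] @ B"] by simp
  have x2: "expand_nth R (length A + d) = A @ kids u @ kids v @ B"
    unfolding R_def using expand_nth_append[of "A @ kids u" v B] by simp
  have c1: "cp (A @ kids u @ [v] @ B)" "cp (A @ [u] @ kids v @ B)"
    using cp.step[of A u "[v] @ B"] cp.step[of "A @ [u]" v B] c by simp_all
  have c2: "cp (expand_nth R (length A))" "cp (expand_nth R (length A + d))"
    using R by (auto intro!: cp_expand_nth simp: R_def)
  have eq: "A @ kids u @ [v] @ B = A @ [u @ [0]] @ (e @ [v] @ B)" by (simp add: e(1))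
  have l1: "length (A @ kids u @ [v] @ B) = length (A @ [u] @ kids v @ B)" by simp
  have l2: "length (expand_nth R (length A)) = length (expand_nth R (length A + d))" by (simp add: length_expand_nth R_def)
  have m1: "mt (A @ [u @ [0]] @ (e @ [v] @ B)) (A @ [u] @ (kids v @ B))"
    using cp_mt[OF c1 l1] unfolding eq .
  have m2: "mt (A @ kids (u @ [0]) @ (e @ [v] @ B)) (A @ kids u @ (kids v @ B))"
    using cp_mt[OF c2 l2] unfolding x1 x2 .
  have "caret u v = tp (A @ [u @ [0]] @ (e @ [v] @ B)) (A @ [u] @ (kids v @ B))"
    using caret_tp(1)[OF c] unfolding eq by (rule sym)
  also have "\<dots> = tp (expand_nth R (length A)) (expand_nth R (length A + d))"
    unfolding x1 x2 by (rule tp_kids[OF m1 refl m2])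
  finally show ?thesis using move[OF R l, of "length A" d] by (simp add: R_def)
qed

lemma cp_min_length: "cp P \<Longrightarrow> k \<le> length P"
  using cp_length by fastforce

text \<open>Remove the last caret on both sides, at positions \<open>i\<close> of \<open>P0\<close>
  and \<open>j\<close> of \<open>Q0\<close>. The element for the smaller codes also maps
  \<open>P\<close> to the expansion of \<open>Q0\<close> at position \<open>i\<close>; there remains
  the move of this caret from \<open>i\<close> to \<open>j\<close>.\<close>

lemma tp_gen_carets: "cp P \<Longrightarrow> cp Q \<Longrightarrow> length P = length Q \<Longrightarrow> tp P Q \<in> gen carets"
proof (induction "length P" arbitrary: P Q rule: less_induct)
  case less
  have long: "k < length (A @ kids w @ B)" if "cp (A @ [w] @ B)" for A w B
    using cp_min_length[OF that] d2 by simp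
  from less.prems(1) show ?case
  proof cases
    case base
    hence "length Q = k" using less.prems by simp
    with less.prems(2) have "Q = map (\<lambda>i. [i]) [0..<k]"
    proof cases
      case (step A w B)
      thus ?thesis using long[of A w B] \<open>length Q = k\<close> by simp
    qed simp
    thus ?thesis using base tp_id[OF cp_mt[OF less.prems(1) less.prems(1)]] by (simp add: gen.zero)
  next
    case (step A w B)
    note P = step
    hence lQ: "k < length Q" using long less.prems by metis
    from less.prems(2) show ?thesis
    proof cases
      case base
      thus ?thesis using lQ by simp
    next
      case (step C z D)
      note Q = step
      define P0 Q0 i j where "P0 = A @ [w] @ B" and "Q0 = C @ [z] @ D" and "i = length A" and "j = length C"
      have len0: "length P0 = length Q0" using less.prems(3) P Q by (simp add: P0_def Q0_def)
      have c0: "cp P0" "cp Q0" using P Q by (simp_all add: P0_def Q0_def)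
      have e: "expand_nth P0 i = P" "expand_nth Q0 j = Q" using P Q by (simp_all add: P0_def Q0_def i_def j_def)
      have ij: "i < length P0" "i < length Q0" "j < length Q0" using len0 by (simp_all add: P0_def Q0_def i_def j_def)
      have "length P0 < length P" using P d2 by (simp add: P0_def)
      hence IH: "tp P0 Q0 \<in> gen carets" using less.hyps c0 len0 by blast
      have ci: "cp (expand_nth Q0 i)" "length (expand_nth Q0 i) = length P" "length (expand_nth Q0 i) = length Q"
        using c0 ij e length_expand_nth less.prems(3) by (auto intro: cp_expand_nth)
      define A' z' B' where "A' = take i Q0" and "z' = Q0 ! i" and "B' = drop (Suc i) Q0"
      have Q0': "Q0 = A' @ [z'] @ B'" "length A' = i"
        using ij by (simp_all add: A'_def z'_def B'_def id_take_nth_drop[symmetric])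
      have eQ: "expand_nth Q0 i = A' @ kids z' @ B'" by (simp add: expand_nth_def A'_def z'_def B'_def)
      have "tp P0 Q0 = tp P (expand_nth Q0 i)"
        unfolding eQ using tp_kids[of A w B A' z' B'] cp_mt[OF c0 len0] cp_mt[OF less.prems(1) ci(1)] ci(2) P Q0' eQ
        by (simp add: P0_def i_def)
      hence 1: "tp P (expand_nth Q0 i) \<in> gen carets" using IH by simp
      have mv: "tp (expand_nth Q0 a) (expand_nth Q0 b) \<in> gen carets" if "a \<le> b" "b < length Q0" for a b
      proof (cases "3 \<le> length Q0")
        case True
        thus ?thesis using move[OF c0(2), of a "b - a"] that gsum_gen by simp
      next
        \<comment> \<open>A code with two leaves has no third one, so this caret move is not taken
          from \<open>carets\<close> directly; \<open>caret_gsum\<close> writes it as a product of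
          \<open>d\<close> members in a finer code.\<close>
        case False
        hence "length Q0 = 2" using cp_min_length[OF c0(2)] k2 by linarith
        then obtain u v where uv: "Q0 = [u, v]" by (auto simp: length_Suc_conv numeral_2_eq_2)
        have "tp (expand_nth Q0 0) (expand_nth Q0 1) = caret u v" "gsum d (caret u v)"
          using caret_tp(1)[of "[]" u v "[]"] caret_gsum[of "[]" u v "[]"] c0(2) uv by (simp_all add: expand_nth_def)
        moreover have "tp (expand_nth Q0 a) (expand_nth Q0 a) = 0" if "a < length Q0" for a
          using cp_expand_nth[OF c0(2) that] by (intro tp_id cp_mt) auto
        moreover have "a = b \<or> (a = 0 \<and> b = 1)" using that uv by auto
        ultimately show ?thesis using that gsum_gen gen.zero by auto
      qed
      have "tp (expand_nth Q0 i) (expand_nth Q0 j) \<in> gen carets"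
      proof (cases "i \<le> j")
        case True
        thus ?thesis using mv ij by blast
      next
        case False
        hence "tp (expand_nth Q0 j) (expand_nth Q0 i) \<in> gen carets" using mv ij by simp
        moreover have "mt (expand_nth Q0 j) (expand_nth Q0 i)"
          using cp_expand_nth[OF c0(2)] ij by (intro cp_mt) (auto simp: length_expand_nth)
        ultimately show ?thesis using tp_neg gen.neg by metis
      qed
      hence "tp (expand_nth Q0 i) Q \<in> gen carets" using e by simp
      moreover have "tp P Q = tp (expand_nth Q0 i) Q + tp P (expand_nth Q0 i)"
        using cp_mt[OF less.prems(1) ci(1)] cp_mt[OF ci(1) less.prems(2)] ci by (simp add: tp_comp)
      ultimately show ?thesis using 1 gen.add by metis
    qed
  qed
qed

lemma FF_gen: "FF \<subseteq> gen carets"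
  using FF_cases tp_gen_carets by (metis subsetI)

lemma carets_FF: "carets \<subseteq> FF"
proof
  fix x assume "x \<in> carets"
  then obtain u v A B where x: "x = caret u v" "cp (A @ [u, v] @ B)" by (auto simp: carets_def)
  have "cp (A @ kids u @ [v] @ B)" "cp (A @ [u] @ kids v @ B)"
    using cp.step[of A u "[v] @ B"] cp.step[of "A @ [u]" v B] x(2) by simp_all
  thus "x \<in> FF" using tp_FF caret_tp(1)[OF x(2)] x(1) by fastforce
qed

section \<open>Swaps of neighbouring balls, and generators of V\<close>

definition swap :: "nat list \<Rightarrow> nat list \<Rightarrow> (nat \<Rightarrow> nat) bp" where
  "swap u v = tp [u, v] [v, u]"

definition swaps :: "(nat \<Rightarrow> nat) bp set" where
  "swaps = {swap u v | u v. \<exists>A B. cp (A @ [u, v] @ B) \<and> A @ B \<noteq> []}"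

inductive adj_swaps :: "'b list \<Rightarrow> 'b list \<Rightarrow> bool" for P where
  adj_refl: "adj_swaps P P"
| adj_step: "adj_swaps P (C @ [a, b] @ D) \<Longrightarrow> adj_swaps P (C @ [b, a] @ D)"

lemma adj_swaps_trans: "adj_swaps Q R \<Longrightarrow> adj_swaps P Q \<Longrightarrow> adj_swaps P R"
proof (induction rule: adj_swaps.induct)
  case (adj_step C a b D)
  show ?case by (rule adj_swaps.adj_step) (rule adj_step.IH[OF adj_step.prems])
qed

lemma adj_swaps_Cons: "adj_swaps P Q \<Longrightarrow> adj_swaps (x # P) (x # Q)"
proof (induction rule: adj_swaps.induct)
  case (adj_step C a b D)
  thus ?case using adj_swaps.adj_step[of "x # P" "x # C" a b D] by simp
qed (rule adj_refl)

lemma adj_swaps_move: "adj_swaps (x # C @ D) (C @ x # D)"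
proof (induction C)
  case (Cons c C)
  have "adj_swaps (x # c # C @ D) (c # x # C @ D)"
    using adj_step[of "x # c # C @ D" "[]" x c "C @ D"] adj_refl by auto
  thus ?case using adj_swaps_trans adj_swaps_Cons[OF Cons, of c] by fastforce
qed (simp add: adj_refl)

lemma adj_swaps_mset: "mset P = mset Q \<Longrightarrow> adj_swaps P Q"
proof (induction P arbitrary: Q)
  case (Cons x P)
  hence "x \<in> set Q" by (metis list.set_intros(1) mset_eq_setD)
  then obtain C D where Q: "Q = C @ x # D" by (metis split_list)
  hence "adj_swaps P (C @ D)" using Cons by simp
  hence "adj_swaps (x # P) (x # C @ D)" by (rule adj_swaps_Cons)
  thus ?case unfolding Q by (rule adj_swaps_trans[OF adj_swaps_move])
qed (simp add: adj_refl)

lemma adj_swaps_mset': "adj_swaps P Q \<Longrightarrow> mset Q = mset P"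
  by (induction rule: adj_swaps.induct) (auto simp: add_mset_commute)

text \<open>Bubble sort. Exchanging two neighbouring entries of the target list amounts to first
  applying the swap of the leaves of \<open>P\<close> in these positions. Those leaves are
  neighbours in the tree, even where the entries of the target are not.\<close>

lemma tp_gen_swaps:
  assumes P: "cp P" "3 \<le> length P" and "mset Q = mset P"
  shows "tp P Q \<in> gen swaps"
proof -
  have "adj_swaps P Q" using adj_swaps_mset assms(3) by metis
  thus ?thesis
  proof (induction rule: adj_swaps.induct)
    case adj_refl
    show ?case using tp_id[OF cp_mt[OF P(1) P(1)]] gen.zero by simp
  next
    case (adj_step C a b D)
    let ?Q = "C @ [a, b] @ D" and ?Q' = "C @ [b, a] @ D"
    have ms: "mset ?Q = mset P" using adj_swaps_mset'[OF adj_step.hyps] .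
    hence len: "length P = length ?Q" by (metis mset_eq_length)
    define A B u v where "A = take (length C) P" and "B = drop (Suc (Suc (length C))) P"
      and "u = P ! length C" and "v = P ! Suc (length C)"
    have P': "P = A @ [u, v] @ B"
      using len by (simp add: A_def B_def u_def v_def Cons_nth_drop_Suc id_take_nth_drop[symmetric])
    have lA: "length A = length C" "length B = length D" using len by (simp_all add: A_def B_def)
    have cP: "code (A @ [u, v] @ B)" using cp_code P(1) P' by simp
    let ?P' = "A @ [v, u] @ B"
    have mP': "mt P ?P'" using mt_mset cp_code[OF P(1)] P' by simp
    hence cP': "code ?P'" by (simp add: mt_def)
    have s: "tp P ?P' = swap u v" unfolding P' swap_def by (rule tp_local(1)[OF cP cP']) auto
    have "A @ B \<noteq> []" using P(2) P' by auto
    hence sG: "swap u v \<in> swaps" using P(1) P' unfolding swaps_def by blast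
    have mQ: "mt P ?Q" using mt_mset[OF cp_code[OF P(1)]] ms by simp
    have mQ': "mt P ?Q'" using mt_mset[OF cp_code[OF P(1)], of ?Q'] ms by (simp add: add_mset_commute)
    have m2: "mt ?P' ?Q'" using mt_trans[OF mt_sym[OF mP'] mQ'] .
    have "list_all2 (pr (tp P ?Q)) P ?Q" by (rule tp_all2[OF mQ])
    hence "list_all2 (pr (tp P ?Q)) ?P' ?Q'" unfolding P' using lA by (auto simp: list_all2_append)
    hence "tp ?P' ?Q' = tp P ?Q"
      using tp_off[OF mQ] mP' by (intro tp_eqI[OF m2]) (auto simp: mt_def)
    hence "tp P ?Q' = tp P ?Q + swap u v" using tp_comp[OF mP' m2] s by simp
    thus ?case using adj_step.IH sG gen.intros by metis
  qed
qed

text \<open>Long words exclude the initial code, and any other code has at least k + d - 1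
  leaves.\<close>

lemma cp_long: "cp P \<Longrightarrow> (\<And>w. w \<in> set P \<Longrightarrow> 1 < length w) \<Longrightarrow> 3 \<le> length P"
proof (induction rule: cp.cases)
  case base
  have "[0] \<in> set P" using base(1) k2 by auto
  thus ?case using base(2) by fastforce
next
  case (step A w B)
  thus ?case using cp_min_length[of "A @ [w] @ B"] k2 d2 by auto
qed

text \<open>First match \<open>P\<close> with the sorted code \<open>Q'\<close> inside F, then
  permute the leaves of \<open>Q'\<close>.\<close>

lemma VV_gen: "VV \<subseteq> gen (carets \<union> swaps)"
proof
  fix p assume "p \<in> VV"
  then obtain P Q Q' where PQ: "cp P" "cp Q'" "mset Q = mset Q'" "mt P Q" "p = tp P Q"
    "\<And>w. w \<in> set P \<union> set Q \<Longrightarrow> 1 < length w" using VV_cases[of p 1] by metis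
  have "3 \<le> length Q'"
    using cp_long[OF PQ(2)] PQ(3,6) by (metis UnCI mset_eq_setD)
  hence 1: "tp Q' Q \<in> gen swaps" using tp_gen_swaps PQ by blast
  have l: "length P = length Q'" using PQ by (metis mset_eq_length mt_length)
  hence 2: "tp P Q' \<in> gen carets" using tp_gen_carets PQ by blast
  have "p = tp Q' Q + tp P Q'"
    using tp_comp[OF cp_mt[OF PQ(1,2) l]] mt_mset[OF cp_code[OF PQ(2)]] PQ by simp
  moreover have "gen swaps \<subseteq> gen (carets \<union> swaps)" "gen carets \<subseteq> gen (carets \<union> swaps)"
    by (intro gen_le[OF sgp_gen]; auto intro: gen.incl)+
  ultimately show "p \<in> gen (carets \<union> swaps)" using 1 2 by (metis gen.add subsetD)
qed

end

section \<open>The group T\<close>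

lemma cyc_ordered_rotate: "cyc_ordered a b c \<longleftrightarrow> cyc_ordered b c a"
  by (auto simp: cyc_ordered_def)

lemma mset_rotate1 [simp]: "mset (rotate1 xs) = mset xs"
  by (cases xs) auto

context tree
begin

lemma cyc_presI:
  assumes "\<And>a b c. a \<in> \<Omega> \<Longrightarrow> b \<in> \<Omega> \<Longrightarrow> c \<in> \<Omega> \<Longrightarrow> lex_less a b \<Longrightarrow> lex_less b c \<Longrightarrow>
    cyc_ordered (ap p a) (ap p b) (ap p c)"
  shows "cyc_pres p"
  unfolding cyc_pres_def
proof (intro ballI impI)
  fix a b c assume a: "a \<in> \<Omega>" "b \<in> \<Omega>" "c \<in> \<Omega>" and "cyc_ordered a b c"
  then consider "lex_less a b" "lex_less b c" | "lex_less b c" "lex_less c a" | "lex_less c a" "lex_less a b"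
    by (auto simp: cyc_ordered_def)
  thus "cyc_ordered (ap p a) (ap p b) (ap p c)"
    by cases (use a assms cyc_ordered_rotate in blast)+
qed

lemma all2_image: "list_all2 (pr p) L L' \<Longrightarrow> x \<in> un L \<Longrightarrow> ap p x \<in> un L'"
proof (induction rule: list_all2_induct)
  case (Cons u L v L')
  thus ?case using pr_image by fastforce
qed simp

lemma un_less:
  "sorted_wrt wlt (A @ B) \<Longrightarrow> x \<in> un A \<Longrightarrow> y \<in> un B \<Longrightarrow> lex_less x y"
  unfolding un_def sorted_wrt_append wlt_def by blast

lemma mt_rotated:
  assumes "cp (A @ B)" "cp (A' @ B')" "length A + length B = length A' + length B'"
  shows "mt (A @ B) (B' @ A')"
  using assms mt_trans[OF cp_mt[OF assms(1,2)] mt_mset[OF cp_code[OF assms(2)]]] by simp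

text \<open>The map is increasing on each of two blocks and exchanges the blocks. Three increasing
  points can be spread over the blocks in four ways, and each preserves the cyclic order.\<close>

lemma tp_cyclic_TT:
  assumes c: "cp (A @ B)" "cp (A' @ B')" and l: "length A = length B'" "length B = length A'"
  shows "tp (A @ B) (B' @ A') \<in> TT"
proof -
  let ?g = "tp (A @ B) (B' @ A')"
  have m: "mt (A @ B) (B' @ A')" using c l by (intro mt_rotated) auto
  have "list_all2 (pr ?g) (A @ B) (B' @ A')" by (rule tp_all2[OF m])
  hence a: "list_all2 (pr ?g) A B'" "list_all2 (pr ?g) B A'" using l by (simp_all add: list_all2_append)
  have s: "sorted_wrt wlt (A @ B)" "sorted_wrt wlt (A' @ B')" using c cp_sorted by auto
  hence sA: "sorted_wrt wlt A" "sorted_wrt wlt B" "sorted_wrt wlt A'" "sorted_wrt wlt B'"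
    by (simp_all add: sorted_wrt_append)
  note oA = all2_order[OF a(1) sA(1,4)] and oB = all2_order[OF a(2) sA(2,3)]
  have oBA: "lex_less (ap ?g y) (ap ?g x)" if "x \<in> un A" "y \<in> un B" for x y
    using un_less[OF s(2)] all2_image[OF a(1)] all2_image[OF a(2)] that by blast
  have AB: "\<Omega> = un A \<union> un B" using cp_un[OF c(1)] by simp
  have BA: "\<not> (x \<in> un B \<and> y \<in> un A \<and> lex_less x y)" for x y
    using un_less[OF s(1)] lex_less_asym by blast
  have "cyc_pres ?g"
  proof (rule cyc_presI)
    fix x y z assume xyz: "x \<in> \<Omega>" "y \<in> \<Omega>" "z \<in> \<Omega>" "lex_less x y" "lex_less y z"
    hence "x \<in> un A \<and> y \<in> un A \<and> z \<in> un A \<or> x \<in> un A \<and> y \<in> un A \<and> z \<in> un B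
      \<or> x \<in> un A \<and> y \<in> un B \<and> z \<in> un B \<or> x \<in> un B \<and> y \<in> un B \<and> z \<in> un B"
      using AB BA by blast
    thus "cyc_ordered (ap ?g x) (ap ?g y) (ap ?g z)"
      using oA oB oBA xyz(4,5) unfolding cyc_ordered_def by metis
  qed
  thus ?thesis using tp_VV[OF m] by (simp add: TT_def)
qed

lemma tp_rotate_TT:
  assumes c: "cp (A @ B)" shows "tp (A @ B) (B @ A) \<in> TT"
proof -
  \<comment> \<open>The target begins with the block \<open>B\<close>, so the source is recut after
    \<open>length B\<close> leaves.\<close>
  let ?A = "take (length B) (A @ B)" and ?B = "drop (length B) (A @ B)"
  have "tp (?A @ ?B) (B @ A) \<in> TT"
    using c by (intro tp_cyclic_TT) (simp_all only: append_take_drop_id, simp_all)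
  thus ?thesis by (simp only: append_take_drop_id)
qed

lemma tp_rotated_TT:
  assumes c: "cp (A @ B)" "cp (A' @ B')" and l: "length A + length B = length A' + length B'"
  shows "tp (B @ A) (B' @ A') \<in> TT" "mt (B @ A) (B' @ A')"
proof -
  have m: "mt (A @ B) (B @ A)" "mt (A @ B) (A' @ B')" "mt (A' @ B') (B' @ A')"
    using c l by (auto intro: mt_rotated cp_mt)
  show m': "mt (B @ A) (B' @ A')" using m mt_sym mt_trans by blast
  have "tp (B @ A) (B' @ A') = tp (A' @ B') (B' @ A') + (tp (A @ B) (A' @ B') + - tp (A @ B) (B @ A))"
    using tp_comp[OF mt_sym[OF m(1)] m(2)] tp_comp[OF mt_trans[OF mt_sym[OF m(1)] m(2)] m(3)] tp_neg[OF m(1)]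
    by simp
  moreover have "tp (A @ B) (A' @ B') \<in> TT" using tp_FF[OF c] l FF_TT by auto
  ultimately show "tp (B @ A) (B' @ A') \<in> TT"
    using tp_rotate_TT[OF c(1)] tp_rotate_TT[OF c(2)] sgp_TT by (simp add: sgp_add sgp_diff)
qed

text \<open>Start reading the source code right behind \<open>w\<close> and the target code at the
  leaves \<open>E'\<close> below \<open>u\<close>. If \<open>E'\<close> is long enough, all leaves
  \<open>B @ A\<close> outside \<open>w\<close> are sent to leaves below \<open>u\<close>. The
  counts \<open>b + ?n\<close> and \<open>a + ?n\<close> achieve this and equalise the
  sizes.\<close>

lemma T_push:
  assumes w: "vw w" and u: "vw u"
  shows "\<exists>g\<in>TT. ap g ` (\<Omega> - cyl w) \<subseteq> cyl u"
proof -
  obtain A B where P: "cp (A @ [w] @ B)" using cp_contains w by blast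
  obtain A' B' where Q: "cp (A' @ [u] @ B')" using cp_contains u by blast
  obtain a where a: "length (A @ [w] @ B) = k + a * (d - 1)" using cp_length[OF P] by blast
  obtain b where b: "length (A' @ [u] @ B') = k + b * (d - 1)" using cp_length[OF Q] by blast
  let ?n = "length A + length B"
  obtain E where E: "length E = Suc ((b + ?n) * (d - 1))" "\<forall>e\<in>set E. \<exists>s. tw s \<and> e = w @ s" "cp (A @ E @ B)"
    using cp_expand[OF P, of "b + ?n"] by blast
  obtain E' where E': "length E' = Suc ((a + ?n) * (d - 1))" "\<forall>e\<in>set E'. \<exists>s. tw s \<and> e = u @ s" "cp (A' @ E' @ B')"
    using cp_expand[OF Q, of "a + ?n"] by blast
  have "length (A @ E) + length B = length A' + length (E' @ B')"
    using a b E(1) E'(1) by (simp add: algebra_simps)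
  note r = tp_rotated_TT[of "A @ E" B A' "E' @ B'", OF _ _ this]
  define g where "g = tp (B @ A @ E) ((E' @ B') @ A')"
  have g: "g \<in> TT" and m: "mt (B @ A @ E) ((E' @ B') @ A')"
    using r E(3) E'(3) by (simp_all add: g_def)
  have "?n \<le> ?n * (d - 1)" using d2 by (cases "d - 1") auto
  also have "\<dots> \<le> length E'" unfolding E'(1) by (simp add: algebra_simps)
  finally have le: "?n \<le> length E'" .
  have "list_all2 (pr g) ((B @ A) @ E) (take ?n E' @ drop ?n E' @ B' @ A')"
    using tp_all2[OF m] by (simp add: g_def flip: append_assoc)
  hence "list_all2 (pr g) (B @ A) (take ?n E')"
    using le by (subst (asm) list_all2_append) auto
  hence im: "ap g x \<in> un (take ?n E')" if "x \<in> un (B @ A)" for x using that all2_image by blast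
  have "cyl e \<subseteq> cyl u" if e: "e \<in> set (take ?n E')" for e
  proof -
    obtain s where "tw s" "e = u @ s" using E'(2) in_set_takeD[OF e] by blast
    thus ?thesis using cyl_append_sub by simp
  qed
  hence "un (take ?n E') \<subseteq> cyl u" unfolding un_def by blast
  moreover have "\<Omega> - cyl w \<subseteq> un (B @ A)" using cp_un[OF P] by auto
  ultimately show ?thesis using im g by blast
qed

lemma expand_rest:
  assumes c: "cp (A @ L @ B)" and ne: "A @ B \<noteq> []"
  shows "\<exists>A' B'. cp (A' @ L @ B') \<and> length A' + length B' = length A + length B + j * (d - 1)"
proof (cases A)
  case (Cons w C)
  have "cp ([] @ [w] @ (C @ L @ B))" using c Cons by simp
  from cp_expand[OF this, of j] obtain E where "length E = Suc (j * (d - 1))" "cp ((E @ C) @ L @ B)" by auto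
  thus ?thesis using Cons by (intro exI[of _ "E @ C"] exI[of _ B]) auto
next
  case Nil
  then obtain w C where B: "B = w # C" using ne by (cases B) auto
  have "cp ((A @ L) @ [w] @ C)" using c B by simp
  from cp_expand[OF this, of j] obtain E where "length E = Suc (j * (d - 1))" "cp (A @ L @ (E @ C))" by auto
  thus ?thesis using B by (intro exI[of _ A] exI[of _ "E @ C"]) auto
qed

text \<open>Equalise the sizes by expanding leaves outside \<open>L\<close> and \<open>L'\<close>,
  then start reading both codes at these blocks.\<close>

lemma T_transitive:
  assumes c: "cp (A @ L @ B)" "A @ B \<noteq> []" and c': "cp (A' @ L' @ B')" "A' @ B' \<noteq> []"
    and l: "length L = length L'"
  shows "\<exists>g\<in>TT. list_all2 (pr g) L L'"
proof -
  obtain a where a: "length (A @ L @ B) = k + a * (d - 1)" using cp_length[OF c(1)] by blast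
  obtain b where b: "length (A' @ L' @ B') = k + b * (d - 1)" using cp_length[OF c'(1)] by blast
  obtain A2 B2 where 2: "cp (A2 @ L @ B2)" "length A2 + length B2 = length A + length B + b * (d - 1)"
    using expand_rest[OF c] by blast
  obtain A3 B3 where 3: "cp (A3 @ L' @ B3)" "length A3 + length B3 = length A' + length B' + a * (d - 1)"
    using expand_rest[OF c'] by blast
  have "length A2 + length (L @ B2) = length A3 + length (L' @ B3)"
    using a b 2(2) 3(2) l by simp
  note r = tp_rotated_TT[OF 2(1) 3(1) this]
  have "list_all2 (pr (tp ((L @ B2) @ A2) ((L' @ B3) @ A3))) (L @ (B2 @ A2)) (L' @ (B3 @ A3))"
    using tp_all2[OF r(2)] by simp
  hence "list_all2 (pr (tp ((L @ B2) @ A2) ((L' @ B3) @ A3))) L L'"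
    using l by (simp add: list_all2_append)
  thus ?thesis using r(1) by blast
qed

lemma T_transitive_word:
  assumes "vw w" "vw v" shows "\<exists>g\<in>TT. pr g w v"
proof -
  obtain A B where P: "cp (A @ [w] @ B)" using cp_contains assms(1) by blast
  obtain A' B' where Q: "cp (A' @ [v] @ B')" using cp_contains assms(2) by blast
  have "A @ B \<noteq> []" "A' @ B' \<noteq> []" using cp_min_length[OF P] cp_min_length[OF Q] k2 by auto
  from T_transitive[OF P this(1) Q this(2)] show ?thesis by auto
qed

lemma cj_tp_all2:
  assumes m: "mt P Q" "mt P' Q'" and a: "list_all2 (pr g) P P'" "list_all2 (pr g) Q Q'"
  shows "cj g (tp P Q) = tp P' Q'"
  using m a by (intro cj_tp) (auto simp: list_all2_conv_all_nth mt_length)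

lemma carets_conj:
  assumes "x \<in> carets" "y \<in> carets" shows "\<exists>g\<in>TT. cj g x = y"
proof -
  obtain u v A B where x: "x = caret u v" "cp (A @ [u, v] @ B)" "A @ B \<noteq> []" using assms(1) by (auto simp: carets_def)
  obtain u' v' A' B' where y: "y = caret u' v'" "cp (A' @ [u', v'] @ B')" "A' @ B' \<noteq> []"
    using assms(2) by (auto simp: carets_def)
  obtain g where g: "g \<in> TT" "list_all2 (pr g) [u, v] [u', v']"
    using T_transitive[OF x(2,3) y(2,3)] by auto
  hence p: "pr g u u'" "pr g v v'" by auto
  have "cj g x = y" unfolding x(1) y(1) caret_def
    using caret_tp(2)[OF x(2)] caret_tp(2)[OF y(2)] p by (intro cj_tp_all2) (auto intro!: list_all2_appendI all2_kids)
  thus ?thesis using g by blast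
qed

section \<open>Rotations of the leaves, and T modulo a normal subgroup\<close>

definition rot :: "nat list list \<Rightarrow> (nat \<Rightarrow> nat) bp" where
  "rot P = tp P (rotate1 P)"

lemma mt_rotate: "cp P \<Longrightarrow> mt P (rotate j P)"
  by (rule mt_mset[OF cp_code], assumption) (induction j, simp_all)

lemma rot_TT: "cp P \<Longrightarrow> rot P \<in> TT"
  using tp_rotate_TT[of "[hd P]" "tl P"] by (cases P) (auto simp: rot_def tp_id mt_def code_def sgp_0[OF sgp_TT])

lemma tp_rotate1: "mt P Q \<Longrightarrow> tp (rotate1 P) (rotate1 Q) = tp P Q"
proof -
  assume m: "mt P Q"
  have r: "mt (rotate1 P) P" "mt Q (rotate1 Q)"
    using m mt_mset[of Q "rotate1 Q"] mt_sym[OF mt_mset[of P "rotate1 P"]] by (auto simp: mt_def)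
  have "list_all2 (pr (tp P Q)) P Q" by (rule tp_all2[OF m])
  hence "list_all2 (pr (tp P Q)) (rotate1 P) (rotate1 Q)"
    by (cases P; cases Q) (auto intro: list_all2_appendI)
  thus ?thesis using tp_off[OF m] r by (intro tp_eqI[OF mt_trans[OF r(1) mt_trans[OF m r(2)]]]) (auto simp: mt_def)
qed

lemma npow_rot: "cp P \<Longrightarrow> npow j (rot P) = tp P (rotate j P)"
proof (induction j)
  case 0
  thus ?case using tp_id cp_mt by simp
next
  case (Suc j)
  have "npow j (rot P) = tp (rotate1 P) (rotate1 (rotate j P))"
    using Suc tp_rotate1[OF mt_rotate[OF Suc.prems]] by simp
  moreover have m1: "mt P (rotate1 P)" using mt_rotate[OF Suc.prems, of 1] by simp
  moreover have "mt P (rotate1 (rotate j P))" using mt_rotate[OF Suc.prems, of "Suc j"] by simp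
  hence "mt (rotate1 P) (rotate1 (rotate j P))" by (rule mt_trans[OF mt_sym[OF m1]])
  ultimately show ?case using tp_comp[of P "rotate1 P" "rotate1 (rotate j P)"] by (simp add: rot_def)
qed

lemma npow_rot_length: "cp P \<Longrightarrow> npow (length P) (rot P) = 0"
  using npow_rot[of P "length P"] tp_id[OF cp_mt[of P P]] by simp

text \<open>The leftmost ray is a fixed point, and a cyclic order cut open at its least point is the
  total order.\<close>

lemma TT_fixes_least:
  assumes p: "p \<in> TT" and "pr p (lw r) (lw s)"
  shows "p \<in> FF"
proof -
  let ?o = "\<lambda>_::nat. 0::nat"
  have T0: "?o \<in> Tl" using Tl_const[of 0] d2 by simp
  have e: "lw n \<frown> ?o = ?o" for n by (auto simp: lw_def cat_def nth_Cons' simp flip: replicate_Suc)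
  have p0: "ap p ?o = ?o" using assms(2) T0 e by (metis pr_def)
  have o: "?o \<in> \<Omega>" using k2 d2 by (simp add: Bd_def)
  have least: "\<not> lex_less y ?o" for y by (simp add: lex_less_def)
  hence least': "y \<noteq> ?o \<Longrightarrow> lex_less ?o y" for y using lex_less_linear by metis
  have cyc: "cyc_pres p" using p by (simp add: TT_def)
  have "lex_less (ap p a) (ap p b)" if ab: "a \<in> \<Omega>" "b \<in> \<Omega>" "lex_less a b" for a b
  proof (cases "a = ?o")
    case True
    hence "b \<noteq> ?o" using ab by auto
    hence "ap p b \<noteq> ?o" using p0 by (metis ap_eq)
    thus ?thesis using least' True p0 by simp
  next
    case False
    hence "cyc_ordered ?o a b" using least' ab by (simp add: cyc_ordered_def)
    hence "cyc_ordered ?o (ap p a) (ap p b)" using cyc o ab p0 unfolding cyc_pres_def by metis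
    thus ?thesis using least by (simp add: cyc_ordered_def)
  qed
  thus ?thesis using p by (simp add: TT_def FF_def order_pres_on_def)
qed

text \<open>A power \<open>g\<close> of the rotation of \<open>Q'\<close> sends the first leaf of
  \<open>Q'\<close> to the leaf \<open>q\<close> which \<open>p\<close> assigns to the first leaf of
  \<open>P\<close>. Then \<open>- g + p\<close> fixes the leftmost ray and hence lies in F.\<close>

lemma TT_gen: "TT \<subseteq> gen (carets \<union> {rot P | P. cp P \<and> 3 \<le> length P})"
proof
  let ?G = "carets \<union> {rot P | P. cp P \<and> 3 \<le> length P}"
  fix p assume p: "p \<in> TT"
  hence "p \<in> VV" using TT_VV by blast
  then obtain P Q Q' where PQ: "cp P" "cp Q'" "mset Q = mset Q'" "mt P Q" "p = tp P Q"
    "\<And>w. w \<in> set P \<union> set Q \<Longrightarrow> 1 < length w" using VV_cases[of p 1] by metis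
  have l3: "3 \<le> length Q'" using cp_long[OF PQ(2)] PQ(3,6) by (metis UnCI mset_eq_setD)
  obtain r M where r: "P = lw r # M" using cp_first_last[OF PQ(1)] by blast
  obtain q N where q: "Q = q # N" using PQ(4) r by (cases Q) (auto simp: mt_def)
  obtain s N' where s: "Q' = lw s # N'" using cp_first_last[OF PQ(2)] by blast
  have "q \<in> set Q'" using PQ(3) q by (metis list.set_intros(1) mset_eq_setD)
  then obtain C D where CD: "Q' = C @ q # D" by (metis split_list)
  define g where "g = npow (length C) (rot Q')"
  have gt: "g = tp Q' (q # D @ C)" using npow_rot[OF PQ(2)] CD by (simp add: g_def rotate_append)
  have mg: "mt Q' (q # D @ C)" using mt_mset[OF cp_code[OF PQ(2)], of "q # D @ C"] CD by simp
  have "rot Q' \<in> gen ?G" using PQ(2) l3 by (intro gen.incl) auto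
  hence gG: "g \<in> gen ?G" unfolding g_def by (rule npow_in_sgp[OF sgp_gen])
  have "g \<in> TT" unfolding g_def using npow_in_sgp[OF sgp_TT] rot_TT PQ(2) by blast
  hence f: "- g + p \<in> TT" using p sgp_TT by (simp add: sgp_add sgp_neg)
  have "pr p (lw r) q" using tp_all2[OF PQ(4)] r q PQ(5) by simp
  moreover have "pr g (lw s) q" using tp_all2[OF mg] s gt by simp
  ultimately have "pr (- g + p) (lw r) (lw s)" using goodD(5,6)[OF good_pr] by blast
  hence "- g + p \<in> gen carets" using TT_fixes_least[OF f] FF_gen by blast
  moreover have "gen carets \<subseteq> gen ?G" by (intro gen_le[OF sgp_gen]) (auto intro: gen.incl)
  ultimately have "g + (- g + p) \<in> gen ?G" using gG gen.add by blast
  thus "p \<in> gen ?G" by (simp add: grp)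
qed

text \<open>Expand the leaf \<open>p\<close> and its image \<open>q\<close>. The coarse rotation now
  first moves the caret from \<open>p\<close> to \<open>q\<close> and then rotates the finer code as
  far as the whole block \<open>kids q\<close>, that is, past the single leaf
  \<open>p\<close>.\<close>

lemma rot_step:
  assumes "cp (p # q # B)" "B \<noteq> []"
  shows "rot (p # q # B) = rot (p # kids q @ B) + caret p q" "caret p q \<in> carets" "cp (p # kids q @ B)"
proof -
  have c: "cp ([] @ [p, q] @ B)" using assms by simp
  show "caret p q \<in> carets" using c assms(2) unfolding carets_def by blast
  have cpe: "cp (kids p @ [q] @ B)" "cp ([p] @ kids q @ B)"
    using cp.step[of "[]" p "q # B"] cp.step[of "[p]" q B] assms(1) by simp_all
  thus "cp (p # kids q @ B)" by simp
  have m0: "mt (p # q # B) (q # B @ [p])" using mt_rotate[OF assms(1), of 1] by simp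
  have m1: "mt (kids p @ [q] @ B) ([p] @ kids q @ B)" using cp_mt[OF cpe] by simp
  have m2: "mt ([p] @ kids q @ B) (kids q @ B @ [p])" using mt_mset[OF cp_code[OF cpe(2)]] by simp
  have "rot (p # q # B) = tp (kids p @ [q] @ B) (kids q @ B @ [p])"
    using tp_kids[of "[]" p "q # B" "[]" q "B @ [p]"] m0 mt_trans[OF m1 m2] by (simp add: rot_def)
  also have "\<dots> = tp ([p] @ kids q @ B) (kids q @ B @ [p]) + tp (kids p @ [q] @ B) ([p] @ kids q @ B)"
    using tp_comp[OF m1 m2] by simp
  also have "tp (kids p @ [q] @ B) ([p] @ kids q @ B) = caret p q"
    using caret_tp(1)[OF c] by simp
  finally show "rot (p # q # B) = rot (p # kids q @ B) + caret p q" by (simp add: rot_def)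
qed

lemma rot_chain:
  assumes "cp (p # q # B)" "B \<noteq> []"
  shows "\<exists>q' B' s. cp (p # q' # B') \<and> B' \<noteq> [] \<and> length B' = length B + j * (d - 1) \<and> gsum j s
    \<and> rot (p # q # B) = rot (p # q' # B') + s"
proof (induction j)
  case 0
  show ?case using assms gsum_0 by (intro exI[of _ q] exI[of _ B] exI[of _ 0]) auto
next
  case (Suc j)
  then obtain q' B' s where IH: "cp (p # q' # B')" "B' \<noteq> []" "length B' = length B + j * (d - 1)" "gsum j s"
    "rot (p # q # B) = rot (p # q' # B') + s" by blast
  obtain e where e: "kids q' = (q' @ [0]) # e" "length e = d - 1" using kids_ends(1)[of q'] by simp
  note st = rot_step[OF IH(1,2)]
  have "rot (p # q # B) = rot (p # (q' @ [0]) # (e @ B')) + (caret p q' + s)"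
    using IH(5) st(1) e(1) by (simp add: add.assoc)
  moreover have "gsum (Suc j) (caret p q' + s)" using gsum_Suc IH(4) st(2) by blast
  moreover have "cp (p # (q' @ [0]) # (e @ B'))" using st(3) e(1) by simp
  moreover have "length (e @ B') = length B + Suc j * (d - 1)" using e IH(3) by simp
  ultimately show ?case using IH(2) by (intro exI[of _ "q' @ [0]"] exI[of _ "e @ B'"] exI[of _ "caret p q' + s"]) auto
qed

text \<open>Modulo \<open>K\<close>, all generators \<open>caret u v\<close> become equal to one element \<open>a\<close>, which is
  \<open>(d - 1)\<close>-torsion, and \<open>rot_chain\<close> says \<open>r\<^sub>n = r\<^sub>n\<^sub>+\<^sub>j\<^sub>(\<^sub>d\<^sub>-\<^sub>1\<^sub>) + j a\<close> for the rotation \<open>r\<^sub>n\<close> of a code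
  of size \<open>n\<close>. With \<open>j = d - 1\<close> the coprime numbers \<open>n\<close> and \<open>n + (d - 1)\<^sup>2\<close> both annihilate \<open>r\<^sub>n\<close>.\<close>
lemma rot_in_normal:
  assumes K: "sgp K" "\<And>g x. g \<in> TT \<Longrightarrow> x \<in> K \<Longrightarrow> cj g x \<in> K"
    and a: "\<And>x. x \<in> carets \<Longrightarrow> x - a \<in> K" and coprime: "gcd k (d - 1) = 1"
    and P: "cp P" "3 \<le> length P"
  shows "rot P \<in> K"
proof -
  have npow_Suc2: "npow (Suc n) a = a + npow n a" for n using npow_add[of 1 n a] by simp
  have gsumK: "p - npow n a \<in> K" if "gsum n p" for n p
    using that
  proof induction
    case gsum_0
    show ?case using sgp_0[OF K(1)] by simp
  next
    case (gsum_Suc n p x)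
    have "x \<in> TT" using gsum_Suc.hyps(2) carets_FF FF_TT by blast
    moreover have "x + p - npow (Suc n) a = cj x (p - npow n a) + (x - a)"
      unfolding npow_Suc2 by (simp add: cj_def grp del: add_uminus_conv_diff)
    ultimately show ?case
      using sgp_add[OF K(1) K(2)[OF _ gsum_Suc.IH] a[OF gsum_Suc.hyps(2)]] by simp
  qed
  obtain p q B where P': "P = p # q # B" "B \<noteq> []"
    using P(2) by (cases P; cases "tl P"; cases "tl (tl P)") auto
  have c: "cp ([] @ [p, q] @ B)" using P P' by simp
  have "npow d a - a \<in> K"
  proof -
    have "caret p q - npow d a \<in> K" "caret p q - a \<in> K"
      using gsumK[OF caret_gsum[OF c]] a rot_step(2) P(1) P' by auto
    hence "- (caret p q - npow d a) + (caret p q - a) \<in> K" using K(1) sgp_add sgp_neg by blast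
    thus ?thesis by (simp add: grp del: add_uminus_conv_diff)
  qed
  moreover have "npow d a = npow (d - 1) a + a" using d2 by (metis One_nat_def Suc_pred npow.simps(2) pos2 order_less_le_trans)
  ultimately have tors: "npow (d - 1) a \<in> K" by simp
  obtain q' B' s where ch: "cp (p # q' # B')" "length B' = length B + (d - 1) * (d - 1)" "gsum (d - 1) s"
    "rot P = rot (p # q' # B') + s" using rot_chain[OF _ P'(2), of p q "d - 1"] P P' by blast
  let ?Q = "p # q' # B'"
  have "s \<in> K" using gsumK[OF ch(3)] tors K(1) sgp_add[of K "s - npow (d - 1) a" "npow (d - 1) a"] by simp
  hence rK: "rot P - rot ?Q \<in> K" using K(2)[OF rot_TT[OF ch(1)]] ch(4) by (simp add: cj_def)
  have "npow n (rot P) - npow n (rot ?Q) \<in> K" for n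
  proof (induction n)
    case (Suc n)
    have "npow (Suc n) (rot P) - npow (Suc n) (rot ?Q)
        = cj (npow n (rot P)) (rot P - rot ?Q) + (npow n (rot P) - npow n (rot ?Q))"
      by (simp add: cj_def grp del: add_uminus_conv_diff)
    moreover have "npow n (rot P) \<in> TT" using npow_in_sgp[OF sgp_TT rot_TT[OF P(1)]] .
    ultimately show ?case using Suc rK K by (simp add: sgp_add)
  qed (use sgp_0[OF K(1)] in simp)
  from this[of "length ?Q"] have 1: "npow (length ?Q) (rot P) \<in> K"
    using npow_rot_length[OF ch(1)] by simp
  have 2: "npow (length P) (rot P) \<in> K" using npow_rot_length[OF P(1)] sgp_0[OF K(1)] by simp
  obtain j where j: "length P = k + j * (d - 1)" using cp_length[OF P(1)] by blast
  have "coprime k (d - 1)" using coprime by (simp add: coprime_iff_gcd_eq_1)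
  hence "coprime (length P) (d - 1)" unfolding j
    by (metis coprime_iff_gcd_eq_1 gcd_add_mult add.commute mult.commute gcd.commute)
  hence cop: "coprime (length P) ((d - 1) * (d - 1))" by simp
  have lQ: "length ?Q = length P + (d - 1) * (d - 1)" using ch(2) P' by simp
  have "gcd (length P) (length ?Q) = 1"
    unfolding lQ gcd_add2 using cop by (simp only: coprime_iff_gcd_eq_1)
  hence "npow 1 (rot P) \<in> K" using npow_gcd[OF K(1) 2 1] by (simp only:)
  thus ?thesis by simp
qed

section \<open>Elements fixing a ball, and perfectness of T\<close>

definition fixers :: "(nat \<Rightarrow> nat) bp set \<Rightarrow> (nat \<Rightarrow> nat) bp set" where
  "fixers H = {p \<in> H. \<exists>w. vw w \<and> fixes_on (cyl w) p}"

lemma fixes_word: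
  assumes c: "cp (A @ [u, v] @ B)" "A @ B \<noteq> []" and f: "fixes_on (- (cyl u \<union> cyl v)) p"
  shows "\<exists>w. vw w \<and> fixes_on (cyl w) p"
proof -
  obtain w where w: "w \<in> set (A @ B)" using c(2) by (meson last_in_set)
  have "code (A @ [u, v] @ B)" using cp_code[OF c(1)] .
  hence "un (A @ B) \<inter> un [u, v] = {}" by (auto simp: code_append code_Cons)
  moreover have "cyl w \<subseteq> un (A @ B)" using w unfolding un_def by blast
  ultimately have "fixes_on (cyl w) p" by (intro fixes_on_mono[OF f]) auto
  thus ?thesis using w cp_vw[OF c(1), of w] by auto
qed

lemma carets_fixers: "carets \<subseteq> fixers FF"
proof
  fix x assume x: "x \<in> carets"
  then obtain u v A B where uv: "x = caret u v" "cp (A @ [u, v] @ B)" "A @ B \<noteq> []" by (auto simp: carets_def)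
  have "fixes_on (- (cyl u \<union> cyl v)) x"
    using tp_off[OF caret_tp(2)[OF uv(2)]] uv(1) by (simp add: caret_def)
  thus "x \<in> fixers FF" using fixes_word[OF uv(2,3)] x carets_FF by (auto simp: fixers_def)
qed

lemma mt_swap: "cp (A @ [u, v] @ B) \<Longrightarrow> mt [u, v] [v, u]"
proof -
  assume "cp (A @ [u, v] @ B)"
  hence "code [u, v]" using cp_code[of "A @ [u, v] @ B"] by (simp only: code_append)
  thus ?thesis by (rule mt_mset) simp
qed

lemma swaps_fixers: "swaps \<subseteq> fixers VV"
proof
  fix x assume "x \<in> swaps"
  then obtain u v A B where uv: "x = swap u v" "cp (A @ [u, v] @ B)" "A @ B \<noteq> []" by (auto simp: swaps_def)
  have "fixes_on (- (cyl u \<union> cyl v)) x" using tp_off[OF mt_swap[OF uv(2)]] uv(1) by (simp add: swap_def)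
  moreover have "x \<in> VV" using tp_VV[OF mt_swap[OF uv(2)]] uv(1) by (simp add: swap_def)
  ultimately show "x \<in> fixers VV" using fixes_word[OF uv(2,3)] by (auto simp: fixers_def)
qed

lemma fixers_mono: "H \<subseteq> H' \<Longrightarrow> fixers H \<subseteq> fixers H'"
  by (auto simp: fixers_def)

text \<open>Only deep balls need be mapped to balls, so one passes to a sub-ball first.\<close>

lemma AA_ball:
  assumes "g \<in> AA" "vw w"
  shows "\<exists>s v. tw s \<and> vw v \<and> ap g ` cyl (w @ s) = cyl v"
proof -
  obtain n where n: "\<And>w. vw w \<Longrightarrow> n < length w \<Longrightarrow> \<exists>v. hm g w v"
    using locally_long[OF good_hm, of g] assms(1) unfolding AA_def by blast
  have t: "tw (replicate (Suc n) 0)" using d2 by (auto simp: tw_def)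
  hence "vw (w @ replicate (Suc n) 0)" using assms(2) by (simp add: vw_append)
  then obtain v where "hm g (w @ replicate (Suc n) 0) v" using n by fastforce
  thus ?thesis using t unfolding hm_def by blast
qed

lemma fixers_conj:
  assumes "sgp H" "H \<subseteq> AA" "g \<in> H" "s \<in> fixers H" shows "cj g s \<in> fixers H"
proof -
  obtain w where w: "vw w" "fixes_on (cyl w) s" using assms(4) by (auto simp: fixers_def)
  have "g \<in> AA" using assms by blast
  then obtain t v where v: "tw t" "vw v" "ap g ` cyl (w @ t) = cyl v" using AA_ball w(1) by blast
  have "fixes_on (cyl (w @ t)) s" using w(2) cyl_append_sub[OF v(1)] fixes_on_mono by blast
  hence "fixes_on (cyl v) (cj g s)" using fixes_on_cj v(3) by metis
  thus ?thesis using v(2) assms cj_in_sgp by (auto simp: fixers_def)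
qed

text \<open>The subgroup generated by the fixers is normal and contains the caret moves, so that
  \<open>rot_in_normal\<close> applies with \<open>a = 0\<close>.\<close>

lemma TT_fixers:
  assumes "gcd k (d - 1) = 1" shows "TT \<subseteq> gen (fixers TT)"
proof -
  let ?K = "gen (fixers TT)"
  have carets: "carets \<subseteq> ?K" using carets_fixers fixers_mono[OF FF_TT] gen.incl by blast
  have "rot P \<in> ?K" if "cp P" "3 \<le> length P" for P
  proof (rule rot_in_normal[OF sgp_gen _ _ assms that])
    show "cj g x \<in> ?K" if "g \<in> TT" "x \<in> ?K" for g x
      using fixers_conj[OF sgp_TT _ that(1)] TT_VV VV_AA by (intro cj_gen[OF _ that(2)] gen.incl) blast
    show "x - 0 \<in> ?K" if "x \<in> carets" for x using that carets by auto
  qed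
  hence "gen (carets \<union> {rot P | P. cp P \<and> 3 \<le> length P}) \<subseteq> ?K"
    using carets by (intro gen_le[OF sgp_gen]) auto
  thus ?thesis using TT_gen by blast
qed

lemma TT_perfect:
  assumes g: "gcd k (d - 1) = 1" shows "TT \<subseteq> der TT"
proof -
  let ?K = "der TT"
  note K = sgp_der[of TT] cj_der[OF sgp_TT, unfolded imp_conjL[symmetric]]
  obtain p q B where P: "cp (p # q # B)" "B \<noteq> []"
  proof -
    have "cp ([] @ [lw 0] @ map (\<lambda>i. [i]) [1..<k])" using cp.base base_ends(1) by simp
    hence "cp (kids (lw 0) @ map (\<lambda>i. [i]) [1..<k])" using cp.step by fastforce
    then obtain R where R: "cp R" "3 \<le> length R" using d2 k2 by fastforce
    obtain p q B where "R = p # q # B" "B \<noteq> []"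
      using R(2) by (cases R; cases "tl R"; cases "tl (tl R)") auto
    thus ?thesis using R that by blast
  qed
  have diff: "x - y \<in> ?K" if x: "x \<in> carets" and y: "y \<in> carets" for x y
  proof -
    obtain h where h: "h \<in> TT" "cj h y = x" using carets_conj[OF y x] by blast
    hence "x - y = comm h y" by (simp add: cj_def comm_def)
    thus ?thesis using comm_in_der[OF h(1)] y carets_FF FF_TT by (metis subsetD)
  qed
  have a: "caret p q \<in> carets" using rot_step(2)[OF P] .
  have rot: "rot R \<in> ?K" if "cp R" "3 \<le> length R" for R
    using diff a that cj_der[OF sgp_TT] by (intro rot_in_normal[OF sgp_der _ _ g, where a = "caret p q"]) auto
  have "1 \<le> length B" using P(2) by (cases B) auto
  hence "3 \<le> length (p # q # B)" "3 \<le> length (p # kids q @ B)" using d2 by simp_all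
  hence "rot (p # q # B) \<in> ?K" "rot (p # kids q @ B) \<in> ?K" using rot P(1) rot_step(3)[OF P] by blast+
  \<comment> \<open>By \<open>rot_step\<close> this caret move is a quotient of two rotations of
    codes with at least three leaves.\<close>
  hence "caret p q \<in> ?K" using rot_step(1)[OF P] sgp_add_left[OF sgp_der] by metis
  hence "x \<in> ?K" if "x \<in> carets" for x using diff[OF that a] sgp_add[OF sgp_der, of "x - caret p q" TT "caret p q"] by simp
  hence "gen (carets \<union> {rot P | P. cp P \<and> 3 \<le> length P}) \<subseteq> ?K"
    using rot by (intro gen_le[OF sgp_der]) auto
  thus ?thesis using TT_gen by blast
qed

end

section \<open>The groups between T and AAut\<close>

lemma glue_bp:
  fixes D :: "nat \<Rightarrow> 'a set" and e :: "nat \<Rightarrow> 'a bp"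
  assumes disj: "\<And>i j. i \<noteq> j \<Longrightarrow> D i \<inter> D j = {}" and im: "\<And>i. ap (e i) ` D i = D i"
  shows "\<exists>q. (\<forall>i. \<forall>x\<in>D i. ap q x = ap (e i) x) \<and> fixes_on (- \<Union> (range D)) q"
proof -
  define f where "f e x = (if \<exists>i. x \<in> D i then ap (e (THE i. x \<in> D i)) x else x)" for e :: "nat \<Rightarrow> 'a bp" and x
  have f_in: "f e x = ap (e i) x" if "x \<in> D i" for e x i
  proof -
    have "(THE i. x \<in> D i) = i" using disj that by (intro the_equality) blast+
    thus ?thesis using that by (auto simp: f_def)
  qed
  have f_out: "f e x = x" if "x \<notin> \<Union> (range D)" for e x using that by (auto simp: f_def)
  have inv: "f e2 (f e1 x) = x" if "\<And>i x. x \<in> D i \<Longrightarrow> ap (e1 i) x \<in> D i" "\<And>i x. ap (e2 i) (ap (e1 i) x) = x" for e1 e2 x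
  proof (cases "\<exists>i. x \<in> D i")
    case True
    then obtain i where i: "x \<in> D i" by blast
    show ?thesis using f_in[OF i, of e1] f_in[OF that(1)[OF i], of e2] that(2) by simp
  qed (use f_out in auto)
  have p: "ap (e i) x \<in> D i" if "x \<in> D i" for i x using im that by blast
  have n: "ap (- e i) x \<in> D i" if x: "x \<in> D i" for i x
  proof -
    obtain y where "y \<in> D i" "x = ap (e i) y" using im[of i] x by blast
    thus ?thesis by simp
  qed
  have "bij (f e)"
    using inv[of e "\<lambda>i. - e i"] inv[of "\<lambda>i. - e i" e] p n
    by (intro bij_betw_byWitness[where f' = "f (\<lambda>i. - e i)"]) auto
  thus ?thesis using f_in f_out by (intro exI[of _ "Abs_bp (f e)"]) (auto simp: fixes_on_def)
qed

lemma restrict_bp: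
  assumes "ap p ` W = W"
  shows "\<exists>q. (\<forall>x\<in>W. ap q x = ap p x) \<and> fixes_on (- W) q"
proof -
  define D :: "nat \<Rightarrow> 'a set" where "D i = (if i = 0 then W else {})" for i
  have d: "D i \<inter> D j = {}" if "i \<noteq> j" for i j using that by (simp add: D_def)
  have im: "ap p ` D i = D i" for i using assms by (simp add: D_def)
  obtain q where q: "\<And>i x. x \<in> D i \<Longrightarrow> ap q x = ap p x" "fixes_on (- \<Union> (range D)) q"
    using glue_bp[of D "\<lambda>_. p", OF d im] by blast
  moreover have "\<Union> (range D) = W" by (auto simp: D_def split: if_splits)
  moreover have "ap q x = ap p x" if "x \<in> W" for x
    by (rule q(1)[where i = 0]) (use that in \<open>simp add: D_def\<close>)
  ultimately show ?thesis by auto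
qed

text \<open>The isosceles property of an ultrametric: moving two points by less than their distance
  does not change it.\<close>

lemma Nagree_perturb:
  assumes "x \<noteq> y" "x' = x \<or> Nagree x y < Nagree x x'" "y' = y \<or> Nagree x y < Nagree y y'"
  shows "Nagree x' y' = Nagree x y"
proof (rule Nagree_eqI)
  have eq: "x' i = x i" "y' i = y i" if "i \<le> Nagree x y" for i
    using assms(2,3) that Nagree_less[of i x x'] Nagree_less[of i y y'] by auto
  show "x' i = y' i" if "i < Nagree x y" for i using eq[of i] that Nagree_less[OF that] by simp
  show "x' (Nagree x y) \<noteq> y' (Nagree x y)" using eq[of "Nagree x y"] Nagree_neq[OF assms(1)] by simp
qed

context tree
begin

definition compls :: "(nat \<Rightarrow> nat) set set" where
  "compls = {\<Omega> - cyl w | w. vw w}"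

lemma small_commI:
  assumes "H \<subseteq> AA" "s \<in> H" "t \<in> H" "vw w" "fixes_on (cyl w) s" "fixes_on (cyl w) t"
  shows "comm s t \<in> small_comms H compls"
proof -
  have "fixes_on (- (\<Omega> - cyl w)) p" if "p \<in> AA" "fixes_on (cyl w) p" for p
    using that AA_fixes[OF that(1)] by (auto simp: fixes_on_def)
  thus ?thesis using assms unfolding small_comms_def compls_def by blast
qed

lemma disjoint_words:
  assumes "vw w" "vw u"
  shows "\<exists>w' u'. vw w' \<and> vw u' \<and> cyl w' \<subseteq> cyl w \<and> cyl u' \<subseteq> cyl u \<and> cyl w' \<inter> cyl u' = {}"
proof (cases "cyl w \<inter> cyl u = {}")
  case False
  then obtain x where x: "x \<in> cyl w" "x \<in> cyl u" by blast
  define m where "m = (if length w \<le> length u then u else w)"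
  have vm: "vw m" using assms by (simp add: m_def)
  have t: "tw [0]" "tw [1]" using d2 by auto
  have m: "cyl m \<subseteq> cyl w" "cyl m \<subseteq> cyl u"
  proof -
    have sub: "cyl b \<subseteq> cyl a" if ab: "x \<in> cyl a" "x \<in> cyl b" "vw a" "vw b" "length a \<le> length b" for a b
    proof -
      obtain s where "b = a @ s" "tw s" using cyl_meet_prefix[OF ab] by blast
      thus ?thesis using cyl_append_sub by simp
    qed
    show "cyl m \<subseteq> cyl w" "cyl m \<subseteq> cyl u"
      using sub[OF x assms] sub[OF x(2,1) assms(2,1)] by (auto simp: m_def split: if_splits)
  qed
  have "cyl (m @ [0]) \<inter> cyl (m @ [1]) = {}"
    using vm t by (intro cyl_disjoint_same_length) (auto simp: vw_append)
  thus ?thesis using m cyl_append_sub[OF t(1), of m] cyl_append_sub[OF t(2), of m] vm t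
    by (intro exI[of _ "m @ [0]"] exI[of _ "m @ [1]"]) (auto simp: vw_append)
qed (use assms in blast)

lemma split_words:
  assumes "vw w"
  shows "vw (w @ [0])" "vw (w @ [1])" "cyl (w @ [0]) \<subseteq> cyl w" "cyl (w @ [1]) \<subseteq> cyl w"
    "cyl (w @ [0]) \<inter> cyl (w @ [1]) = {}"
proof -
  have t: "tw [0]" "tw [1]" using d2 by auto
  show v: "vw (w @ [0])" "vw (w @ [1])" using t assms by (auto simp: vw_append)
  show "cyl (w @ [0]) \<subseteq> cyl w" "cyl (w @ [1]) \<subseteq> cyl w"
    using cyl_append_sub[OF t(1), of w] cyl_append_sub[OF t(2), of w] by simp_all
  show "cyl (w @ [0]) \<inter> cyl (w @ [1]) = {}" using v by (intro cyl_disjoint_same_length) auto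
qed

text \<open>If \<open>h\<^sub>i\<close> maps the complement of the ball \<open>B\<^sub>i\<close> into the ball \<open>U\<^sub>i\<close>, where the four balls are
  disjoint, then the commutator of \<open>h\<^sub>1\<close> and \<open>h\<^sub>2\<close> maps the complement of \<open>U\<^sub>2\<close> into \<open>U\<^sub>1\<close>.\<close>
lemma T_der_push:
  assumes "vw w" "vw u"
  shows "\<exists>g\<in>der TT. ap g ` (\<Omega> - cyl w) \<subseteq> cyl u"
proof -
  obtain w' u' where wu: "vw w'" "vw u'" "cyl w' \<subseteq> cyl w" "cyl u' \<subseteq> cyl u" "cyl w' \<inter> cyl u' = {}"
    using disjoint_words[OF assms] by blast
  note swap = split_words[OF wu(1)] and su = split_words[OF wu(2)]
  define U2 B2 U1 B1 where "U2 = cyl (w' @ [0])" and "B2 = cyl (w' @ [1])"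
    and "U1 = cyl (u' @ [0])" and "B1 = cyl (u' @ [1])"
  note defs = B1_def U1_def B2_def U2_def
  have disj: "B1 \<inter> B2 = {}" "B2 \<inter> U1 = {}" "U2 \<inter> B1 = {}" and sub: "U1 \<subseteq> cyl u" "U2 \<subseteq> cyl w"
    and inX: "B1 \<subseteq> \<Omega>" "B2 \<subseteq> \<Omega>" "U1 \<subseteq> \<Omega>" "U2 \<subseteq> \<Omega>"
    unfolding defs using swap su wu cyl_sub_X by blast+
  obtain h1 where h1: "h1 \<in> TT" "ap h1 ` (\<Omega> - B1) \<subseteq> U1" using T_push[OF su(2) su(1)] by (auto simp: defs)
  obtain h2 where h2: "h2 \<in> TT" "ap h2 ` (\<Omega> - B2) \<subseteq> U2" using T_push[OF swap(2) swap(1)] by (auto simp: defs)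
  have pull: "ap (- h) x \<in> B" if h: "h \<in> TT" "ap h ` (\<Omega> - B) \<subseteq> U" and x: "x \<in> \<Omega>" "x \<notin> U" for h x B U
  proof (rule ccontr)
    assume n: "ap (- h) x \<notin> B"
    have "- h \<in> AA" using sgp_neg[OF sgp_TT h(1)] TT_VV VV_AA by blast
    hence "ap (- h) x \<in> \<Omega>" using AA_image x(1) by blast
    hence "ap h (ap (- h) x) \<in> U" using h(2) n by blast
    thus False using x(2) by simp
  qed
  have "ap (comm h1 h2) x \<in> cyl u" if x: "x \<in> \<Omega> - cyl w" for x
  proof -
    have "ap (- h2) x \<in> B2" using pull[OF h2] x sub by blast
    hence "ap (- h1) (ap (- h2) x) \<in> B1" using pull[OF h1] disj inX by blast
    hence "ap h2 (ap (- h1) (ap (- h2) x)) \<in> U2" using h2(2) disj inX by blast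
    hence "ap h1 (ap h2 (ap (- h1) (ap (- h2) x))) \<in> U1" using h1(2) disj inX by blast
    thus ?thesis using sub by (auto simp: comm_def)
  qed
  thus ?thesis using comm_in_der[OF h1(1) h2(1)] by blast
qed

lemma der_FF_small_compls:
  assumes "FF \<subseteq> H" "H \<subseteq> AA"
  shows "der FF \<subseteq> gen (small_comms H compls)"
proof -
  have "small_comms FF (range inner) \<subseteq> small_comms H compls"
  proof
    fix c assume "c \<in> small_comms FF (range inner)"
    then obtain s t n where c: "c = comm s t" "s \<in> FF" "t \<in> FF" "fixes_on (- inner n) s" "fixes_on (- inner n) t"
      by (auto simp: small_comms_def)
    have "cyl (lw n) \<subseteq> - inner n" by (auto simp: inner_def)
    hence "fixes_on (cyl (lw n)) s" "fixes_on (cyl (lw n)) t" using c(4,5) fixes_on_mono by blast+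
    moreover have "s \<in> H" "t \<in> H" using c(2,3) assms(1) by auto
    ultimately show "c \<in> small_comms H compls" unfolding c(1) by (intro small_commI[OF assms(2) _ _ vw_lw])
  qed
  thus ?thesis using der_FF_small gen_le[OF sgp_gen] gen.incl by blast
qed

lemma der_le_of_commensurated:
  assumes H: "TT \<subseteq> H" "H \<subseteq> AA" "sgp H" "H \<subseteq> gen (fixers H)" and L: "sgp L"
    and wc: "\<And>g \<tau>. g \<in> der H \<Longrightarrow> \<tau> \<in> L \<Longrightarrow> \<exists>n>0. cj g (npow n \<tau>) \<in> L"
    and t: "t \<in> L" "\<And>i. i > 0 \<Longrightarrow> ap (npow i t) ` cyl u \<inter> cyl u = {}" "vw u"
  shows "der H \<subseteq> L"
proof (rule der_le_commensurated[OF H(3) L wc t(1,2)])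
  let ?N = "gen (small_comms H compls)"
  have FH: "FF \<subseteq> H" using FF_TT H(1) by blast
  have small_cj: "cj g c \<in> small_comms H compls" if g: "g \<in> H" and c: "c \<in> small_comms H compls" for g c
  proof -
    obtain s r w where c': "c = comm s r" "s \<in> H" "r \<in> H" "vw w"
      "fixes_on (- (\<Omega> - cyl w)) s" "fixes_on (- (\<Omega> - cyl w)) r"
      using c by (auto simp: small_comms_def compls_def)
    obtain a v where v: "tw a" "vw v" "ap g ` cyl (w @ a) = cyl v" using AA_ball[of g w] g H(2) c'(4) by blast
    have "cyl (w @ a) \<subseteq> - (\<Omega> - cyl w)" using cyl_append_sub[OF v(1), of w] by blast
    hence f: "fixes_on (cyl (w @ a)) s" "fixes_on (cyl (w @ a)) r" using c' fixes_on_mono by blast+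
    have "fixes_on (cyl v) (cj g s)" "fixes_on (cyl v) (cj g r)"
      using fixes_on_cj[OF f(1), of g] fixes_on_cj[OF f(2), of g] by (simp_all only: v(3))
    thus ?thesis unfolding c'(1) cj_comm
      using small_commI[OF H(2) _ _ v(2)] cj_in_sgp[OF H(3) g] c' by blast
  qed
  have norm: "cj g n \<in> ?N" if "g \<in> H" "n \<in> ?N" for g n
    by (rule cj_gen[OF _ that(2)]) (rule gen.incl, rule small_cj[OF that(1)])
  have SH: "fixers H \<subseteq> H" by (auto simp: fixers_def)
  have genH: "gen (fixers H) \<subseteq> H" by (rule gen_le[OF H(3) SH])
  have commN: "comm s r \<in> ?N" if sS: "s \<in> fixers H" and rS: "r \<in> fixers H" for s r
  proof -
    obtain w1 w2 where w: "vw w1" "fixes_on (cyl w1) s" "vw w2" "fixes_on (cyl w2) r"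
      using sS rS by (auto simp: fixers_def)
    have sH: "s \<in> H" and rH: "r \<in> H" using sS rS SH by auto
    \<comment> \<open>F' fixes the end points and can push only sets inside some
      \<open>inner m\<close>, so the ball \<open>w1\<close> is first shrunk to such a set.\<close>
    obtain v m where v: "vw v" "cyl v \<subseteq> cyl w1" "cyl v \<subseteq> inner m" using interior[OF w(1)] by blast
    obtain f where f: "f \<in> der FF" "ap f ` inner m \<subseteq> cyl w2" using der_FF_push[OF w(3)] by blast
    have fN: "f \<in> ?N" using der_FF_small_compls[OF FH H(2)] f(1) by blast
    have fH: "f \<in> H" using f(1) der_le[OF sgp_FF] FH by blast
    obtain a b where b: "tw a" "vw b" "ap f ` cyl (v @ a) = cyl b" using AA_ball[of f v] fH H(2) v(1) by blast
    have va: "cyl (v @ a) \<subseteq> cyl v" using cyl_append_sub[OF b(1)] .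
    define s' where "s' = cj f s"
    have s'H: "s' \<in> H" unfolding s'_def by (rule cj_in_sgp[OF H(3) fH sH])
    have "fixes_on (cyl (v @ a)) s" using w(2) v(2) va fixes_on_mono by blast
    hence fs: "fixes_on (cyl b) s'" using fixes_on_cj b(3) unfolding s'_def by metis
    have "cyl b \<subseteq> cyl w2" using b(3) f(2) va v(3) by blast
    hence fr: "fixes_on (cyl b) r" using w(4) fixes_on_mono by blast
    have "comm s' r \<in> ?N" using small_commI[OF H(2) s'H rH b(2) fs fr] gen.incl by blast
    \<comment> \<open>Since \<open>f\<close> lies in the normal subgroup, \<open>s\<close> and its
      conjugate \<open>s'\<close> agree modulo this subgroup, and \<open>s'\<close> fixes a ball
      inside \<open>cyl w2\<close>, as \<open>r\<close> does.\<close>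
    moreover define n where "n = s - s'"
    have "n = cj s f - f" by (simp add: n_def s'_def cj_def grp del: add_uminus_conv_diff)
    hence nN: "n \<in> ?N" using norm[OF sH fN] fN sgp_diff[OF sgp_gen] by simp
    moreover have "cj r (- n) \<in> ?N" using norm[OF rH] gen.neg[OF nN] by blast
    moreover have "comm s r = n + comm s' r + cj r (- n)"
      by (simp add: n_def comm_def cj_def grp del: add_uminus_conv_diff)
    ultimately show ?thesis using gen.add by metis
  qed
  have "der (gen (fixers H)) \<subseteq> ?N"
    by (rule der_gen_le[OF sgp_gen]) (use norm genH commN in auto)
  thus "der H \<subseteq> ?N" using der_mono[OF H(4)] by blast
next
  fix W assume "W \<in> compls"
  then obtain w where w: "vw w" "W = \<Omega> - cyl w" by (auto simp: compls_def)
  \<comment> \<open>Inside the ball of \<open>w\<close>, the words \<open>w @ [0]\<close> and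
    \<open>w @ [1, 0]\<close> receive the two copies of \<open>W\<close>. The ball of
    \<open>w @ [1, 1]\<close> stays free, and its complement is what gets pushed into
    \<open>cyl u\<close>.\<close>
  note s1 = split_words[OF w(1)]
  note s2 = split_words[OF s1(2)]
  obtain h1 where h1: "h1 \<in> TT" "ap h1 ` W \<subseteq> cyl (w @ [0])" using T_push[OF w(1) s1(1)] w(2) by blast
  obtain h2 where h2: "h2 \<in> TT" "ap h2 ` W \<subseteq> cyl ((w @ [1]) @ [0])" using T_push[OF w(1) s2(1)] w(2) by blast
  obtain g where g: "g \<in> der TT" "ap g ` (\<Omega> - cyl ((w @ [1]) @ [1])) \<subseteq> cyl u"
    using T_der_push[OF s2(2) t(3)] by blast
  have sub: "cyl (w @ [0]) \<subseteq> \<Omega> - cyl ((w @ [1]) @ [1])" "cyl ((w @ [1]) @ [0]) \<subseteq> \<Omega> - cyl ((w @ [1]) @ [1])"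
    "\<Omega> - cyl w \<subseteq> \<Omega> - cyl ((w @ [1]) @ [1])"
    using cyl_sub_X[OF s1(1)] cyl_sub_X[OF s2(1)] s1(4,5) s2(4,5) by blast+
  have "W \<union> ap h1 ` W \<union> ap h2 ` W \<subseteq> \<Omega> - cyl ((w @ [1]) @ [1])"
    by (rule Un_least[OF Un_least[OF sub(3)[folded w(2)] subset_trans[OF h1(2) sub(1)]] subset_trans[OF h2(2) sub(2)]])
  hence "ap g ` (W \<union> ap h1 ` W \<union> ap h2 ` W) \<subseteq> cyl u" by (rule subset_trans[OF image_mono g(2)])
  moreover have "W \<inter> cyl (w @ [0]) = {}" "W \<inter> cyl ((w @ [1]) @ [0]) = {}" "cyl (w @ [0]) \<inter> cyl ((w @ [1]) @ [0]) = {}"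
    using s1(3-5) s2(3) unfolding w(2) by blast+
  hence "W \<inter> ap h1 ` W = {}" "W \<inter> ap h2 ` W = {}" "ap h1 ` W \<inter> ap h2 ` W = {}"
    using h1(2) h2(2) by blast+
  moreover have "h1 \<in> H" "h2 \<in> H" "g \<in> der H" using h1(1) h2(1) g(1) H(1) der_mono by blast+
  ultimately show "\<exists>h1\<in>H. \<exists>h2\<in>H. \<exists>g\<in>der H. W \<inter> ap h1 ` W = {} \<and> W \<inter> ap h2 ` W = {}
      \<and> ap h1 ` W \<inter> ap h2 ` W = {} \<and> ap g ` (W \<union> ap h1 ` W \<union> ap h2 ` W) \<subseteq> cyl u"
    by blast
qed

lemma VV_fixers: "VV \<subseteq> gen (fixers VV)"
proof -
  have "carets \<union> swaps \<subseteq> fixers VV" using carets_fixers swaps_fixers fixers_mono[OF FF_VV] by blast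
  hence "gen (carets \<union> swaps) \<subseteq> gen (fixers VV)" by (intro gen_le[OF sgp_gen]) (auto intro: gen.incl)
  thus ?thesis using VV_gen by blast
qed

section \<open>The group AAut is perfect\<close>

definition isoms :: "(nat \<Rightarrow> nat) bp set" where
  "isoms = {p. \<exists>w. hm p w w \<and> fixes_on (- cyl w) p}"

lemma isoms_AA:
  assumes h: "hm p w w" and f: "fixes_on (- cyl w) p" shows "p \<in> AA"
proof -
  have w: "vw w" using h by (simp add: hm_def)
  have "\<exists>v. hm p u v" if u: "vw u" "length u = Suc (length w)" for u
  proof (cases "cyl u \<inter> cyl w = {}")
    case True
    hence "fixes_on (cyl u) p" by (intro fixes_on_mono[OF f]) auto
    thus ?thesis using pr_hm pr_fixed[OF u(1)] by blast
  next
    case False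
    then obtain x where "x \<in> cyl w" "x \<in> cyl u" by blast
    then obtain s where "u = w @ s" "tw s" using cyl_meet_prefix[OF _ _ w u(1)] u(2) by (metis le_SucI order_refl)
    thus ?thesis using hm_extend[OF h] by blast
  qed
  moreover have "fixes_on (- \<Omega>) p" by (rule fixes_on_mono[OF f]) (use cyl_sub_X[OF w] in blast)
  ultimately show ?thesis unfolding AA_def locally_def by blast
qed

lemma hm_cong: "(\<And>x. x \<in> cyl w \<Longrightarrow> ap p x = ap q x) \<Longrightarrow> hm p w v \<longleftrightarrow> hm q w v"
proof -
  assume e: "\<And>x. x \<in> cyl w \<Longrightarrow> ap p x = ap q x"
  hence "ap p ` cyl w = ap q ` cyl w" by (intro image_cong) auto
  moreover have "(\<forall>x\<in>cyl w. \<forall>y\<in>cyl w. x \<noteq> y \<longrightarrow> Nagree (ap p x) (ap p y) + length w = Nagree x y + length v)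
      \<longleftrightarrow> (\<forall>x\<in>cyl w. \<forall>y\<in>cyl w. x \<noteq> y \<longrightarrow> Nagree (ap q x) (ap q y) + length w = Nagree x y + length v)"
    by (intro ball_cong refl) (simp only: e)
  ultimately show ?thesis unfolding hm_def by (simp only:)
qed

text \<open>Split off the restriction of \<open>s\<close> to one ball of \<open>P\<close> at a
  time.\<close>

lemma isoms_gen:
  "code P \<Longrightarrow> (\<And>w. w \<in> set P \<Longrightarrow> hm s w w) \<Longrightarrow> fixes_on (- un P) s \<Longrightarrow> s \<in> gen isoms"
proof (induction P arbitrary: s)
  case Nil
  hence "s = 0" by (intro bp_eqI) (simp add: fixes_on_def)
  thus ?case by (simp add: gen.zero)
next
  case (Cons w P)
  have c: "code P" "cyl w \<inter> un P = {}" using Cons.prems(1) by (auto simp: code_Cons)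
  have h: "hm s w w" using Cons.prems(2) by simp
  hence "ap s ` cyl w = cyl w" by (simp add: hm_def)
  then obtain q where q: "\<forall>x\<in>cyl w. ap q x = ap s x" "fixes_on (- cyl w) q" using restrict_bp by blast
  have "hm q w w" using h hm_cong[of w q s w] q(1) by simp
  hence qI: "q \<in> isoms" using q(2) by (auto simp: isoms_def)
  have nq: "ap (- q) x = x" if "x \<notin> cyl w" for x
    using q(2) that fixes_on_neg[of "- cyl w" q] by (simp add: fixes_on_def)
  have im: "ap s x \<in> cyl v" if "v \<in> set P" "x \<in> cyl v" for v x
    using hm_in[OF Cons.prems(2)[of v]] that by simp
  have "hm (- q + s) v v" if v: "v \<in> set P" for v
  proof -
    have sub: "cyl v \<subseteq> - cyl w" using c(2) v by (auto simp: un_def)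
    have "ap (- q + s) x = ap s x" if "x \<in> cyl v" for x using nq im[OF v that] sub by auto
    thus ?thesis using hm_cong[of v "- q + s" s v] Cons.prems(2)[of v] v by simp
  qed
  moreover have "fixes_on (- un P) (- q + s)"
    unfolding fixes_on_def
  proof
    fix x assume x: "x \<in> - un P"
    show "ap (- q + s) x = x"
    proof (cases "x \<in> cyl w")
      case True
      hence "ap s x = ap q x" using q(1) by simp
      thus ?thesis by simp
    next
      case False
      hence "ap s x = x" using Cons.prems(3) x by (simp add: fixes_on_def)
      thus ?thesis using nq[OF False] by simp
    qed
  qed
  ultimately have "- q + s \<in> gen isoms" using Cons.IH c(1) by blast
  hence "q + (- q + s) \<in> gen isoms" using gen.incl[OF qI] gen.add by blast
  thus ?case by (simp add: grp)
qed

text \<open>On each ball of a level, an almost automorphism differs from the prefix replacement with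
  the same image ball by an isometry.\<close>

lemma AA_gen: "AA \<subseteq> gen (VV \<union> isoms)"
proof
  fix p assume p: "p \<in> AA"
  hence "locally hm p" by (simp add: AA_def)
  then obtain P Q Q' where PQ: "cp P" "cp Q'" "mset Q = mset Q'" "mt P Q" "list_all2 (hm p) P Q"
    using locally_cases[OF good_hm, of p 0] by metis
  define v where "v = tp P Q"
  have v: "v \<in> VV" unfolding v_def by (rule tp_VV[OF PQ(4)])
  have "hm (- v + p) w w" if w: "w \<in> set P" for w
  proof -
    obtain i where i: "i < length P" "w = P ! i" using w by (metis in_set_conv_nth)
    have "hm p (P ! i) (Q ! i)" using PQ(5) i by (simp add: list_all2_conv_all_nth)
    moreover have "hm v (P ! i) (Q ! i)" unfolding v_def by (rule pr_hm[OF tp_pr[OF PQ(4) i(1)]])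
    ultimately show ?thesis using goodD(5,6)[OF good_hm] i(2) by metis
  qed
  moreover have "fixes_on (- un P) (- v + p)"
    unfolding cp_un[OF PQ(1)] using AA_fixes[OF p] VV_fixes[OF v] by (intro fixes_on_add) simp_all
  ultimately have "- v + p \<in> gen isoms" using isoms_gen[OF cp_code[OF PQ(1)]] by blast
  moreover have "gen isoms \<subseteq> gen (VV \<union> isoms)" by (intro gen_le[OF sgp_gen]) (auto intro: gen.incl)
  moreover have "v \<in> gen (VV \<union> isoms)" using v by (intro gen.incl) simp
  ultimately have "v + (- v + p) \<in> gen (VV \<union> isoms)" using gen.add by blast
  thus "p \<in> gen (VV \<union> isoms)" by (simp add: grp)
qed

lemma hm_selfI:
  assumes "vw w" "ap p ` cyl w = cyl w"
    "\<And>x y. x \<in> cyl w \<Longrightarrow> y \<in> cyl w \<Longrightarrow> x \<noteq> y \<Longrightarrow> Nagree (ap p x) (ap p y) = Nagree x y"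
  shows "hm p w w"
  using assms by (simp add: hm_def)

text \<open>An infinite swindle: infinitely many copies of an isometry of a ball, placed in the balls
  \<open>lw i @ [1]\<close>, form an isometry of the ball \<open>lw 0\<close>.\<close>
lemma isoms_der_special:
  assumes h: "hm s (lw 0 @ [1]) (lw 0 @ [1])" and f: "fixes_on (- cyl (lw 0 @ [1])) s"
  shows "s \<in> der AA"
proof -
  have "cp ([] @ [lw 0, [1]] @ map (\<lambda>i. [i]) [2..<k])"
  proof -
    have "map (\<lambda>i. [i]) [1..<k] = [1] # map (\<lambda>i. [i]) [2..<k]"
      using k2 by (simp add: upt_conv_Cons numeral_2_eq_2)
    thus ?thesis using cp.base base_ends(1) by simp
  qed
  note c = this
  \<comment> \<open>The inverse caret move contracts \<open>lw 0\<close> towards the leftmost ray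
    and so carries each \<open>D i\<close> to \<open>D (Suc i)\<close>.\<close>
  define g where "g = - caret (lw 0) [1]"
  have mx: "mt (kids (lw 0) @ [[1]]) ([lw 0] @ kids [1])" using caret_tp(2)[OF c] .
  have gx: "g = tp ([lw 0] @ kids [1]) (kids (lw 0) @ [[1]])" using tp_neg[OF mx] by (simp add: g_def caret_def)
  have "g \<in> VV" unfolding gx by (rule tp_VV[OF mt_sym[OF mx]])
  hence gA: "g \<in> AA" using VV_AA by blast
  have g0: "pr g (lw 0) (lw 1)"
    using tp_pr[OF mt_sym[OF mx], of 0] kids_ends(1)[of "lw 0"] lw_Suc[of 0] by (simp add: gx)
  have gl: "pr g (lw i) (lw (Suc i))" for i
  proof (induction i)
    case (Suc i)
    thus ?case using pr_extend[OF Suc, of "[0]"] d2 by (simp add: lw_Suc)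
  qed (use g0 in simp)
  define D where "D i = cyl (lw i @ [1])" for i
  have t1: "tw [1]" "tw [0]" using d2 by auto
  have vD: "vw (lw i @ [1])" for i using t1 by (simp add: vw_append)
  have gD: "pr g (lw i @ [1]) (lw (Suc i) @ [1])" for i using pr_extend[OF gl t1(1)] .
  hence gDi: "ap g ` D i = D (Suc i)" for i using pr_image by (simp add: D_def)
  have lw_mono: "cyl (lw j) \<subseteq> cyl (lw i)" if "i \<le> j" for i j
    using that by (induction j rule: dec_induct) (use cyl_lw_Suc in auto)
  have D_lw: "D i \<subseteq> cyl (lw i)" for i unfolding D_def by (rule cyl_append_sub[OF t1(1)])
  have D_Suc: "D i \<inter> cyl (lw (Suc i)) = {}" for i
    unfolding D_def lw_Suc using t1 by (intro cyl_disjoint_same_length) (auto simp: vw_append)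
  have disj: "D i \<inter> D j = {}" if "i < j" for i j
    using D_Suc[of i] D_lw[of j] lw_mono[of "Suc i" j] that by auto
  hence disj: "D i \<inter> D j = {}" if "i \<noteq> j" for i j using that by (metis Int_commute linorder_neqE_nat)
  define e where "e i = cj (npow i g) s" for i
  have gi: "hm (npow i g) (lw 0 @ [1]) (lw i @ [1])" for i
  proof (induction i)
    case 0
    show ?case using goodD(7)[OF good_hm vD] by simp
  next
    case (Suc i)
    have "npow (Suc i) g = g + npow i g" using npow_add[of 1 i g] by simp
    thus ?case using goodD(5)[OF good_hm Suc pr_hm[OF gD[of i]]] by simp
  qed
  have eh: "hm (e i) (lw i @ [1]) (lw i @ [1])" for i
    using goodD(5)[OF good_hm goodD(6)[OF good_hm gi] goodD(5)[OF good_hm h gi[of i]]]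
    by (simp add: e_def cj_def)
  have eD: "ap (e i) ` D i = D i" for i using eh by (simp add: hm_def D_def)
  have eS: "e (Suc i) = cj g (e i)" for i
  proof -
    have "npow (Suc i) g = g + npow i g" using npow_add[of 1 i g] by simp
    thus ?thesis by (simp add: e_def cj_cj)
  qed
  obtain q where q: "\<And>i x. x \<in> D i \<Longrightarrow> ap q x = ap (e i) x" "fixes_on (- \<Union> (range D)) q"
    using glue_bp[of D e, OF disj eD] by blast
  have qD: "ap q x \<in> D i" if "x \<in> D i" for x i using q(1)[OF that] eD that by blast
  have q_out: "ap q x = x" if "x \<notin> \<Union> (range D)" for x using q(2) that by (simp add: fixes_on_def)
  have qU: "fixes_on (- cyl (lw 0)) q"
    using D_lw lw_mono[of 0] by (intro fixes_on_mono[OF q(2)]) blast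
  have "hm q (lw 0) (lw 0)"
  proof (rule hm_selfI)
    show "ap q ` cyl (lw 0) = cyl (lw 0)"
    proof
      show "ap q ` cyl (lw 0) \<subseteq> cyl (lw 0)" using supp_image[OF qU] by blast
      have "fixes_on (- cyl (lw 0)) (- q)" using qU by simp
      thus "cyl (lw 0) \<subseteq> ap q ` cyl (lw 0)"
        using supp_image by (metis ap_ap_uminus image_eqI subsetI)
    qed
    fix x y assume xy: "x \<in> cyl (lw 0)" "y \<in> cyl (lw 0)" "x \<noteq> y"
    have xyX: "x \<in> \<Omega>" "y \<in> \<Omega>" using xy cyl_sub_X[OF vw_lw] by auto
    show "Nagree (ap q x) (ap q y) = Nagree x y"
    proof (cases "\<exists>i. x \<in> D i \<and> y \<in> D i")
      case True
      then obtain i where i: "x \<in> D i" "y \<in> D i" by blast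
      thus ?thesis using hm_Nagree[OF eh[of i], of x y] xy(3) q(1) by (simp add: D_def)
    next
      case False
      \<comment> \<open>The map \<open>q\<close> preserves every \<open>D i\<close>, so it moves
        \<open>a\<close> within a ball not containing \<open>b\<close>, that is, by less than the
        distance of the two points.\<close>
      have near: "ap q a = a \<or> Nagree a b < Nagree a (ap q a)"
        if ab: "a \<in> \<Omega>" "b \<in> \<Omega>" "a \<noteq> b" "\<not> (\<exists>i. a \<in> D i \<and> b \<in> D i)" for a b
      proof (cases "a \<in> \<Union> (range D)")
        case True
        then obtain i where i: "a \<in> D i" by blast
        hence "b \<notin> D i" using ab(4) by blast
        hence "Nagree a b < length (lw i @ [1])"
          using Nagree_cylI[OF i[unfolded D_def] vD ab(2)] unfolding D_def by (meson not_le)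
        moreover have "length (lw i @ [1]) \<le> Nagree a (ap q a)" if "ap q a \<noteq> a"
          using Nagree_cyl[of a "lw i @ [1]" "ap q a"] i qD[OF i] that by (simp add: D_def)
        ultimately show ?thesis by fastforce
      qed (use q_out in simp)
      have F': "\<not> (\<exists>i. y \<in> D i \<and> x \<in> D i)" using False by blast
      show ?thesis
        using Nagree_perturb[OF xy(3) near[OF xyX xy(3) False]] near[OF xyX(2,1) xy(3)[symmetric] F']
        by (simp add: Nagree_commute[of y x])
    qed
  qed simp
  hence qA: "q \<in> AA" using isoms_AA qU by blast
  have s0: "ap s x = x" if "x \<notin> D 0" for x using f that by (simp add: fixes_on_def D_def)
  have e0: "e 0 = s" by (simp add: e_def cj_def)
  \<comment> \<open>Conjugation by \<open>g\<close> shifts all copies by one place, so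
    \<open>cj g q\<close> lacks only the copy \<open>s\<close> on \<open>D 0\<close>. Hence
    \<open>s\<close> is the commutator of \<open>q\<close> and \<open>g\<close>.\<close>
  have "s + cj g q = q"
  proof (rule bp_eqI)
    fix x
    have mv: "ap (- g) x \<in> D i \<longleftrightarrow> x \<in> D (Suc i)" for i
      using gDi[of i] by (metis ap_ap_uminus ap_uminus_ap image_iff)
    have cjx: "ap (cj g q) x = ap g (ap q (ap (- g) x))" by (simp add: cj_def)
    consider (0) "x \<in> D 0" | (S) i where "x \<in> D (Suc i)" | (N) "x \<notin> \<Union> (range D)"
      by (metis UN_E not0_implies_Suc)
    thus "ap (s + cj g q) x = ap q x"
    proof cases
      case 0
      have "x \<notin> D (Suc i)" for i using disj[of 0 "Suc i"] 0 by auto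
      hence "ap (- g) x \<notin> \<Union> (range D)" using mv by blast
      hence "ap (cj g q) x = x" using cjx q_out by simp
      thus ?thesis using q(1)[OF 0] e0 by simp
    next
      case S
      hence "ap (cj g q) x = ap (e (Suc i)) x" using cjx q(1)[of "ap (- g) x" i] mv eS by (simp add: cj_def)
      moreover have "ap (e (Suc i)) x \<in> D (Suc i)" using eD S by blast
      hence "ap (e (Suc i)) x \<notin> D 0" using disj[of 0 "Suc i"] by auto
      ultimately show ?thesis using s0 q(1)[OF S] by simp
    next
      case N
      hence "ap (- g) x \<notin> \<Union> (range D)" using mv by blast
      hence "ap (cj g q) x = x" using cjx q_out by simp
      thus ?thesis using N q_out s0 by auto
    qed
  qed
  hence "s = q - cj g q" by (metis add_diff_cancel)
  also have "\<dots> = comm q g" by (simp add: comm_def cj_def grp del: add_uminus_conv_diff)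
  finally show ?thesis using comm_in_der[OF qA gA] by simp
qed

lemma TT_AA: "TT \<subseteq> AA"
  using TT_VV VV_AA by blast

lemma der_AA_cj_iff: "g \<in> AA \<Longrightarrow> cj g s \<in> der AA \<Longrightarrow> s \<in> der AA"
  using cj_der[OF sgp_AA sgp_neg[OF sgp_AA], of g "cj g s"] by (simp add: cj_cj, simp add: cj_def)

lemma isoms_der: "isoms \<subseteq> der AA"
proof
  fix s assume "s \<in> isoms"
  then obtain w where w: "hm s w w" "fixes_on (- cyl w) s" by (auto simp: isoms_def)
  have "vw w" using w(1) by (simp add: hm_def)
  moreover have "vw (lw 0 @ [1])" using d2 by (simp add: vw_append)
  ultimately obtain g where g: "g \<in> TT" "pr g w (lw 0 @ [1])" using T_transitive_word by blast
  note hg = pr_hm[OF g(2)]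
  have "hm (cj g s) (lw 0 @ [1]) (lw 0 @ [1])"
    using goodD(5)[OF good_hm goodD(6)[OF good_hm hg] goodD(5)[OF good_hm w(1) hg]] by (simp add: cj_def)
  moreover have "fixes_on (- cyl (lw 0 @ [1])) (cj g s)"
    using fixes_on_cj_compl[OF w(2), of g] pr_image[OF g(2)] by simp
  ultimately have "cj g s \<in> der AA" by (rule isoms_der_special)
  thus "s \<in> der AA" using der_AA_cj_iff g(1) TT_AA by blast
qed

text \<open>Exchanging two children of \<open>w\<close> permutes the values of a single letter,
  which leaves the first place of disagreement of two rays unchanged.\<close>

lemma swap_siblings_isoms:
  assumes w: "vw w" shows "swap (w @ [0]) (w @ [1]) \<in> isoms"
proof -
  let ?p = "swap (w @ [0]) (w @ [1])"
  note s = split_words[OF w]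
  have "code [w @ [0], w @ [1]]" using s by (simp add: code_Cons) (simp add: code_def)
  hence m: "mt [w @ [0], w @ [1]] [w @ [1], w @ [0]]" by (rule mt_mset) simp
  have a: "pr ?p (w @ [0]) (w @ [1])" "pr ?p (w @ [1]) (w @ [0])"
    using tp_all2[OF m] by (simp_all add: swap_def)
  have off: "fixes_on (- (cyl (w @ [0]) \<union> cyl (w @ [1]))) ?p" using tp_off[OF m] by (simp add: swap_def)
  have fx: "fixes_on (- cyl w) ?p" by (rule fixes_on_mono[OF off]) (use s in blast)
  define \<tau> where "\<tau> i = (if i = 0 then 1 else if i = 1 then 0 else i)" for i :: nat
  have pri: "pr ?p (w @ [i]) (w @ [\<tau> i])" if i: "i < d" for i
  proof (cases "i = 0 \<or> i = 1")
    case False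
    have vi: "vw (w @ [i])" using w i by (simp add: vw_append)
    have "cyl (w @ [i]) \<inter> cyl (w @ [0]) = {}" "cyl (w @ [i]) \<inter> cyl (w @ [1]) = {}"
      using False s vi by (auto intro!: cyl_disjoint_same_length[THEN equalityD1, THEN subsetD])
    hence "fixes_on (cyl (w @ [i])) ?p" by (intro fixes_on_mono[OF off]) auto
    thus ?thesis using pr_fixed[OF vi] False by (simp add: \<tau>_def)
  qed (use a in \<open>auto simp: \<tau>_def\<close>)
  have "hm ?p w w"
  proof (rule hm_selfI[OF w])
    show "ap ?p ` cyl w = cyl w"
    proof
      show "ap ?p ` cyl w \<subseteq> cyl w" using supp_image[OF fx] by blast
      have "fixes_on (- cyl w) (- ?p)" using fx by simp
      thus "cyl w \<subseteq> ap ?p ` cyl w" using supp_image by (metis ap_ap_uminus image_eqI subsetI)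
    qed
    fix x y assume xy: "x \<in> cyl w" "y \<in> cyl w" "x \<noteq> y"
    have split: "\<exists>i a. i < d \<and> a \<in> Tl \<and> z = (w @ [i]) \<frown> a" if z: "z \<in> cyl w" for z
    proof -
      have "z \<in> un (kids w)" using z by simp
      then obtain v where v: "v \<in> set (kids w)" "z \<in> cyl v" unfolding un_def by blast
      obtain a where "a \<in> Tl" "z = v \<frown> a" using v(2) by (rule cylE)
      thus ?thesis using v(1) by (auto simp: set_kids)
    qed
    obtain i a where i: "i < d" "a \<in> Tl" "x = (w @ [i]) \<frown> a" using split[OF xy(1)] by blast
    obtain j b where j: "j < d" "b \<in> Tl" "y = (w @ [j]) \<frown> b" using split[OF xy(2)] by blast
    have e: "ap ?p x = (w @ [\<tau> i]) \<frown> a" "ap ?p y = (w @ [\<tau> j]) \<frown> b"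
      using pri i j by (auto simp: pr_def)
    have Nd: "Nagree ((w @ [i]) \<frown> a) ((w @ [j]) \<frown> b) = length w" if "i \<noteq> j" for i j :: nat and a b
      using that by (intro Nagree_eqI) (auto simp: cat_def nth_append)
    show "Nagree (ap ?p x) (ap ?p y) = Nagree x y"
    proof (cases "i = j")
      case True
      hence "a \<noteq> b" using xy i j by auto
      thus ?thesis unfolding e unfolding i(3) j(3) using True by (simp add: Nagree_cat)
    next
      case False
      hence "\<tau> i \<noteq> \<tau> j" by (auto simp: \<tau>_def split: if_splits)
      thus ?thesis unfolding e unfolding i(3) j(3) using Nd False by simp
    qed
  qed
  thus ?thesis using fx by (auto simp: isoms_def)
qed

text \<open>T moves any two neighbouring leaves, apart from a code of only two, to the first two
  children of \<open>lw 0\<close>, where the swap is an isometry.\<close>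

lemma swaps_der: "swaps \<subseteq> der AA"
proof
  fix x assume "x \<in> swaps"
  then obtain u v A B where x: "x = swap u v" "cp (A @ [u, v] @ B)" "A @ B \<noteq> []" by (auto simp: swaps_def)
  have "vw (lw 0)" by simp
  then obtain A' B' where P: "cp (A' @ [lw 0] @ B')" using cp_contains by blast
  have ne: "A' @ B' \<noteq> []" using cp_min_length[OF P] k2 by auto
  obtain e where e: "kids (lw 0) = [lw 0 @ [0], lw 0 @ [1]] @ e"
    using kids_ends(1)[of "lw 0"] d2 by (simp add: upt_conv_Cons)
  have Q: "cp (A' @ [lw 0 @ [0], lw 0 @ [1]] @ (e @ B'))" using cp.step[OF P] e by simp
  obtain g where g: "g \<in> TT" "list_all2 (pr g) [u, v] [lw 0 @ [0], lw 0 @ [1]]"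
    using T_transitive[OF x(2,3) Q] ne by auto
  hence pg: "pr g u (lw 0 @ [0])" "pr g v (lw 0 @ [1])" by auto
  have "cj g x = swap (lw 0 @ [0]) (lw 0 @ [1])"
    unfolding x(1) swap_def by (rule cj_tp_all2[OF mt_swap[OF x(2)] mt_swap[OF Q]]) (use pg in simp_all)
  hence "cj g x \<in> der AA" using swap_siblings_isoms[OF vw_lw] isoms_der by auto
  thus "x \<in> der AA" using der_AA_cj_iff g(1) TT_AA by blast
qed

text \<open>Written on the children, \<open>swap u v\<close> is \<open>caret u v\<close> followed by
  a permutation of the leaves \<open>[u] @ kids v\<close>.\<close>

lemma carets_gen_swaps: "carets \<subseteq> gen swaps"
proof
  fix x assume "x \<in> carets"
  then obtain u v A B where x: "x = caret u v" "cp (A @ [u, v] @ B)" "A @ B \<noteq> []" by (auto simp: carets_def)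
  have c: "cp (A @ kids u @ [v] @ B)" "cp (A @ [u] @ kids v @ B)"
    using cp.step[of A u "[v] @ B"] cp.step[of "A @ [u]" v B] x(2) by simp_all
  have m1: "mt (kids u @ [v]) (kids v @ [u])"
  proof -
    have "code (A @ (kids u @ [v]) @ B)" "code (A @ ([u] @ kids v) @ B)"
      using cp_code[OF c(1)] cp_code[OF c(2)] by simp_all
    hence "code (kids u @ [v])" "code ([u] @ kids v)" by (simp_all only: code_append)
    moreover from this have "code (kids v @ [u])" by (simp only: code_append Int_commute simp_thms)
    ultimately show ?thesis by (simp add: mt_def Un_commute)
  qed
  have m2: "mt ([u] @ kids v) (kids v @ [u])" using caret_tp(2)[OF x(2)] m1 mt_sym mt_trans by blast
  have "swap u v = tp (kids u @ [v]) (kids v @ [u])"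
  proof (rule tp_eqI[OF m1, symmetric])
    have "list_all2 (pr (swap u v)) [u, v] [v, u]" unfolding swap_def by (rule tp_all2[OF mt_swap[OF x(2)]])
    thus "list_all2 (pr (swap u v)) (kids u @ [v]) (kids v @ [u])"
      by (auto intro!: list_all2_appendI all2_kids)
    show "fixes_on (- un (kids u @ [v])) (swap u v)"
      using tp_off[OF mt_swap[OF x(2)]] by (simp add: swap_def)
  qed
  moreover have "tp (kids u @ [v]) (kids v @ [u]) = tp ([u] @ kids v) (kids v @ [u]) + caret u v"
    unfolding caret_def by (rule tp_comp[symmetric, OF caret_tp(2)[OF x(2)] m2])
  moreover have "tp ([u] @ kids v) (kids v @ [u]) \<in> gen swaps"
  proof -
    have code: "code (A @ ([u] @ kids v) @ B)" using cp_code[OF c(2)] by simp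
    moreover have ms: "mset (A @ ([u] @ kids v) @ B) = mset (A @ (kids v @ [u]) @ B)" by simp
    ultimately have "code (A @ (kids v @ [u]) @ B)" using mt_mset by (auto simp: mt_def)
    hence "tp (A @ ([u] @ kids v) @ B) (A @ (kids v @ [u]) @ B) = tp ([u] @ kids v) (kids v @ [u])"
      using code by (intro tp_local(1)) auto
    moreover have "3 \<le> length (A @ ([u] @ kids v) @ B)" using x(3) d2 by (cases A; cases B) auto
    ultimately show ?thesis using tp_gen_swaps[of "A @ ([u] @ kids v) @ B" "A @ (kids v @ [u]) @ B"] c(2) ms by simp
  qed
  moreover have "swap u v \<in> gen swaps" using x(2,3) by (intro gen.incl) (auto simp: swaps_def)
  ultimately show "x \<in> gen swaps" unfolding x(1) using sgp_add_left[OF sgp_gen] by metis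
qed

lemma AA_perfect: "AA \<subseteq> der AA"
proof -
  have "gen swaps \<subseteq> der AA" by (rule gen_le[OF sgp_der swaps_der])
  hence "gen (carets \<union> swaps) \<subseteq> der AA" using carets_gen_swaps swaps_der by (intro gen_le[OF sgp_der]) blast
  hence "gen (VV \<union> isoms) \<subseteq> der AA" using VV_gen isoms_der by (intro gen_le[OF sgp_der]) blast
  thus ?thesis using AA_gen by blast
qed

lemma AA_fixers: "AA \<subseteq> gen (fixers AA)"
proof -
  have "isoms \<subseteq> fixers AA"
  proof
    fix p assume "p \<in> isoms"
    then obtain w where w: "hm p w w" "fixes_on (- cyl w) p" by (auto simp: isoms_def)
    have v: "vw w" using w(1) by (simp add: hm_def)
    have "\<Omega> - cyl w \<noteq> {}" using cyl_neq_X[OF v] cyl_sub_X[OF v] by blast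
    then obtain x where x: "x \<in> \<Omega>" "x \<notin> cyl w" by blast
    let ?u = "pre (length w) x"
    have u: "vw ?u" "x \<in> cyl ?u" using x X_pre X_in_cyl vw_length[OF v] by auto
    have "cyl ?u \<inter> cyl w = {}" using x(2) u by (intro cyl_disjoint_same_length[OF u(1) v]) auto
    hence "fixes_on (cyl ?u) p" by (intro fixes_on_mono[OF w(2)]) auto
    thus "p \<in> fixers AA" using isoms_AA[OF w] u(1) by (auto simp: fixers_def)
  qed
  hence "gen (fixers VV) \<subseteq> gen (fixers AA)" "isoms \<subseteq> gen (fixers AA)"
    using fixers_mono[OF VV_AA] by (auto intro!: gen_le[OF sgp_gen] gen.incl)
  hence "gen (VV \<union> isoms) \<subseteq> gen (fixers AA)" using VV_fixers by (intro gen_le[OF sgp_gen]) blast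
  thus ?thesis using AA_gen by blast
qed

text \<open>Take \<open>u\<close> around a point of \<open>cyl w\<close> outside its image, so small
  that the preimage of \<open>cyl u\<close> under \<open>t\<close> lies in a ball disjoint from
  \<open>cyl w\<close>. Then \<open>cyl u\<close> misses the image of \<open>cyl w\<close>, which
  contains all forward images of \<open>cyl u\<close>.\<close>

lemma contracted_ball:
  assumes t: "t \<in> AA" and w: "vw w" and c: "ap t ` cyl w \<subset> cyl w"
  obtains u where "vw u" "\<And>i. i > 0 \<Longrightarrow> ap (npow i t) ` cyl u \<inter> cyl u = {}"
proof -
  obtain x where x: "x \<in> cyl w" "x \<notin> ap t ` cyl w" using c by blast
  have xX: "x \<in> \<Omega>" using x cyl_sub_X[OF w] by blast
  have "locally hm (- t)" using locally_neg[OF good_hm] t by (simp add: AA_def)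
  then obtain n where n: "\<And>u. vw u \<Longrightarrow> n < length u \<Longrightarrow> \<exists>v. hm (- t) u v \<and> length u \<le> length v + n"
    using locally_long[OF good_hm] by blast
  \<comment> \<open>Deep enough for the word \<open>v\<close> of the ball containing the preimage to
    be at least as long as \<open>w\<close>. Since that ball also has a point outside
    \<open>cyl w\<close>, the two are disjoint.\<close>
  define m where "m = Suc (n + length w)"
  define u where "u = pre m x"
  have u: "vw u" "x \<in> cyl u" "length u = m" using xX X_pre X_in_cyl by (auto simp: u_def m_def)
  have uw: "cyl u \<subseteq> cyl w" unfolding u_def by (rule cyl_pre_sub[OF x(1) w]) (simp add: m_def)
  obtain v where v: "hm (- t) u v" "length w \<le> length v" using n[OF u(1)] u(3) by (auto simp: m_def)
  have vv: "vw v" using v(1) by (simp add: hm_def)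
  have y: "ap (- t) x \<in> cyl v" "ap (- t) x \<notin> cyl w"
    using hm_in[OF v(1) u(2)] x(2) by (auto, metis ap_ap_uminus image_eqI)
  have vw: "cyl v \<inter> cyl w = {}"
  proof (rule ccontr)
    assume "cyl v \<inter> cyl w \<noteq> {}"
    then obtain z where "z \<in> cyl w" "z \<in> cyl v" by blast
    then obtain s where "v = w @ s" "tw s" using cyl_meet_prefix[OF _ _ w vv v(2)] by blast
    thus False using y cyl_append_sub by blast
  qed
  have ut: "cyl u \<inter> ap t ` cyl w = {}"
  proof (rule ccontr)
    assume "cyl u \<inter> ap t ` cyl w \<noteq> {}"
    then obtain y where y: "y \<in> cyl w" "ap t y \<in> cyl u" by blast
    hence "y \<in> cyl v" using hm_in[OF v(1) y(2)] by simp
    thus False using vw y(1) by blast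
  qed
  have "ap (npow i t) ` cyl w \<subseteq> ap t ` cyl w" if i: "i > 0" for i
  proof -
    have "ap (npow j t) ` cyl w \<subseteq> cyl w" for j
    proof (induction j)
      case (Suc j)
      have "ap (npow (Suc j) t) ` cyl w = ap (npow j t) ` ap t ` cyl w" by (simp add: image_image)
      thus ?case using Suc c by blast
    qed simp
    moreover obtain j where "i = 1 + j" using i by (cases i) auto
    moreover have "ap (npow (1 + j) t) ` cyl w = ap t ` ap (npow j t) ` cyl w" for j
      unfolding npow_add by (simp add: image_image)
    ultimately show ?thesis by blast
  qed
  hence "ap (npow i t) ` cyl u \<inter> cyl u = {}" if "i > 0" for i using ut uw that by blast
  thus ?thesis using that u(1) by blast
qed

end

section \<open>Transfer to the group of almost automorphisms\<close>

context tree
begin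

abbreviation GG where "GG \<equiv> AAut_group d k"

lemma AAut_bij: "f \<in> AAut d k \<Longrightarrow> bij f"
proof -
  assume "f \<in> AAut d k"
  hence f: "bij_betw f \<Omega> \<Omega>" "\<And>x. x \<notin> \<Omega> \<Longrightarrow> f x = x" by (auto simp: AAut_def bhomeo_def)
  have "bij_betw f (- \<Omega>) (- \<Omega>)" using f(2) by (intro bij_betw_byWitness[where f' = f]) auto
  from bij_betw_combine[OF f(1) this] show "bij f" by simp
qed

lemma AAut_eq: "AAut d k = ap ` AA"
proof
  show "AAut d k \<subseteq> ap ` AA"
  proof
    fix f assume f: "f \<in> AAut d k"
    hence "ap (Abs_bp f) = f" by (simp add: AAut_bij)
    thus "f \<in> ap ` AA" using f AA_iff by (metis image_eqI)
  qed
qed (use AA_iff in auto)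

lemma carrier_GG: "carrier GG = ap ` AA" and mult_GG: "f \<otimes>\<^bsub>GG\<^esub> g = f \<circ> g" and one_GG: "\<one>\<^bsub>GG\<^esub> = id"
  by (simp_all add: AAut_group_def AAut_eq)

lemma mult_ap: "ap p \<otimes>\<^bsub>GG\<^esub> ap q = ap (p + q)" and one_ap: "\<one>\<^bsub>GG\<^esub> = ap 0"
  by (simp_all add: mult_GG one_GG)

lemma group_GG: "group GG"
proof (rule groupI)
  fix x y assume x: "x \<in> carrier GG" and y: "y \<in> carrier GG"
  thus "x \<otimes>\<^bsub>GG\<^esub> y \<in> carrier GG" using sgp_add[OF sgp_AA] by (auto simp: carrier_GG mult_ap simp del: ap_plus)
  fix z show "x \<otimes>\<^bsub>GG\<^esub> y \<otimes>\<^bsub>GG\<^esub> z = x \<otimes>\<^bsub>GG\<^esub> (y \<otimes>\<^bsub>GG\<^esub> z)" by (simp add: mult_GG o_assoc)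
next
  fix x assume "x \<in> carrier GG"
  then obtain p where p: "p \<in> AA" "x = ap p" by (auto simp: carrier_GG)
  have "ap (- p) \<in> carrier GG" using sgp_neg[OF sgp_AA p(1)] by (auto simp: carrier_GG)
  moreover have "ap (- p) \<otimes>\<^bsub>GG\<^esub> x = \<one>\<^bsub>GG\<^esub>" unfolding p(2) mult_ap one_ap by simp
  ultimately show "\<exists>y\<in>carrier GG. y \<otimes>\<^bsub>GG\<^esub> x = \<one>\<^bsub>GG\<^esub>" by blast
qed (use sgp_0[OF sgp_AA] in \<open>auto simp: carrier_GG one_ap mult_ap simp del: ap_0 ap_plus\<close>)

lemma inv_ap: "p \<in> AA \<Longrightarrow> inv\<^bsub>GG\<^esub> (ap p) = ap (- p)"
  using sgp_neg[OF sgp_AA]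
  by (intro group.inv_equality[OF group_GG]) (auto simp: carrier_GG mult_ap one_ap)

lemma comm_ap:
  "p \<in> AA \<Longrightarrow> q \<in> AA \<Longrightarrow> ap p \<otimes>\<^bsub>GG\<^esub> ap q \<otimes>\<^bsub>GG\<^esub> inv\<^bsub>GG\<^esub> (ap p) \<otimes>\<^bsub>GG\<^esub> inv\<^bsub>GG\<^esub> (ap q) = ap (comm p q)"
  by (simp add: inv_ap mult_ap comm_def del: ap_plus ap_diff)

lemma derived_ap:
  assumes H: "H \<subseteq> AA" "sgp H"
  shows "derived GG (ap ` H) = ap ` der H"
proof
  define C where "C = {comm a b | a b. a \<in> H \<and> b \<in> H}"
  have S: "derived_set GG (ap ` H) = ap ` C"
    using comm_ap H(1) unfolding C_def by (auto simp: subset_iff)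
  have d: "derived GG (ap ` H) = generate GG (ap ` C)" "der H = gen C"
    by (simp_all only: derived_def S der_def C_def)
  have CA: "C \<subseteq> AA" unfolding C_def using comm_in_sgp[OF sgp_AA] H(1) by blast
  hence genA: "gen C \<subseteq> AA" by (rule gen_le[OF sgp_AA])
  show "derived GG (ap ` H) \<subseteq> ap ` der H" unfolding d
  proof
    fix f assume "f \<in> generate GG (ap ` C)"
    thus "f \<in> ap ` gen C"
    proof induction
      case one
      show ?case unfolding one_ap by (rule imageI) (rule gen.zero)
    next
      case (incl h)
      thus ?case by (auto intro: gen.incl)
    next
      case (inv h)
      then obtain c where c: "h = ap c" "c \<in> C" by blast
      hence "inv\<^bsub>GG\<^esub> h = ap (- c)" using inv_ap CA by auto
      moreover have "- c \<in> gen C" using c(2) by (intro gen.neg gen.incl)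
      ultimately show ?case by blast
    next
      case (eng h1 h2)
      then obtain a b where "h1 = ap a" "h2 = ap b" "a \<in> gen C" "b \<in> gen C" by blast
      moreover from this have "a + b \<in> gen C" by (intro gen.add)
      ultimately show ?case by (simp only: mult_ap imageI)
    qed
  qed
  have cl: "ap ` C \<subseteq> carrier GG" unfolding carrier_GG using CA by blast
  have "ap p \<in> generate GG (ap ` C)" if "p \<in> gen C" for p
    using that
  proof induction
    case zero
    show ?case using generate.one[of GG] by (simp only: one_ap)
  next
    case (incl a)
    thus ?case by (intro generate.incl) blast
  next
    case (add a b)
    thus ?case using generate.eng[of "ap a" GG "ap ` C" "ap b"] by (simp only: mult_ap)
  next
    case (neg a)
    hence "a \<in> AA" using genA by blast
    thus ?case using group.generate_m_inv_closed[OF group_GG cl neg.IH] by (simp only: inv_ap)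
  qed
  thus "ap ` der H \<subseteq> derived GG (ap ` H)" unfolding d by blast
qed

lemma image_grp: "Fgrp d k = ap ` FF" "Vgrp d k = ap ` VV" "Tgrp d k = ap ` TT"
proof -
  have key: "S = ap ` {p. ap p \<in> S}" if "S \<subseteq> AAut d k" for S
    using that AAut_eq by auto
  have V: "Vgrp d k \<subseteq> AAut d k" by (auto simp: Vgrp_def)
  have F: "Fgrp d k \<subseteq> AAut d k" and T: "Tgrp d k \<subseteq> AAut d k" using V by (auto simp: Fgrp_def Tgrp_def)
  show "Fgrp d k = ap ` FF" by (subst key[OF F]) (simp only: FF_iff Collect_mem_eq)
  show "Vgrp d k = ap ` VV" by (subst key[OF V]) (simp only: VV_iff Collect_mem_eq)
  show "Tgrp d k = ap ` TT" by (subst key[OF T]) (simp only: TT_iff Collect_mem_eq)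
qed

lemma sgp_preimage:
  assumes "subgroup \<Lambda> GG"
  shows "sgp {p. ap p \<in> \<Lambda>}" "{p. ap p \<in> \<Lambda>} \<subseteq> AA" "\<Lambda> = ap ` {p. ap p \<in> \<Lambda>}"
proof -
  have sub: "\<Lambda> \<subseteq> ap ` AA" using subgroup.subset[OF assms] by (simp add: carrier_GG)
  show A: "{p. ap p \<in> \<Lambda>} \<subseteq> AA" 
  proof
    fix p assume "p \<in> {p. ap p \<in> \<Lambda>}"
    hence "ap p \<in> ap ` AA" using sub by auto
    thus "p \<in> AA" by (metis ap_inject imageE)
  qed
  show "\<Lambda> = ap ` {p. ap p \<in> \<Lambda>}" using sub by auto
  show "sgp {p. ap p \<in> \<Lambda>}"
    unfolding sgp_def
  proof (intro conjI ballI)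
    show "0 \<in> {p. ap p \<in> \<Lambda>}" using subgroup.one_closed[OF assms] by (simp add: one_GG)
    fix a assume a: "a \<in> {p. ap p \<in> \<Lambda>}"
    show "- a \<in> {p. ap p \<in> \<Lambda>}" using subgroup.m_inv_closed[OF assms, of "ap a"] a A inv_ap by auto
    fix b assume "b \<in> {p. ap p \<in> \<Lambda>}"
    thus "a + b \<in> {p. ap p \<in> \<Lambda>}" using subgroup.m_closed[OF assms, of "ap a" "ap b"] a by (simp add: mult_GG)
  qed
qed

text \<open>Only a weak consequence of commensuration is used: some power of each element of
  \<open>\<Lambda>\<close> is conjugated into \<open>\<Lambda>\<close>.\<close>
lemma commensurated_power:
  assumes \<Lambda>: "subgroup \<Lambda> GG" and c: "commensurated_by GG G \<Lambda>"
    and g: "g \<in> AA" "ap (- g) \<in> G" and \<tau>: "ap \<tau> \<in> \<Lambda>"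
  shows "\<exists>n>0. ap (cj g (npow n \<tau>)) \<in> \<Lambda>"
proof -
  note L = sgp_preimage[OF \<Lambda>]
  \<comment> \<open>The commensuration is applied to the inverse of \<open>g\<close>, so that
    \<open>K\<close> consists of those elements of \<Lambda> that \<open>g\<close> conjugates into
    \<Lambda>.\<close>
  define K where "K = ((\<lambda>x. ap (- g) \<otimes>\<^bsub>GG\<^esub> x \<otimes>\<^bsub>GG\<^esub> inv\<^bsub>GG\<^esub> (ap (- g))) ` \<Lambda>) \<inter> \<Lambda>"
  have fin: "finite (rcosets\<^bsub>GG\<lparr>carrier := \<Lambda>\<rparr>\<^esub> K)"
    using c g(2) unfolding commensurated_by_def K_def by blast
  have ng: "- g \<in> AA" using sgp_neg[OF sgp_AA g(1)] .
  have conj: "ap (- g) \<otimes>\<^bsub>GG\<^esub> ap x \<otimes>\<^bsub>GG\<^esub> inv\<^bsub>GG\<^esub> (ap (- g)) = ap (cj (- g) x)" for x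
    using inv_ap[OF ng] by (simp add: mult_ap cj_def del: ap_plus)
  have K_iff: "ap x \<in> K \<longleftrightarrow> ap x \<in> \<Lambda> \<and> ap (cj g x) \<in> \<Lambda>" for x
  proof -
    have "ap x \<in> (\<lambda>x. ap (- g) \<otimes>\<^bsub>GG\<^esub> x \<otimes>\<^bsub>GG\<^esub> inv\<^bsub>GG\<^esub> (ap (- g))) ` \<Lambda> \<longleftrightarrow> (\<exists>y. ap y \<in> \<Lambda> \<and> ap x = ap (cj (- g) y))"
      by (subst L(3)) (auto simp: image_iff conj)
    also have "\<dots> \<longleftrightarrow> ap (cj g x) \<in> \<Lambda>"
    proof
      assume "\<exists>y. ap y \<in> \<Lambda> \<and> ap x = ap (cj (- g) y)"
      then obtain y where "ap y \<in> \<Lambda>" "x = cj (- g) y" using ap_inject by blast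
      thus "ap (cj g x) \<in> \<Lambda>" by (simp add: cj_cj) (simp add: cj_def)
    next
      assume "ap (cj g x) \<in> \<Lambda>"
      moreover have "x = cj (- g) (cj g x)" by (simp add: cj_cj) (simp add: cj_def)
      ultimately show "\<exists>y. ap y \<in> \<Lambda> \<and> ap x = ap (cj (- g) y)" by metis
    qed
    finally show ?thesis by (auto simp: K_def)
  qed
  \<comment> \<open>Pigeonhole: two of the cosets of \<open>K\<close> by powers of \<tau> coincide,
    so a positive power of \<tau> lies in \<open>K\<close>.\<close>
  define f where "f i = K #>\<^bsub>GG\<lparr>carrier := \<Lambda>\<rparr>\<^esub> ap (npow i \<tau>)" for i :: nat
  have np: "ap (npow i \<tau>) \<in> \<Lambda>" for i using npow_in_sgp[OF L(1), of \<tau> i] \<tau> by simp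
  have "range f \<subseteq> rcosets\<^bsub>GG\<lparr>carrier := \<Lambda>\<rparr>\<^esub> K"
    using np by (auto simp: f_def RCOSETS_def)
  hence "finite (range f)" using fin finite_subset by blast
  hence "\<not> inj f" using finite_imageD infinite_UNIV_nat by blast
  then obtain i j where ij: "i < j" "f i = f j" unfolding inj_def by (metis linorder_neqE_nat)
  have "ap 0 \<in> K" unfolding K_iff using sgp_0[OF L(1)] by simp
  hence "ap 0 \<otimes>\<^bsub>GG\<^esub> ap (npow j \<tau>) \<in> f j" by (auto simp: f_def r_coset_def simp del: ap_0)
  hence "ap (npow j \<tau>) \<in> f i" unfolding ij(2) mult_ap by simp
  then obtain h where h: "h \<in> K" "ap (npow j \<tau>) = h \<otimes>\<^bsub>GG\<^esub> ap (npow i \<tau>)" by (auto simp: f_def r_coset_def)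
  obtain y where y: "h = ap y" using h(1) L(3) unfolding K_def by blast
  have "npow j \<tau> = y + npow i \<tau>" using h(2) unfolding y mult_ap by (simp only: ap_inject)
  hence "npow (j - i) \<tau> + npow i \<tau> = y + npow i \<tau>" using ij(1) by (simp flip: npow_add)
  hence "npow (j - i) \<tau> = y" by simp
  hence "ap (cj g (npow (j - i) \<tau>)) \<in> \<Lambda>" using h(1) K_iff[of y] y by simp
  thus ?thesis using ij(1) by (intro exI[of _ "j - i"]) simp
qed

lemma translation_ball:
  assumes \<Lambda>: "subgroup \<Lambda> GG" and h: "h \<in> \<Lambda>" "is_translation d k h"
  obtains t u where "ap t \<in> \<Lambda>" "vw u" "\<And>i. i > 0 \<Longrightarrow> ap (npow i t) ` cyl u \<inter> cyl u = {}"
proof -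
  note L = sgp_preimage[OF \<Lambda>]
  obtain B and n :: int where B: "is_ball d k B" "(h [^]\<^bsub>GG\<^esub> n) ` B \<subset> B"
    using h(2) by (auto simp: is_translation_def)
  have "h [^]\<^bsub>GG\<^esub> n \<in> \<Lambda>" using group.subgroup_int_pow_closed[OF group_GG \<Lambda> h(1)] .
  then obtain t where t: "h [^]\<^bsub>GG\<^esub> n = ap t" "ap t \<in> \<Lambda>" using L(3) by blast
  have tA: "t \<in> AA" using L(2) t(2) by blast
  \<comment> \<open>The definition \<open>is_ball\<close> admits the whole boundary, which a
    bijection cannot map into a proper part of itself.\<close>
  have "ap t ` \<Omega> = \<Omega>" using bij_betw_fixes_on[OF AA_fixes[OF tA]] by (simp add: bij_betw_def)
  hence "B \<noteq> \<Omega>" using B(2) t(1) by auto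
  then obtain w where w: "vw w" "B = cyl w" using is_ball_cases[OF B(1)] by blast
  show ?thesis
    using contracted_ball[OF tA w(1)] B(2) t w(2) that by metis
qed

lemma le_of_commensurated:
  assumes G: "G = derived GG (Fgrp d k) \<or> (G = Tgrp d k \<and> gcd k (d - 1) = 1)
      \<or> G = derived GG (Vgrp d k) \<or> G = AAut d k"
    and \<Lambda>: "subgroup \<Lambda> GG" and c: "commensurated_by GG G \<Lambda>"
    and tr: "\<exists>h\<in>\<Lambda>. is_translation d k h"
  shows "G \<subseteq> \<Lambda>"
proof -
  note L = sgp_preimage[OF \<Lambda>]
  let ?L = "{p. ap p \<in> \<Lambda>}"
  obtain t u where t: "ap t \<in> \<Lambda>" "vw u" "\<And>i. i > 0 \<Longrightarrow> ap (npow i t) ` cyl u \<inter> cyl u = {}"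
    using tr translation_ball[OF \<Lambda>] by metis
  have FA: "FF \<subseteq> AA" using FF_VV VV_AA by blast
  have wc: "\<exists>n>0. cj g (npow n \<tau>) \<in> ?L" if "G = ap ` der H" "H \<subseteq> AA" "sgp H" "g \<in> der H" "\<tau> \<in> ?L" for H g \<tau>
  proof -
    have "g \<in> AA" using der_le[OF that(3)] that by blast
    moreover have "ap (- g) \<in> G" using that sgp_neg[OF sgp_der] by blast
    ultimately show ?thesis using commensurated_power[OF \<Lambda> c] that(5) by blast
  qed
  have big: "G \<subseteq> \<Lambda>" if "G = ap ` der H" "TT \<subseteq> H" "H \<subseteq> AA" "sgp H" "H \<subseteq> gen (fixers H)" for H
  proof -
    have "der H \<subseteq> ?L"
      by (rule der_le_of_commensurated[OF that(2-5) L(1) wc[OF that(1,3,4)] _ t(3) t(2)]) (use t(1) in auto)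
    thus ?thesis using that(1) by blast
  qed
  from G consider (F) "G = derived GG (Fgrp d k)" | (T) "G = Tgrp d k" "gcd k (d - 1) = 1"
    | (V) "G = derived GG (Vgrp d k)" | (A) "G = AAut d k" by blast
  thus ?thesis
  proof cases
    case F
    hence e: "G = ap ` der FF" using derived_ap[OF FA sgp_FF] image_grp by simp
    have "der FF \<subseteq> ?L"
      by (rule der_FF_le[OF L(1) wc[OF e FA sgp_FF] _ t(3) t(2)]) (use t(1) in auto)
    thus ?thesis using e by blast
  next
    case T
    have "der TT = TT" using TT_perfect[OF T(2)] der_le[OF sgp_TT] by blast
    hence "G = ap ` der TT" using T(1) image_grp by simp
    thus ?thesis using big TT_AA sgp_TT TT_fixers[OF T(2)] by blast
  next
    case V
    hence "G = ap ` der VV" using derived_ap[OF VV_AA sgp_VV] image_grp by simp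
    thus ?thesis using big TT_VV VV_AA sgp_VV VV_fixers by blast
  next
    case A
    have "der AA = AA" using AA_perfect der_le[OF sgp_AA] by blast
    hence "G = ap ` der AA" using A AAut_eq by simp
    thus ?thesis using big TT_AA sgp_AA AA_fixers by blast
  qed
qed

end

theorem mainTheorem13:
  fixes d k :: nat and G \<Lambda> :: "((nat \<Rightarrow> nat) \<Rightarrow> (nat \<Rightarrow> nat)) set"
  assumes "d \<ge> 2" and "k \<ge> 2"
    and "G = derived (AAut_group d k) (Fgrp d k)
         \<or> (G = Tgrp d k \<and> gcd k (d - 1) = 1)
         \<or> G = derived (AAut_group d k) (Vgrp d k)
         \<or> G = AAut d k"
    and "subgroup \<Lambda> (AAut_group d k)"
    and "commensurated_by (AAut_group d k) G \<Lambda>"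
    and "\<exists>h\<in>\<Lambda>. is_translation d k h"
  shows "G \<subseteq> \<Lambda>"
proof -
  interpret tree d k using assms(1,2) by unfold_locales
  show ?thesis using assms(3-6) by (rule le_of_commensurated)
qed

end
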